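(* Let $A$ be a nonnegative linear operator on a Banach space $X$. Fix $u\in X$ and $\lambda>0$. (i) If $A^su=\lambda^su$ for some $0<s<2$, then $u\in D(\log(A))$ and $\log(A)u=(\log\lambda)u$. (ii) If, in addition, $A$ is one-to-one, then any of the following statements (1) $A^su=\lambda^su$ for some $0<s<2$ (or, equivalently, for all $s>0$); (2) $A^{-s}u=\lambda^{-s}u$ for some $0<s<2$ (or, equivalently, for all $s>0$); implies $\log(A)u=(\log\lambda)u$. (iii) If $0\in\rho(A)$, then the converse holds: if $\log(A)u=(\log\lambda)u$, where here $-\log(A)$ denotes the infinitesimal generator of the semigroup $\{A^{-s}\}_{s\geq0}$, i.e. if $\lim_{s\to0^+}\frac{A^{-s}u-u}{s}$ exists in $X$ and equals $-(\log\lambda)u$, then both (1) and (2) hold.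
   Context: $X$ is a Banach space and $I$ its identity operator. A linear operator $A:D(A)\subset X\to X$, with range $R(A)$, is nonnegative if for every $\mu>0$ the operator $\mu I+A:D(A)\to X$ is bijective with bounded inverse, and $\sup_{\mu>0}\|\mu(\mu I+A)^{-1}\|<\infty$. We write $0\in\rho(A)$ if $A:D(A)\to X$ is bijective with bounded inverse, and $0\in\sigma(A)$ otherwise. If $A$ is nonnegative and one-to-one, then $A^{-1}$ (with domain $R(A)$) is also nonnegative. Positive fractional powers $A^s$, $s>0$, of a nonnegative operator $A$: (a) If $A$ is bounded, $A^s=J^s$, where (integrals are Bochner integrals): for $0<s<1$, $D(J^s)=D(A)$ and $J^su=\frac{\sin(s\pi)}{\pi}\int_0^\infty\mu^{s-1}(\mu I+A)^{-1}Au\,d\mu$; for $s=1$, $D(J^s)=D(A^2)$ and $J^su=\frac{\sin(s\pi)}{\pi}\int_0^\infty\mu^{s-1}\big[(\mu I+A)^{-1}-\frac{\mu}{\mu^2+1}I\big]Au\,d\mu+\sin(s\pi/2)Au$; for $n<s<n+1$, $n\in\{1,2,\dots\}$, $D(J^s)=D(A^{n+1})$ and $J^su=J^{s-n}A^nu$; for $s=n+1$, $n\in\{1,2,\dots\}$, $D(J^s)=D(A^{n+2})$ and $J^su=J^{s-n}A^nu$. (b) If $A$ is unbounded and $0\in\rho(A)$, $A^s=[(A^{-1})^s]^{-1}$. (c) If $A$ is unbounded and $0\in\sigma(A)$, $A^su=\lim_{\varepsilon\to0^+}(A+\varepsilon I)^su$, with $D(A^s)$ the set of all $u$ that belong to $D((A+\varepsilon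 I)^s)$ for all $\varepsilon>0$ close to zero and for which the limit exists in $X$. Negative fractional powers: if $A$ is nonnegative and one-to-one, $A^{-s}:=(A^{-1})^s$ for $s>0$; it equals the inverse $(A^s)^{-1}$ of $A^s$. If $0\in\rho(A)$, each $A^{-s}$ is bounded with domain $X$; $A^0=I$. An equation $A^{\pm s}u=\lambda^{\pm s}u$ includes the assertion that $u\in D(A^{\pm s})$. Logarithm (used in (i) and (ii)): $\log(A)u=\lim_{s\to0^+}\frac1s(A^su-u)$, with $D(\log(A))$ the set of $u\in X$ (belonging to $D(A^s)$ for all small $s>0$) for which this limit exists in $X$. The logarithm used in (iii) is the one specified there: $-\log(A)u=\lim_{s\to0^+}\frac1s(A^{-s}u-u)$, with domain the set of $u\in X$ for which the limit exists in $X$. An equation $\log(A)u=(\log\lambda)u$ includes the assertion that $u$ is in the domain of $\log(A)$. *)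

theory Defs
  imports "HOL-Analysis.Analysis"
begin

text \<open>
  A linear operator \<open>A : D(A) \<subseteq> X \<rightarrow> X\<close> is represented by its graph, so that
  \<open>D(A)\<close> is \<^const>\<open>Domain\<close>, \<open>R(A)\<close> is \<^const>\<open>Range\<close>, the inverse is the converse relation,
  \<open>A^n\<close> (with its natural domain) is relational power, and \<open>Au = v\<close>, including the assertion
  \<open>u \<in> D(A)\<close>, is \<open>(u, v) \<in> A\<close>. The scalars are real; a complex Banach space with a
  complex-linear operator is a special case, as no complex scalar occurs below.
\<close>

definition linear_operator :: "('a::real_normed_vector \<times> 'a) set \<Rightarrow> bool" where
  "linear_operator A \<longleftrightarrow> single_valued A \<and> subspace A"

text \<open>Meaningful only for \<open>u\<close> in the domain of a single-valued \<open>A\<close>.\<close>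

definition app :: "('a \<times> 'a) set \<Rightarrow> 'a \<Rightarrow> 'a" where
  "app A u = (THE v. (u, v) \<in> A)"

text \<open>The operator \<open>\<mu>I + A\<close> with domain \<open>D(A)\<close>.\<close>

definition shift :: "real \<Rightarrow> ('a::real_normed_vector \<times> 'a) set \<Rightarrow> ('a \<times> 'a) set" where
  "shift \<mu> A = {(u, \<mu> *\<^sub>R u + v) | u v. (u, v) \<in> A}"

text \<open>\<open>A : D(A) \<rightarrow> X\<close> is bijective with bounded inverse, i.e. \<open>0 \<in> \<rho>(A)\<close>.\<close>

definition zero_in_resolvent_set :: "('a::real_normed_vector \<times> 'a) set \<Rightarrow> bool" where
  "zero_in_resolvent_set A \<longleftrightarrow>
     bij_betw (app A) (Domain A) UNIV \<and> bounded_linear (app (A\<inverse>))"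

definition resolvent :: "('a::real_normed_vector \<times> 'a) set \<Rightarrow> real \<Rightarrow> 'a \<Rightarrow> 'a" where
  "resolvent A \<mu> = app ((shift \<mu> A)\<inverse>)"

definition nonnegative_operator :: "('a::real_normed_vector \<times> 'a) set \<Rightarrow> bool" where
  "nonnegative_operator A \<longleftrightarrow>
     linear_operator A \<and>
     (\<forall>\<mu>>0. zero_in_resolvent_set (shift \<mu> A)) \<and>
     bdd_above ((\<lambda>\<mu>. onorm (\<lambda>f. \<mu> *\<^sub>R resolvent A \<mu> f)) ` {0<..})"

definition bounded_operator :: "('a::real_normed_vector \<times> 'a) set \<Rightarrow> bool" where
  "bounded_operator A \<longleftrightarrow> (\<exists>K. \<forall>u\<in>Domain A. norm (app A u) \<le> K * norm u)"

text \<open>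
  The library's \<^const>\<open>has_bochner_integral\<close> requires a second countable codomain. The following is
  the same definition without that restriction, so that \<open>X\<close> may be nonseparable.
\<close>

definition bochner_has_integral ::
    "'m measure \<Rightarrow> ('m \<Rightarrow> 'a::real_normed_vector) \<Rightarrow> 'a \<Rightarrow> bool" where
  "bochner_has_integral M f x \<longleftrightarrow>
     f \<in> borel_measurable M \<and>
     (\<exists>s. (\<forall>i::nat. Bochner_Integration.simple_bochner_integrable M (s i)) \<and>
          (\<lambda>i. \<integral>\<^sup>+t. ennreal (norm (f t - s i t)) \<partial>M) \<longlonglongrightarrow> 0 \<and>
          (\<lambda>i. Bochner_Integration.simple_bochner_integral M (s i)) \<longlonglongrightarrow> x)"

definition bochner_integral :: "'m measure \<Rightarrow> ('m \<Rightarrow> 'a::real_normed_vector) \<Rightarrow> 'a" where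
  "bochner_integral M f =
     (if \<exists>x. bochner_has_integral M f x then THE x. bochner_has_integral M f x else 0)"

abbreviation bochner_integral_pos :: "(real \<Rightarrow> 'a::real_normed_vector) \<Rightarrow> 'a" where
  "bochner_integral_pos f \<equiv> bochner_integral lborel (\<lambda>\<mu>. indicator {0<..} \<mu> *\<^sub>R f \<mu>)"

text \<open>The operator \<open>J^s\<close> built from \<open>A\<close>, for \<open>0 < s < 1\<close> and for \<open>s = 1\<close>.\<close>

definition J_below_one :: "('a::real_normed_vector \<times> 'a) set \<Rightarrow> real \<Rightarrow> ('a \<times> 'a) set" where
  "J_below_one A s =
     {(u, (sin (s * pi) / pi) *\<^sub>R
            bochner_integral_pos (\<lambda>\<mu>. (\<mu> powr (s - 1)) *\<^sub>R resolvent A \<mu> (app A u)))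
      | u. u \<in> Domain A}"

definition J_one :: "('a::real_normed_vector \<times> 'a) set \<Rightarrow> real \<Rightarrow> ('a \<times> 'a) set" where
  "J_one A s =
     {(u, (sin (s * pi) / pi) *\<^sub>R
            bochner_integral_pos (\<lambda>\<mu>. (\<mu> powr (s - 1)) *\<^sub>R
              (resolvent A \<mu> (app A u) - (\<mu> / (\<mu>\<^sup>2 + 1)) *\<^sub>R app A u))
          + sin (s * pi / 2) *\<^sub>R app A u)
      | u. u \<in> Domain (A ^^ 2)}"

text \<open>
  For \<open>n < s \<le> n + 1\<close> the exponent \<open>s - n\<close> lies in \<open>(0, 1]\<close>. The composite
  \<open>u \<mapsto> J^(s-n) (A^n u)\<close> has domain \<open>D(A^(n+1))\<close> if \<open>s < n + 1\<close> and \<open>D(A^(n+2))\<close> if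
  \<open>s = n + 1\<close>, as \<open>J^(s-n)\<close> has domain \<open>D(A)\<close> and \<open>D(A^2)\<close> respectively.
\<close>

definition J :: "('a::real_normed_vector \<times> 'a) set \<Rightarrow> real \<Rightarrow> ('a \<times> 'a) set" where
  "J A s =
     (let n = nat (\<lceil>s\<rceil> - 1); t = s - real n
      in A ^^ n O (if t < 1 then J_below_one A t else J_one A t))"

text \<open>
  Cases \<open>A\<close> bounded, and \<open>A\<close> unbounded with \<open>0 \<in> \<rho>(A)\<close>. In the latter \<open>A\<inverse>\<close> is bounded, so
  \<open>(A\<inverse>)^s = J (A\<inverse>) s\<close>.
\<close>

definition pow_regular :: "('a::real_normed_vector \<times> 'a) set \<Rightarrow> real \<Rightarrow> ('a \<times> 'a) set" where
  "pow_regular A s = (if bounded_operator A then J A s else (J (A\<inverse>) s)\<inverse>)"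

text \<open>
  Case \<open>A\<close> unbounded with \<open>0 \<in> \<sigma>(A)\<close>. Here \<open>0 \<in> \<rho>(A + \<epsilon>I)\<close> for \<open>\<epsilon> > 0\<close> by nonnegativity, so
  \<open>(A + \<epsilon>I)^s\<close> is given by the preceding definition.
\<close>

definition pow_limit :: "('a::real_normed_vector \<times> 'a) set \<Rightarrow> real \<Rightarrow> ('a \<times> 'a) set" where
  "pow_limit A s =
     {(u, v). (\<forall>\<^sub>F \<epsilon> in at_right 0. u \<in> Domain (pow_regular (shift \<epsilon> A) s)) \<and>
              ((\<lambda>\<epsilon>. app (pow_regular (shift \<epsilon> A) s) u) \<longlongrightarrow> v) (at_right 0)}"

definition pos_power :: "('a::real_normed_vector \<times> 'a) set \<Rightarrow> real \<Rightarrow> ('a \<times> 'a) set" where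
  "pos_power A s =
     (if bounded_operator A \<or> zero_in_resolvent_set A then pow_regular A s else pow_limit A s)"

text \<open>\<open>A^s\<close> for real \<open>s\<close>; negative exponents are meant for one-to-one \<open>A\<close> only.\<close>

definition frac_power :: "('a::real_normed_vector \<times> 'a) set \<Rightarrow> real \<Rightarrow> ('a \<times> 'a) set" where
  "frac_power A s =
     (if s > 0 then pos_power A s else if s = 0 then Id else pos_power (A\<inverse>) (- s))"

definition log_operator :: "('a::real_normed_vector \<times> 'a) set \<Rightarrow> ('a \<times> 'a) set" where
  "log_operator A =
     {(u, v). (\<forall>\<^sub>F s in at_right 0. u \<in> Domain (frac_power A s)) \<and>
              ((\<lambda>s. (1 / s) *\<^sub>R (app (frac_power A s) u - u)) \<longlongrightarrow> v) (at_right 0)}"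

text \<open>The infinitesimal generator of a family \<open>T s\<close>, \<open>s \<ge> 0\<close>, of everywhere defined operators.\<close>

definition generator :: "(real \<Rightarrow> ('a::real_normed_vector \<times> 'a) set) \<Rightarrow> ('a \<times> 'a) set" where
  "generator T = {(u, v). ((\<lambda>s. (1 / s) *\<^sub>R (app (T s) u - u)) \<longlongrightarrow> v) (at_right 0)}"

end

theory Submission
  imports Defs "HOL-Real_Asymp.Real_Asymp"
begin

text \<open>
  Everything reduces to the equivalence of \<open>A\<^sup>s u = \<lambda>\<^sup>s u\<close>, \<open>0 < s < 2\<close>, with \<open>A u = \<lambda> u\<close>; given the
  latter, all the integrals are scalar ones.

  For a bounded nonnegative \<open>b\<close>, \<open>L(e) = log(e + b)\<close> is the primitive of \<open>(e + b)\<^sup>-\<^sup>1\<close> with \<open>L(e) - ln e \<rightarrow> 0\<close> at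
  infinity, and the Balakrishnan integral for \<open>(e + b)\<^sup>s\<close> equals \<open>exp(s L(e))\<close>, since both solve the same
  differential equation in \<open>e\<close> and agree asymptotically. Letting \<open>e \<rightarrow> 0\<close> gives the semigroup
  property of \<open>b\<^sup>s\<close>.

  In each of the cases (a), (b), (c) the equation \<open>A\<^sup>s u = \<lambda>\<^sup>s u\<close> becomes \<open>T\<^sup>s u = \<lambda>\<^sup>s S\<^sup>s u\<close> for the
  bounded operators \<open>S = (I + A)\<^sup>-\<^sup>1\<close> and \<open>T = I - S\<close>. Then \<open>F(t) = \<lambda>\<^sup>-\<^sup>t S\<^sup>a\<^sup>-\<^sup>t T\<^sup>c\<^sup>+\<^sup>t u\<close> is periodic with
  period \<open>s\<close>, and its \<open>k\<close>-th Fourier coefficient \<open>w\<close> satisfies \<open>T\<^sup>r w = \<lambda>\<^sup>r e\<^sup>i\<^sup>\<phi>\<^sup>r S\<^sup>r w\<close> for all \<open>r > 0\<close>, where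
  \<open>\<phi> = 2\<pi>k/s\<close>. For \<open>r = 1\<close> this makes \<open>w\<close> an eigenvector of \<open>A\<close> for the eigenvalue \<open>\<lambda>e\<^sup>i\<^sup>\<phi>\<close>, so that \<open>A\<^sup>r\<close>
  multiplies it by the principal power, whose argument is at most \<open>\<pi>r\<close>. As \<open>s < 2\<close> forces \<open>\<phi> > \<pi>\<close>
  for \<open>k \<ge> 1\<close>, only the mean survives: \<open>F\<close> is constant, whence \<open>T u = \<lambda> S u\<close>.

  In (iii), \<open>x(h) = \<lambda>\<^sup>h A\<^sup>-\<^sup>h u\<close> satisfies \<open>x(h) - u = o(h)\<close>, and telescoping with the semigroup property
  gives \<open>x(1/2) = u\<close>.
\<close>

section \<open>Improper integrals\<close>

text \<open>The bound on s decides whether the claim can be true: for s > 2 the rotation of the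
  plane by the angle 2 pi / s is a nonnegative operator whose s-th power is the identity, although
  it fixes no nonzero vector. In general lambda^s has further s-th roots lambda e^(i phi), and their
  arguments must lie outside the range that principal powers can produce. For a general A there is
  no spectral decomposition, and u is not known to lie in D(A); the Fourier coefficients manufacture
  genuine eigenvectors out of u alone. They live in a complexification because the scalars are real.
  Two restrictions shape the constructions. An A that is unbounded or not invertible has no bounded
  logarithm, so only differences log(A + t) - log(A + r), integrals of the resolvent, are used. And
  for a b that is not invertible, b^s makes sense only for s > 0; hence the exponents in F are
  shifted so as to stay positive, and the surplus power of S is cancelled by injectivity in the
  end.\<close>

definition has_improper_integral :: "(real \<Rightarrow> 'a::banach) \<Rightarrow> 'a \<Rightarrow> bool" where
  "has_improper_integral f I \<longleftrightarrow> continuous_on {0<..} f \<and>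
     (\<lambda>n. integral {1 / real (Suc n)..real (Suc n)} f) \<longlonglongrightarrow> I"

lemma integrable_on_trunc:
  fixes f :: "real \<Rightarrow> 'a::banach"
  assumes "continuous_on {0<..} f" "0 < a"
  shows "f integrable_on {a..b}"
  by (rule integrable_continuous_interval) (rule continuous_on_subset[OF assms(1)], use assms in auto)

lemma trunc_pos: "0 < 1 / real (Suc n)"
  by simp

lemma trunc_gt_zero: "x \<in> {1 / real (Suc n)..real (Suc n)} \<Longrightarrow> x > 0"
  using less_le_trans[OF trunc_pos] by (auto simp del: of_nat_Suc)

lemma has_improper_integral_unique:
  "has_improper_integral f I \<Longrightarrow> has_improper_integral f K \<Longrightarrow> I = K"
  unfolding has_improper_integral_def using LIMSEQ_unique by blast

lemma has_improper_integral_cong: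
  assumes "has_improper_integral f I" "\<And>x. x > 0 \<Longrightarrow> f x = g x"
  shows "has_improper_integral g I"
proof -
  have "continuous_on {0<..} g"
    using assms continuous_on_cong[of "{0<..}" "{0<..}" f g] unfolding has_improper_integral_def by auto
  moreover have "integral {1 / real (Suc n)..real (Suc n)} g = integral {1 / real (Suc n)..real (Suc n)} f" for n
  proof (rule integral_cong)
    fix x assume "x \<in> {1 / real (Suc n)..real (Suc n)}"
    then have "x > 0" by (rule trunc_gt_zero)
    then show "g x = f x" using assms(2) by simp
  qed
  ultimately show ?thesis using assms(1) unfolding has_improper_integral_def by simp
qed

lemma has_improper_integral_linear:
  assumes "has_improper_integral f I" "bounded_linear T"
  shows "has_improper_integral (\<lambda>x. T (f x)) (T I)"
proof -
  have c: "continuous_on {0<..} f" and l: "(\<lambda>n. integral {1 / real (Suc n)..real (Suc n)} f) \<longlonglongrightarrow> I"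
    using assms unfolding has_improper_integral_def by auto
  have "integral {1 / real (Suc n)..real (Suc n)} (\<lambda>x. T (f x)) = T (integral {1 / real (Suc n)..real (Suc n)} f)" for n
    using integral_linear[OF integrable_on_trunc[OF c trunc_pos] assms(2), of n "real (Suc n)"]
    by (simp add: o_def)
  moreover have "continuous_on {0<..} (\<lambda>x. T (f x))"
    using c assms(2) by (rule bounded_linear.continuous_on[rotated])
  ultimately show ?thesis
    unfolding has_improper_integral_def using bounded_linear.tendsto[OF assms(2) l] by simp
qed

lemma has_improper_integral_diff:
  assumes "has_improper_integral f I" "has_improper_integral g K"
  shows "has_improper_integral (\<lambda>x. f x - g x) (I - K)"
proof -
  have c: "continuous_on {0<..} f" "continuous_on {0<..} g"
    and l: "(\<lambda>n. integral {1 / real (Suc n)..real (Suc n)} f) \<longlonglongrightarrow> I"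
      "(\<lambda>n. integral {1 / real (Suc n)..real (Suc n)} g) \<longlonglongrightarrow> K"
    using assms unfolding has_improper_integral_def by auto
  have "integral {1 / real (Suc n)..real (Suc n)} (\<lambda>x. f x - g x) =
      integral {1 / real (Suc n)..real (Suc n)} f - integral {1 / real (Suc n)..real (Suc n)} g" for n
    by (intro Henstock_Kurzweil_Integration.integral_diff integrable_on_trunc c trunc_pos)
  then show ?thesis
    unfolding has_improper_integral_def using tendsto_diff[OF l] c by (auto intro: continuous_intros)
qed

lemma has_improper_integral_norm_bound:
  assumes "has_improper_integral f I" "has_improper_integral g K" "\<And>x. x > 0 \<Longrightarrow> norm (f x) \<le> g x"
  shows "norm I \<le> K"
proof -
  have c: "continuous_on {0<..} f" "continuous_on {0<..} g"
    and l: "(\<lambda>n. integral {1 / real (Suc n)..real (Suc n)} f) \<longlonglongrightarrow> I"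
      "(\<lambda>n. integral {1 / real (Suc n)..real (Suc n)} g) \<longlonglongrightarrow> K"
    using assms unfolding has_improper_integral_def by auto
  have "norm (integral {1 / real (Suc n)..real (Suc n)} f) \<le> integral {1 / real (Suc n)..real (Suc n)} g" for n
  proof (rule integral_norm_bound_integral[OF integrable_on_trunc integrable_on_trunc])
    fix x assume "x \<in> {1 / real (Suc n)..real (Suc n)}"
    then have "x > 0" by (rule trunc_gt_zero)
    then show "norm (f x) \<le> g x" using assms(3) by simp
  qed (use c trunc_pos in auto)
  then show ?thesis
    using tendsto_le[OF _ l(2) tendsto_norm[OF l(1)]] by (auto simp del: of_nat_Suc)
qed

lemma integral_trunc_split:
  fixes f :: "real \<Rightarrow> 'a::banach"
  assumes c: "continuous_on {0<..} f" and mn: "m \<le> n"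
  shows "integral {1 / real (Suc n)..real (Suc n)} f =
    integral {1 / real (Suc n)..1 / real (Suc m)} f + integral {1 / real (Suc m)..real (Suc m)} f
      + integral {real (Suc m)..real (Suc n)} f"
proof -
  have o: "1 / real (Suc n) \<le> 1 / real (Suc m)" "1 / real (Suc m) \<le> real (Suc m)" "real (Suc m) \<le> real (Suc n)"
    using mn by (auto simp: field_simps)
  have i: "f integrable_on {1 / real (Suc n)..real (Suc n)}" "f integrable_on {1 / real (Suc n)..real (Suc m)}"
    using integrable_on_trunc[OF c trunc_pos] by auto
  show ?thesis
    using Henstock_Kurzweil_Integration.integral_combine[OF _ o(3) i(1)]
      Henstock_Kurzweil_Integration.integral_combine[OF o(1) o(2) i(2)] o by (simp del: of_nat_Suc)
qed

text \<open>Two truncations differ by integrals over the two outer pieces, where \<open>g\<close>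
  dominates; so the truncations of \<open>f\<close> are Cauchy along with those of
  \<open>g\<close>.\<close>

lemma has_improper_integral_dominated:
  fixes f :: "real \<Rightarrow> 'a::banach" and g :: "real \<Rightarrow> real"
  assumes c: "continuous_on {0<..} f" and g: "has_improper_integral g K"
    and le: "\<And>x. x > 0 \<Longrightarrow> norm (f x) \<le> g x"
  shows "\<exists>I. has_improper_integral f I"
proof -
  have cg: "continuous_on {0<..} g" and lg: "(\<lambda>n. integral {1 / real (Suc n)..real (Suc n)} g) \<longlonglongrightarrow> K"
    using g unfolding has_improper_integral_def by auto
  define I where "I n = integral {1 / real (Suc n)..real (Suc n)} f" for n
  define Kn where "Kn n = integral {1 / real (Suc n)..real (Suc n)} g" for n
  have bd: "norm (integral {a..b} f) \<le> integral {a..b} g" if "0 < a" for a b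
    by (rule integral_norm_bound_integral) (use that c cg le in \<open>auto intro!: integrable_on_trunc\<close>)
  have key: "norm (I n - I m) \<le> Kn n - Kn m" if "m \<le> n" for m n
  proof -
    have "I n - I m = integral {1 / real (Suc n)..1 / real (Suc m)} f + integral {real (Suc m)..real (Suc n)} f"
      unfolding I_def using integral_trunc_split[OF c that] by simp
    also have "norm \<dots> \<le> integral {1 / real (Suc n)..1 / real (Suc m)} g + integral {real (Suc m)..real (Suc n)} g"
      by (intro norm_triangle_mono bd) auto
    also have "\<dots> = Kn n - Kn m"
      unfolding Kn_def using integral_trunc_split[OF cg that] by simp
    finally show ?thesis .
  qed
  have "Cauchy Kn" using lg unfolding Kn_def[symmetric] by (rule LIMSEQ_imp_Cauchy)
  have "Cauchy I"
  proof (rule CauchyI)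
    fix e :: real assume "e > 0"
    then obtain N where N: "\<And>m n. m \<ge> N \<Longrightarrow> n \<ge> N \<Longrightarrow> norm (Kn m - Kn n) < e"
      using CauchyD[OF \<open>Cauchy Kn\<close>] by blast
    have "norm (I m - I n) < e" if "m \<ge> N" "n \<ge> N" for m n
    proof (cases "m \<le> n")
      case True
      then show ?thesis using key[OF True] N[OF that(2,1)] by (simp add: norm_minus_commute)
    next
      case False
      then have "n \<le> m" by simp
      then show ?thesis using key[of n m] N[OF that(1,2)] by simp
    qed
    then show "\<exists>N. \<forall>m\<ge>N. \<forall>n\<ge>N. norm (I m - I n) < e" by blast
  qed
  then obtain L where "I \<longlonglongrightarrow> L" using Cauchy_convergent_iff convergent_def by blast
  then show ?thesis using c unfolding has_improper_integral_def I_def by blast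
qed

section \<open>The integral of x^(s-1) / (x + a) over the positive reals\<close>

lemma Beta_reflection_real:
  fixes s :: real
  assumes "0 < s" "s < 1"
  shows "Beta s (1 - s) = pi / sin (s * pi)"
proof -
  have "complex_of_real (Gamma s * Gamma (1 - s)) = complex_of_real (pi / sin (s * pi))"
    using Gamma_reflection_complex[of "of_real s"]
    by (metis Gamma_complex_of_real mult.commute of_real_1 of_real_diff of_real_divide of_real_mult sin_of_real)
  then have "Gamma s * Gamma (1 - s) = pi / sin (s * pi)" by (simp only: of_real_eq_iff)
  then show ?thesis unfolding Beta_def by simp
qed

text \<open>The substitution t = x / (x + a) turns the integral into a^(s-1) Beta(s, 1-s), and the
  reflection formula evaluates the Beta function. The substitution is carried out by differentiating
  the incomplete Beta integral \<open>\<Phi>\<close> composed with \<open>\<psi>\<close>, so that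
  each truncated integral is known exactly.\<close>

lemma has_improper_integral_powr:
  fixes s a :: real
  assumes s: "0 < s" "s < 1" and a: "0 < a"
  shows "has_improper_integral (\<lambda>x. x powr (s - 1) / (x + a)) (a powr (s - 1) * (pi / sin (s * pi)))"
proof -
  define h where "h t = t powr (s - 1) * (1 - t) powr (1 - s - 1)" for t :: real
  have hi: "(h has_integral pi / sin (s * pi)) {0..1}"
    using has_integral_Beta_real[of s "1 - s"] s Beta_reflection_real[OF s] unfolding h_def by simp
  then have hint: "h integrable_on {0..1}" by blast
  define \<Phi> where "\<Phi> t = integral {0..t} h" for t
  have cont: "continuous_on {0..1} \<Phi>"
    unfolding \<Phi>_def using indefinite_integral_continuous_1[OF hint] .
  have der: "(\<Phi> has_vector_derivative h t) (at t)" if "0 < t" "t < 1" for t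
  proof -
    have "isCont h t" unfolding h_def using that by (intro continuous_intros) auto
    then have "continuous (at t within {0..1}) h" by (rule continuous_at_imp_continuous_at_within)
    then have "(\<Phi> has_vector_derivative h t) (at t within {0..1})"
      unfolding \<Phi>_def
      using integral_has_vector_derivative_continuous_at[OF hint, of t "{}"] that by simp
    then show ?thesis using that at_within_Icc_at[of 0 t 1] by simp
  qed
  define \<psi> where "\<psi> x = x / (x + a)" for x
  have integ: "((\<lambda>x. x powr (s - 1) / (x + a)) has_integral
      a powr (s - 1) * (\<Phi> (\<psi> q)) - a powr (s - 1) * (\<Phi> (\<psi> p))) {p..q}" if pq: "0 < p" "p \<le> q" for p q
  proof (rule fundamental_theorem_of_calculus[OF pq(2)])
    fix x assume "x \<in> {p..q}"
    then have x: "x > 0" using pq by auto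
    have \<psi>x: "0 < \<psi> x" "\<psi> x < 1" unfolding \<psi>_def using x a by auto
    have d\<psi>: "(\<psi> has_real_derivative a / (x + a)^2) (at x)"
      unfolding \<psi>_def using x a by (auto intro!: derivative_eq_intros simp: power2_eq_square field_simps)
    have d\<Phi>: "(\<Phi> has_real_derivative h (\<psi> x)) (at (\<psi> x))"
      using der[OF \<psi>x] by (simp add: has_real_derivative_iff_has_vector_derivative)
    have "((\<lambda>x. a powr (s - 1) * \<Phi> (\<psi> x)) has_real_derivative
        a powr (s - 1) * (h (\<psi> x) * (a / (x + a)^2))) (at x)"
      using DERIV_cmult[OF DERIV_chain[OF d\<Phi> d\<psi>]] by (simp add: o_def)
    moreover have "a powr (s - 1) * (h (\<psi> x) * (a / (x + a)^2)) = x powr (s - 1) / (x + a)"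
    proof -
      have "1 - \<psi> x = a / (x + a)" unfolding \<psi>_def using x a by (simp add: field_simps)
      then have "h (\<psi> x) = (x powr (s - 1) / (x + a) powr (s - 1)) * (a powr (- s) / (x + a) powr (- s))"
        unfolding h_def using x a by (simp add: \<psi>_def powr_divide)
      also have "\<dots> = x powr (s - 1) * a powr (- s) / ((x + a) powr (s - 1) * (x + a) powr (- s))" by simp
      also have "(x + a) powr (s - 1) * (x + a) powr (- s) = (x + a) powr (- 1)"
        by (simp flip: powr_add)
      also have "\<dots> = 1 / (x + a)" using x a by (simp add: powr_minus_divide)
      finally have h: "h (\<psi> x) = x powr (s - 1) * a powr (- s) * (x + a)" by simp
      have "a powr (s - 1) * a powr (- s) = a powr (- 1)" by (simp flip: powr_add)
      then have aa: "a powr (s - 1) * a powr (- s) * a = 1" using a by (simp add: powr_minus_divide)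
      have "a powr (s - 1) * (h (\<psi> x) * (a / (x + a)^2)) =
          (a powr (s - 1) * a powr (- s) * a) * (x powr (s - 1) * ((x + a) / (x + a)^2))"
        unfolding h by (simp add: ac_simps)
      also have "\<dots> = x powr (s - 1) / (x + a)"
        unfolding aa using x a by (simp add: power2_eq_square)
      finally show ?thesis .
    qed
    ultimately show "((\<lambda>x. a powr (s - 1) * \<Phi> (\<psi> x)) has_vector_derivative x powr (s - 1) / (x + a))
        (at x within {p..q})"
      using has_real_derivative_iff_has_vector_derivative has_vector_derivative_at_within by metis
  qed
  have int: "integral {1 / real (Suc n)..real (Suc n)} (\<lambda>x. x powr (s - 1) / (x + a)) =
      a powr (s - 1) * (\<Phi> (\<psi> (real (Suc n)))) - a powr (s - 1) * (\<Phi> (\<psi> (1 / real (Suc n))))" for n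
    by (rule integral_unique, rule integ) (auto simp: field_simps)
  have l1: "(\<lambda>n. \<psi> (real (Suc n))) \<longlonglongrightarrow> 1"
  proof -
    have "(\<lambda>n. 1 / (1 + a * inverse (real (Suc n)))) \<longlonglongrightarrow> 1 / (1 + a * 0)"
      by (intro tendsto_intros LIMSEQ_inverse_real_of_nat) simp
    moreover have "1 / (1 + a * inverse (real (Suc n))) = \<psi> (real (Suc n))" for n
      unfolding \<psi>_def using a by (simp add: field_simps)
    ultimately show ?thesis by simp
  qed
  have l0: "(\<lambda>n. \<psi> (1 / real (Suc n))) \<longlonglongrightarrow> 0"
  proof -
    have "(\<lambda>n. inverse (real (Suc n)) / (inverse (real (Suc n)) + a)) \<longlonglongrightarrow> 0 / (0 + a)"
      by (intro tendsto_intros LIMSEQ_inverse_real_of_nat) (use a in simp)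
    then show ?thesis unfolding \<psi>_def by (simp add: inverse_eq_divide)
  qed
  have rng: "0 \<le> \<psi> x \<and> \<psi> x \<le> 1" if "x > 0" for x unfolding \<psi>_def using that a by auto
  have "(\<lambda>n. \<Phi> (\<psi> (real (Suc n)))) \<longlonglongrightarrow> \<Phi> 1"
    by (rule continuous_on_tendsto_compose[OF cont l1]) (use rng[of "real (Suc _)"] in \<open>auto simp del: of_nat_Suc\<close>)
  moreover have "(\<lambda>n. \<Phi> (\<psi> (1 / real (Suc n)))) \<longlonglongrightarrow> \<Phi> 0"
    by (rule continuous_on_tendsto_compose[OF cont l0]) (auto simp: rng simp del: of_nat_Suc)
  ultimately have "(\<lambda>n. integral {1 / real (Suc n)..real (Suc n)} (\<lambda>x. x powr (s - 1) / (x + a))) \<longlonglongrightarrow>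
      a powr (s - 1) * \<Phi> 1 - a powr (s - 1) * \<Phi> 0"
    unfolding int by (intro tendsto_intros)
  moreover have "\<Phi> 1 = pi / sin (s * pi)" "\<Phi> 0 = 0" unfolding \<Phi>_def using hi by (auto simp: integral_unique)
  moreover have "continuous_on {0<..} (\<lambda>x. x powr (s - 1) / (x + a))"
    using a by (auto intro!: continuous_intros)
  ultimately show ?thesis unfolding has_improper_integral_def by simp
qed


section \<open>The Bochner integral of dominated continuous functions\<close>

lemma simple_bochner_integral_indicator_scaleR:
  fixes c :: "'a::real_normed_vector"
  assumes A: "A \<in> sets M" "emeasure M A < \<infinity>"
  shows "Bochner_Integration.simple_bochner_integrable M (\<lambda>x. indicator A x *\<^sub>R c)"
    and "Bochner_Integration.simple_bochner_integral M (\<lambda>x. indicator A x *\<^sub>R c) = measure M A *\<^sub>R c"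
proof -
  have i: "Bochner_Integration.simple_bochner_integrable M (indicator A :: _ \<Rightarrow> real)"
  proof
    have "{y \<in> space M. indicator A y \<noteq> (0::real)} = A"
      using sets.sets_into_space[OF A(1)] by (auto simp: indicator_def)
    then show "emeasure M {y \<in> space M. indicator A y \<noteq> (0::real)} \<noteq> \<infinity>" using A by simp
  qed (use A in simp)
  show "Bochner_Integration.simple_bochner_integrable M (\<lambda>x. indicator A x *\<^sub>R c)"
    using simple_bochner_integrable_compose2[where p="\<lambda>(r::real) (_::real). r *\<^sub>R c", OF _ i i] by simp
  have "linear (\<lambda>r::real. r *\<^sub>R c)" by (simp add: linear_iff scaleR_left_distrib)
  from simple_bochner_integral_linear[OF this i]
  have "Bochner_Integration.simple_bochner_integral M (\<lambda>x. indicator A x *\<^sub>R c) =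
      Bochner_Integration.simple_bochner_integral M (indicator A :: _ \<Rightarrow> real) *\<^sub>R c" .
  also have "Bochner_Integration.simple_bochner_integral M (indicator A :: _ \<Rightarrow> real) = measure M A"
    using simple_bochner_integrable_eq_integral[OF i] A sets.sets_into_space[OF A(1)]
    by (simp add: Int_absorb2)
  finally show "Bochner_Integration.simple_bochner_integral M (\<lambda>x. indicator A x *\<^sub>R c) = measure M A *\<^sub>R c" .
qed

lemma simple_bochner_integrable_add:
  fixes f g :: "'m \<Rightarrow> 'a::real_normed_vector"
  assumes "Bochner_Integration.simple_bochner_integrable M f" "Bochner_Integration.simple_bochner_integrable M g"
  shows "Bochner_Integration.simple_bochner_integrable M (\<lambda>x. f x + g x)"
  using simple_bochner_integrable_compose2[where p="(+)", OF _ assms] by simp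

text \<open>Uniform continuity yields a mesh on whose cells \<open>f\<close> varies by at most
  \<open>e\<close>; the values are taken at the left end points. Half-open cells keep consecutive
  pieces disjoint.\<close>

lemma step_function_approx:
  fixes f :: "real \<Rightarrow> 'a::banach"
  assumes pq: "p < q" and c: "continuous_on {p..q} f" and e: "e > 0"
  shows "\<exists>s. Bochner_Integration.simple_bochner_integrable lborel s \<and> (\<forall>x. x \<notin> {p..<q} \<longrightarrow> s x = 0) \<and>
    (\<forall>x\<in>{p..<q}. norm (f x - s x) \<le> e) \<and>
    norm (Bochner_Integration.simple_bochner_integral lborel s - integral {p..q} f) \<le> e * (q - p)"
proof -
  have "uniformly_continuous_on {p..q} f" by (rule compact_uniformly_continuous[OF c]) simp
  then obtain d where d: "d > 0" "\<And>x y. x \<in> {p..q} \<Longrightarrow> y \<in> {p..q} \<Longrightarrow> dist y x < d \<Longrightarrow> dist (f y) (f x) < e"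
    unfolding uniformly_continuous_on_def using e by metis
  obtain N :: nat where N: "(q - p) / d < real N" using reals_Archimedean2 by blast
  have N0: "N > 0" using N pq d(1) by (metis diff_gt_0_iff_gt divide_pos_pos gr0I less_asym of_nat_0)
  define h where "h = (q - p) / real N"
  have h: "0 < h" "h < d" using N N0 d(1) pq unfolding h_def by (auto simp: field_simps)
  define x where "x k = p + real k * h" for k
  have xN: "x N = q" unfolding x_def h_def using N0 by simp
  have xm: "x k \<le> x l" if "k \<le> l" for k l unfolding x_def using that h by (simp add: mult_right_mono)
  \<comment> \<open>The approximant is built from \<open>p\<close> up to \<open>x k\<close>, so that
    each induction step adds a single indicator function.\<close>
  have "\<exists>s. Bochner_Integration.simple_bochner_integrable lborel s \<and> (\<forall>y. y \<notin> {p..<x k} \<longrightarrow> s y = 0) \<and>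
    (\<forall>y\<in>{p..<x k}. norm (f y - s y) \<le> e) \<and>
    norm (Bochner_Integration.simple_bochner_integral lborel s - integral {p..x k} f) \<le> e * (x k - p)"
    if "k \<le> N" for k
    using that
  proof (induction k)
    case 0
    have "Bochner_Integration.simple_bochner_integrable lborel (\<lambda>x::real. 0::'a)"
      using simple_bochner_integral_indicator_scaleR(1)[of "{}" lborel "0::'a"] by simp
    moreover have "Bochner_Integration.simple_bochner_integral lborel (\<lambda>x::real. 0::'a) = 0"
      using simple_bochner_integral_indicator_scaleR(2)[of "{}" lborel "0::'a"] by simp
    ultimately show ?case by (intro exI[of _ "\<lambda>_. 0"]) (auto simp: x_def)
  next
    case (Suc k)
    then obtain s where s: "Bochner_Integration.simple_bochner_integrable lborel s"
      "\<And>y. y \<notin> {p..<x k} \<Longrightarrow> s y = 0" "\<And>y. y \<in> {p..<x k} \<Longrightarrow> norm (f y - s y) \<le> e"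
      "norm (Bochner_Integration.simple_bochner_integral lborel s - integral {p..x k} f) \<le> e * (x k - p)"
      by auto
    have xk: "p \<le> x k" "x k \<le> x (Suc k)" "x (Suc k) \<le> q" "x (Suc k) - x k = h"
      using xm[of k "Suc k"] xm[of "Suc k" N] Suc.prems xN h by (auto simp: x_def field_simps)
    let ?A = "{x k..<x (Suc k)}"
    let ?i = "\<lambda>y. indicator ?A y *\<^sub>R f (x k)"
    let ?s = "\<lambda>y. s y + ?i y"
    have em: "emeasure lborel ?A < \<infinity>" using xk by simp
    note ind = simple_bochner_integral_indicator_scaleR[where M=lborel and A="?A" and c="f (x k)", OF _ em, simplified]
    have near: "norm (f y - f (x k)) \<le> e" if "y \<in> {x k..x (Suc k)}" for y
      using d(2)[of "x k" y] that xk h by (auto simp: dist_norm)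
    have 1: "Bochner_Integration.simple_bochner_integrable lborel ?s"
      by (intro simple_bochner_integrable_add s ind)
    have 2: "?s y = 0" if "y \<notin> {p..<x (Suc k)}" for y
      using that s(2)[of y] xk by (auto simp: indicator_def)
    have 3: "norm (f y - ?s y) \<le> e" if "y \<in> {p..<x (Suc k)}" for y
    proof (cases "y < x k")
      case True then show ?thesis using s(3)[of y] that by (auto simp: indicator_def)
    next
      case False then show ?thesis using s(2)[of y] near[of y] that by (auto simp: indicator_def)
    qed
    have int1: "f integrable_on {p..x (Suc k)}"
      by (rule integrable_continuous_interval, rule continuous_on_subset[OF c]) (use xk in auto)
    have int2: "f integrable_on {x k..x (Suc k)}"
      by (rule integrable_continuous_interval, rule continuous_on_subset[OF c]) (use xk in auto)
    have "norm (integral {x k..x (Suc k)} (\<lambda>y. f (x k) - f y)) \<le> integral {x k..x (Suc k)} (\<lambda>_. e)"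
      by (rule integral_norm_bound_integral) (use near int2 in \<open>auto simp: norm_minus_commute intro: integrable_diff\<close>)
    moreover have "integral {x k..x (Suc k)} (\<lambda>y. f (x k) - f y) = h *\<^sub>R f (x k) - integral {x k..x (Suc k)} f"
      using int2 xk by (subst Henstock_Kurzweil_Integration.integral_diff) auto
    ultimately have b2: "norm (h *\<^sub>R f (x k) - integral {x k..x (Suc k)} f) \<le> e * h"
      using xk by (simp add: mult.commute)
    have "Bochner_Integration.simple_bochner_integral lborel ?s =
        Bochner_Integration.simple_bochner_integral lborel s + h *\<^sub>R f (x k)"
      using simple_bochner_integral_add[OF s(1) ind(1)] ind(2) xk by simp
    moreover have "integral {p..x (Suc k)} f = integral {p..x k} f + integral {x k..x (Suc k)} f"
      using Henstock_Kurzweil_Integration.integral_combine[OF xk(1,2) int1] by simp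
    ultimately have "Bochner_Integration.simple_bochner_integral lborel ?s - integral {p..x (Suc k)} f =
        (Bochner_Integration.simple_bochner_integral lborel s - integral {p..x k} f)
        + (h *\<^sub>R f (x k) - integral {x k..x (Suc k)} f)" by simp
    also have "norm \<dots> \<le> e * (x k - p) + e * h" by (rule norm_triangle_mono[OF s(4) b2])
    also have "\<dots> = e * (x (Suc k) - p)" using xk(4) by (simp add: algebra_simps)
    finally have 4: "norm (Bochner_Integration.simple_bochner_integral lborel ?s - integral {p..x (Suc k)} f)
        \<le> e * (x (Suc k) - p)" .
    show ?case using 1 2 3 4 by blast
  qed
  from this[of N] show ?thesis unfolding xN by simp
qed

text \<open>In a nonseparable space a difference of Borel functions need not be Borel. As
  \<open>s\<close> has finitely many values, the norm splits over the level sets of \<open>s\<close>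
  into finitely many terms \<open>norm (f x - y)\<close> with \<open>y\<close> fixed, each a
  continuous function of \<open>f x\<close>.\<close>

lemma borel_measurable_norm_diff_simple:
  fixes f s :: "'m \<Rightarrow> 'a::real_normed_vector"
  assumes f: "f \<in> borel_measurable M" and s: "simple_function M s"
  shows "(\<lambda>x. norm (f x - s x)) \<in> borel_measurable M"
proof -
  have fin: "finite (s ` space M)" using s by (simp add: simple_functionD)
  have "(\<lambda>x. norm (f x - y)) \<in> borel_measurable M" for y
    by (rule measurable_compose[OF f]) (intro borel_measurable_continuous_onI continuous_intros)
  moreover have "s -` {y} \<inter> space M \<in> sets M" for y using s by (simp add: simple_functionD)
  ultimately have "(\<lambda>x. \<Sum>y\<in>s ` space M. indicator (s -` {y} \<inter> space M) x * norm (f x - y)) \<in> borel_measurable M"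
    by (intro borel_measurable_sum borel_measurable_times borel_measurable_indicator)
  moreover have "(\<Sum>y\<in>s ` space M. indicator (s -` {y} \<inter> space M) x * norm (f x - y)) = norm (f x - s x)"
    if "x \<in> space M" for x
  proof -
    have "(\<Sum>y\<in>s ` space M. indicator (s -` {y} \<inter> space M) x * norm (f x - y)) =
        (\<Sum>y\<in>s ` space M. if y = s x then norm (f x - y) else 0)"
      using that by (intro sum.cong) (auto simp: indicator_def)
    also have "\<dots> = norm (f x - s x)" using fin that by simp
    finally show ?thesis .
  qed
  ultimately show ?thesis by (simp cong: measurable_cong)
qed

text \<open>The integrals of two approximating simple functions differ by at most the sum of their
  L1 distances to \<open>f\<close>, which tends to zero.\<close>

lemma bochner_has_integral_unique:
  assumes x: "bochner_has_integral M f x" and y: "bochner_has_integral M f y"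
  shows "x = y"
proof -
  have f: "f \<in> borel_measurable M" using x unfolding bochner_has_integral_def by simp
  obtain s where s: "\<And>i. Bochner_Integration.simple_bochner_integrable M (s i)"
    "(\<lambda>i::nat. \<integral>\<^sup>+t. ennreal (norm (f t - s i t)) \<partial>M) \<longlonglongrightarrow> 0"
    "(\<lambda>i. Bochner_Integration.simple_bochner_integral M (s i)) \<longlonglongrightarrow> x"
    using x unfolding bochner_has_integral_def by auto
  obtain r where r: "\<And>i. Bochner_Integration.simple_bochner_integrable M (r i)"
    "(\<lambda>i::nat. \<integral>\<^sup>+t. ennreal (norm (f t - r i t)) \<partial>M) \<longlonglongrightarrow> 0"
    "(\<lambda>i. Bochner_Integration.simple_bochner_integral M (r i)) \<longlonglongrightarrow> y"
    using y unfolding bochner_has_integral_def by auto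
  have le: "ennreal (norm (Bochner_Integration.simple_bochner_integral M (s i) - Bochner_Integration.simple_bochner_integral M (r i)))
     \<le> (\<integral>\<^sup>+t. ennreal (norm (f t - s i t)) \<partial>M) + (\<integral>\<^sup>+t. ennreal (norm (f t - r i t)) \<partial>M)" for i
  proof -
    have sr: "Bochner_Integration.simple_bochner_integrable M (\<lambda>t. s i t - r i t)"
      using simple_bochner_integrable_compose2[where p="(-)", OF _ s(1)[of i] r(1)[of i]] by simp
    then have nsr: "Bochner_Integration.simple_bochner_integrable M (\<lambda>t. norm (s i t - r i t))"
      using simple_bochner_integrable_compose2[where p="\<lambda>a _. norm a", OF _ sr sr] by simp
    have ms: "(\<lambda>t. ennreal (norm (f t - s i t))) \<in> borel_measurable M"
      "(\<lambda>t. ennreal (norm (f t - r i t))) \<in> borel_measurable M"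
      using borel_measurable_norm_diff_simple[OF f] s(1)[of i] r(1)[of i]
      by (auto simp: simple_bochner_integrable.simps)
    have "norm (Bochner_Integration.simple_bochner_integral M (s i) - Bochner_Integration.simple_bochner_integral M (r i))
       \<le> Bochner_Integration.simple_bochner_integral M (\<lambda>t. norm (s i t - r i t))"
      using simple_bochner_integral_norm_bound[OF sr] simple_bochner_integral_diff[OF s(1)[of i] r(1)[of i]] by simp
    then have "ennreal (norm (Bochner_Integration.simple_bochner_integral M (s i) - Bochner_Integration.simple_bochner_integral M (r i)))
       \<le> ennreal (Bochner_Integration.simple_bochner_integral M (\<lambda>t. norm (s i t - r i t)))" by (rule ennreal_leI)
    also have "\<dots> = (\<integral>\<^sup>+t. ennreal (norm (s i t - r i t)) \<partial>M)"
      by (rule simple_bochner_integral_eq_nn_integral[OF nsr]) simp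
    also have "\<dots> \<le> (\<integral>\<^sup>+t. ennreal (norm (f t - s i t)) + ennreal (norm (f t - r i t)) \<partial>M)"
    proof (rule nn_integral_mono)
      fix t
      have "norm (s i t - r i t) \<le> norm (f t - s i t) + norm (f t - r i t)"
        using norm_triangle_ineq4[of "f t - r i t" "f t - s i t"] by simp
      then show "ennreal (norm (s i t - r i t)) \<le> ennreal (norm (f t - s i t)) + ennreal (norm (f t - r i t))"
        by (metis ennreal_leI ennreal_plus norm_ge_zero)
    qed
    also have "\<dots> = (\<integral>\<^sup>+t. ennreal (norm (f t - s i t)) \<partial>M) + (\<integral>\<^sup>+t. ennreal (norm (f t - r i t)) \<partial>M)"
      by (rule nn_integral_add[OF ms])
    finally show ?thesis .
  qed
  have "(\<lambda>i. ennreal (norm (Bochner_Integration.simple_bochner_integral M (s i) - Bochner_Integration.simple_bochner_integral M (r i)))) \<longlonglongrightarrow> 0"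
    by (rule tendsto_sandwich[OF _ _ tendsto_const, where h="\<lambda>i. (\<integral>\<^sup>+t. ennreal (norm (f t - s i t)) \<partial>M) + (\<integral>\<^sup>+t. ennreal (norm (f t - r i t)) \<partial>M)"])
      (use le tendsto_add[OF s(2) r(2)] in auto)
  moreover have "(\<lambda>i. ennreal (norm (Bochner_Integration.simple_bochner_integral M (s i) - Bochner_Integration.simple_bochner_integral M (r i)))) \<longlonglongrightarrow> ennreal (norm (x - y))"
    by (intro tendsto_ennrealI tendsto_norm tendsto_diff s r)
  ultimately have "ennreal (norm (x - y)) = 0" using LIMSEQ_unique by blast
  then show ?thesis by (simp add: ennreal_eq_0_iff)
qed

lemma bochner_integral_eqI: "bochner_has_integral M f x \<Longrightarrow> bochner_integral M f = x"
  unfolding bochner_integral_def using bochner_has_integral_unique by (metis the_equality)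


text \<open>Calculus is done with truncated Henstock-Kurzweil integrals, which make sense in every
  Banach space; this is the way back to the Bochner integral of the definitions. Step functions
  approximate \<open>f\<close> on the truncation interval, and the integral of \<open>g\<close> over
  the complement controls the rest.\<close>

lemma bochner_integral_pos_eqI:
  fixes f :: "real \<Rightarrow> 'a::banach" and g :: "real \<Rightarrow> real"
  assumes f: "has_improper_integral f I" and g: "has_improper_integral g K"
    and le: "\<And>x. x > 0 \<Longrightarrow> norm (f x) \<le> g x"
  shows "bochner_integral_pos f = I"
proof (rule bochner_integral_eqI)
  have cf: "continuous_on {0<..} f" and lf: "(\<lambda>n. integral {1 / real (Suc n)..real (Suc n)} f) \<longlonglongrightarrow> I"
    using f unfolding has_improper_integral_def by auto
  have cg: "continuous_on {0<..} g" and lg: "(\<lambda>n. integral {1 / real (Suc n)..real (Suc n)} g) \<longlonglongrightarrow> K"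
    using g unfolding has_improper_integral_def by auto
  have g0: "g x \<ge> 0" if "x > 0" for x using le[OF that] norm_ge_zero order_trans by blast
  define T where "T n = {1 / real (Suc n)..<real (Suc n)}" for n
  have T0: "x > 0" if "x \<in> T n" for x n using trunc_gt_zero[of x n] that unfolding T_def by (auto simp del: of_nat_Suc)
  define G where "G x = indicator {0<..} x * g x" for x
  have Gm: "G \<in> borel_measurable borel"
    unfolding G_def using borel_measurable_continuous_on_indicator[OF _ cg] by simp
  have Tm: "T n \<in> sets borel" for n unfolding T_def by simp
  have T_meas: "(\<lambda>x. ennreal (indicator (T n) x * G x)) \<in> borel_measurable borel" for n
    by (intro measurable_compose[OF _ measurable_ennreal] borel_measurable_times borel_measurable_indicator Gm Tm)
  have T_meas': "(\<lambda>x. ennreal (indicator (- T n) x * G x)) \<in> borel_measurable borel" for n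
    by (intro measurable_compose[OF _ measurable_ennreal] borel_measurable_times borel_measurable_indicator Gm borel_comp Tm)
  have G0: "G x \<ge> 0" for x unfolding G_def using g0 by (auto simp: indicator_def)
  have inner: "(\<integral>\<^sup>+x. ennreal (indicator (T n) x * G x) \<partial>lborel) = ennreal (integral {1 / real (Suc n)..real (Suc n)} g)" for n
  proof -
    let ?S = "{1 / real (Suc n)..real (Suc n)}"
    have "negligible {x \<in> ?S - T n. g x \<noteq> 0}" "negligible {x \<in> T n - ?S. g x \<noteq> 0}"
      by (rule negligible_subset[of "{real (Suc n)}"], simp, force simp: T_def)+
    from has_integral_spike_set_eq[OF this]
    have "(g has_integral integral ?S g) (T n)"
      using integrable_integral[OF integrable_on_trunc[OF cg trunc_pos[of n], of "real (Suc n)"]] by blast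
    then have "(\<integral>\<^sup>+x. ennreal (indicator (T n) x * g x) \<partial>lborel) = ennreal (integral {1 / real (Suc n)..real (Suc n)} g)"
      by (rule nn_integral_has_integral_lebesgue[rotated]) (use g0 T0 in blast)
    moreover have "indicator (T n) x * G x = indicator (T n) x * g x" for x
      unfolding G_def using T0[of x n] by (auto simp: indicator_def)
    ultimately show ?thesis by (simp only:)
  qed
  have Kn: "integral {1 / real (Suc n)..real (Suc n)} g \<ge> 0" for n
    by (rule integral_nonneg) (use integrable_on_trunc[OF cg trunc_pos] g0 trunc_gt_zero in blast)+
  have total: "(\<integral>\<^sup>+x. ennreal (G x) \<partial>lborel) = ennreal K"
  proof -
    have inc: "incseq (\<lambda>n x. ennreal (indicator (T n) x * G x))"
    proof (intro incseq_SucI le_funI ennreal_leI mult_right_mono)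
      fix n x
      have "1 / real (Suc (Suc n)) \<le> 1 / real (Suc n)" by (simp add: field_simps)
      then have "T n \<subseteq> T (Suc n)" unfolding T_def by (auto simp del: of_nat_Suc)
      then show "indicator (T n) x \<le> (indicator (T (Suc n)) x :: real)" by (auto simp: indicator_def)
    qed (use G0 in auto)
    have lim: "(\<lambda>n. \<integral>\<^sup>+x. ennreal (indicator (T n) x * G x) \<partial>lborel) \<longlonglongrightarrow> (\<integral>\<^sup>+x. ennreal (G x) \<partial>lborel)"
    proof (rule nn_integral_LIMSEQ[OF inc])
      show "(\<lambda>x. ennreal (indicator (T n) x * G x)) \<in> borel_measurable lborel" for n
        using T_meas[of n] by simp
      fix x
      show "(\<lambda>n. ennreal (indicator (T n) x * G x)) \<longlonglongrightarrow> ennreal (G x)"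
      proof (cases "x > 0")
        case False then show ?thesis unfolding G_def by simp
      next
        case True
        obtain N :: nat where N: "max (1 / x) x < real N" using reals_Archimedean2 by blast
        have "\<forall>n\<ge>N. x \<in> T n"
        proof (intro allI impI)
          fix n assume "N \<le> n"
          then have "real N \<le> real (Suc n)" by simp
          then have a: "1 / x < real (Suc n)" "x < real (Suc n)" using N by linarith+
          then have "1 / real (Suc n) < x" using True by (simp add: field_simps)
          then show "x \<in> T n" unfolding T_def using a by simp
        qed
        then have "eventually (\<lambda>n. ennreal (indicator (T n) x * G x) = ennreal (G x)) sequentially"
          unfolding eventually_sequentially by (intro exI[of _ N]) (auto simp: indicator_def)
        then show ?thesis by (rule tendsto_eventually)
      qed
    qed
    have "(\<lambda>n. \<integral>\<^sup>+x. ennreal (indicator (T n) x * G x) \<partial>lborel) \<longlonglongrightarrow> ennreal K"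
      unfolding inner by (rule tendsto_ennrealI[OF lg])
    then show ?thesis using lim LIMSEQ_unique by blast
  qed
  have outer: "(\<integral>\<^sup>+x. ennreal (indicator (- T n) x * G x) \<partial>lborel) = ennreal K - ennreal (integral {1 / real (Suc n)..real (Suc n)} g)" for n
  proof -
    have "(\<integral>\<^sup>+x. ennreal (G x) \<partial>lborel) =
        (\<integral>\<^sup>+x. ennreal (indicator (T n) x * G x) + ennreal (indicator (- T n) x * G x) \<partial>lborel)"
      by (intro nn_integral_cong) (auto simp: indicator_def)
    also have "\<dots> = (\<integral>\<^sup>+x. ennreal (indicator (T n) x * G x) \<partial>lborel) + (\<integral>\<^sup>+x. ennreal (indicator (- T n) x * G x) \<partial>lborel)"
      using T_meas[of n] T_meas'[of n] by (intro nn_integral_add) auto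
    finally have "ennreal K = ennreal (integral {1 / real (Suc n)..real (Suc n)} g) + (\<integral>\<^sup>+x. ennreal (indicator (- T n) x * G x) \<partial>lborel)"
      unfolding total inner .
    then show ?thesis by (metis ennreal_add_diff_cancel_left ennreal_neq_top)
  qed
  have outer_lim: "(\<lambda>n. \<integral>\<^sup>+x. ennreal (indicator (- T n) x * G x) \<partial>lborel) \<longlonglongrightarrow> 0"
  proof -
    have "(\<lambda>n. ennreal (K - integral {1 / real (Suc n)..real (Suc n)} g)) \<longlonglongrightarrow> ennreal (K - K)"
      by (intro tendsto_ennrealI tendsto_diff tendsto_const lg)
    moreover have "ennreal K - ennreal (integral {1 / real (Suc n)..real (Suc n)} g) = ennreal (K - integral {1 / real (Suc n)..real (Suc n)} g)" for n
      using Kn ennreal_minus by simp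
    ultimately show ?thesis unfolding outer by simp
  qed
  define F where "F x = indicator {0<..} x *\<^sub>R f x" for x
  have Fm: "F \<in> borel_measurable lborel"
    unfolding F_def using borel_measurable_continuous_on_indicator[OF _ cf] by simp
  have FG: "norm (F x) \<le> G x" for x unfolding F_def G_def using le by (auto simp: indicator_def)
  \<comment> \<open>The interval \<open>T n\<close> is shorter than n + 1, so this uniform error
    costs at most 1 / (n + 1) in L1.\<close>
  define e where "e n = 1 / (real (Suc n))\<^sup>2" for n
  have "\<exists>s. Bochner_Integration.simple_bochner_integrable lborel s \<and> (\<forall>x. x \<notin> T n \<longrightarrow> s x = 0) \<and>
    (\<forall>x\<in>T n. norm (f x - s x) \<le> e n) \<and>
    norm (Bochner_Integration.simple_bochner_integral lborel s - integral {1 / real (Suc n)..real (Suc n)} f) \<le> 1 / real (Suc n)" for n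
  proof (cases n)
    \<comment> \<open>The truncation interval degenerates to the point 1 and \<open>T 0\<close> is
      empty, so the zero function serves.\<close>
    case 0
    have T: "T n = {}" "integral {1 / real (Suc n)..real (Suc n)} f = 0" unfolding T_def using 0 by auto
    have "Bochner_Integration.simple_bochner_integrable lborel (\<lambda>x::real. 0::'a)"
      using simple_bochner_integral_indicator_scaleR(1)[of "{}" lborel "0::'a"] by simp
    moreover have "Bochner_Integration.simple_bochner_integral lborel (\<lambda>x::real. 0::'a) = 0"
      using simple_bochner_integral_indicator_scaleR(2)[of "{}" lborel "0::'a"] by simp
    ultimately show ?thesis unfolding T by (intro exI[of _ "\<lambda>_. 0"]) auto
  next
    case (Suc m)
    have "1 / real (Suc n) < real (Suc n)"
    proof -
      have "1 < real (Suc n)" using Suc by simp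
      moreover from this have "1 / real (Suc n) < 1" by simp
      ultimately show ?thesis by linarith
    qed
    moreover have "continuous_on {1 / real (Suc n)..real (Suc n)} f"
      by (rule continuous_on_subset[OF cf]) (use trunc_gt_zero in blast)
    moreover have "e n > 0" unfolding e_def by simp
    ultimately obtain s where s: "Bochner_Integration.simple_bochner_integrable lborel s" "\<forall>x. x \<notin> T n \<longrightarrow> s x = 0"
      "\<forall>x\<in>T n. norm (f x - s x) \<le> e n"
      "norm (Bochner_Integration.simple_bochner_integral lborel s - integral {1 / real (Suc n)..real (Suc n)} f)
        \<le> e n * (real (Suc n) - 1 / real (Suc n))"
      using step_function_approx unfolding T_def by metis
    have "e n * (real (Suc n) - 1 / real (Suc n)) \<le> e n * real (Suc n)"
      by (intro mult_left_mono) (auto simp: e_def)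
    also have "\<dots> = 1 / real (Suc n)" unfolding e_def power2_eq_square by (simp del: of_nat_Suc)
    finally show ?thesis using s order_trans by blast
  qed
  then obtain s where s: "\<And>n. Bochner_Integration.simple_bochner_integrable lborel (s n)"
    "\<And>n x. x \<notin> T n \<Longrightarrow> s n x = 0" "\<And>n x. x \<in> T n \<Longrightarrow> norm (f x - s n x) \<le> e n"
    "\<And>n. norm (Bochner_Integration.simple_bochner_integral lborel (s n) - integral {1 / real (Suc n)..real (Suc n)} f) \<le> 1 / real (Suc n)"
    by metis
  have lim1: "(\<lambda>n. 1 / real (Suc n)) \<longlonglongrightarrow> 0"
    using LIMSEQ_inverse_real_of_nat by (simp add: inverse_eq_divide)
  have "(\<lambda>n. Bochner_Integration.simple_bochner_integral lborel (s n) - integral {1 / real (Suc n)..real (Suc n)} f) \<longlonglongrightarrow> 0"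
    by (rule Lim_null_comparison[OF _ lim1]) (use s(4) in auto)
  from tendsto_add[OF this lf] have sI: "(\<lambda>n. Bochner_Integration.simple_bochner_integral lborel (s n)) \<longlonglongrightarrow> I" by simp
  have bound: "(\<integral>\<^sup>+x. ennreal (norm (F x - s n x)) \<partial>lborel) \<le>
      ennreal (1 / real (Suc n)) + (\<integral>\<^sup>+x. ennreal (indicator (- T n) x * G x) \<partial>lborel)" for n
  proof -
    have "(\<integral>\<^sup>+x. ennreal (norm (F x - s n x)) \<partial>lborel) \<le>
        (\<integral>\<^sup>+x. ennreal (e n) * indicator (T n) x + ennreal (indicator (- T n) x * G x) \<partial>lborel)"
    proof (rule nn_integral_mono)
      fix x
      show "ennreal (norm (F x - s n x)) \<le> ennreal (e n) * indicator (T n) x + ennreal (indicator (- T n) x * G x)"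
      proof (cases "x \<in> T n")
        case True
        then have "F x = f x" using T0[OF True] unfolding F_def by simp
        then show ?thesis using s(3)[OF True] True by (simp add: ennreal_leI)
      next
        case False
        then show ?thesis using s(2)[OF False] FG[of x] by (simp add: ennreal_leI)
      qed
    qed
    also have "\<dots> = (\<integral>\<^sup>+x. ennreal (e n) * indicator (T n) x \<partial>lborel) + (\<integral>\<^sup>+x. ennreal (indicator (- T n) x * G x) \<partial>lborel)"
      using T_meas'[of n] Tm[of n] by (intro nn_integral_add) auto
    also have "(\<integral>\<^sup>+x. ennreal (e n) * indicator (T n) x \<partial>lborel) = ennreal (e n) * emeasure lborel (T n)"
      using Tm by (intro nn_integral_cmult_indicator) simp
    also have "\<dots> \<le> ennreal (e n) * ennreal (real (Suc n))"
    proof (rule mult_left_mono)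
      have "1 / real (Suc n) \<le> real (Suc n)" by (simp add: field_simps)
      then have "emeasure lborel (T n) = ennreal (real (Suc n) - 1 / real (Suc n))" unfolding T_def by simp
      also have "\<dots> \<le> ennreal (real (Suc n))" by (intro ennreal_leI) simp
      finally show "emeasure lborel (T n) \<le> ennreal (real (Suc n))" .
    qed simp
    also have "\<dots> = ennreal (1 / real (Suc n))"
    proof -
      have "e n * real (Suc n) = 1 / real (Suc n)" unfolding e_def power2_eq_square by (simp del: of_nat_Suc)
      moreover have "e n \<ge> 0" unfolding e_def by simp
      ultimately show ?thesis by (simp add: ennreal_mult[symmetric] del: of_nat_Suc)
    qed
    finally show ?thesis by (simp add: add_right_mono)
  qed
  have "(\<lambda>n. \<integral>\<^sup>+x. ennreal (norm (F x - s n x)) \<partial>lborel) \<longlonglongrightarrow> 0"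
  proof (rule tendsto_sandwich[OF _ _ tendsto_const])
    show "(\<lambda>n. ennreal (1 / real (Suc n)) + (\<integral>\<^sup>+x. ennreal (indicator (- T n) x * G x) \<partial>lborel)) \<longlonglongrightarrow> 0"
      using tendsto_add[OF tendsto_ennrealI[OF lim1] outer_lim] by simp
  qed (use bound in auto)
  then show "bochner_has_integral lborel (\<lambda>x. indicator {0<..} x *\<^sub>R f x) I"
    unfolding bochner_has_integral_def F_def[symmetric] using Fm s(1) sI by blast
qed


section \<open>Uniqueness of Fourier coefficients\<close>

text \<open>By the product-to-sum formula one factor cos w is absorbed into cos (k w), at the price
  of moving \<open>k\<close> by one in both directions; therefore \<open>k\<close> is arbitrary in
  the induction on the power.\<close>

lemma integral_cos_power_eq_zero:
  fixes F :: "real \<Rightarrow> 'a::banach"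
  assumes c: "continuous_on {0..s} F"
    and z: "\<And>k::nat. integral {0..s} (\<lambda>t. cos (real k * w t) *\<^sub>R F t) = 0"
    and w: "continuous_on {0..s} w"
  shows "integral {0..s} (\<lambda>t. (cos (w t) ^ n * cos (real k * w t)) *\<^sub>R F t) = 0"
proof (induction n arbitrary: k)
  case 0
  then show ?case using z by simp
next
  case (Suc n)
  show ?case
  proof (cases k)
    \<comment> \<open>There is no frequency k - 1 here, but one cosine factor can be read as cos (1
      w).\<close>
    case 0
    have "cos (w t) ^ Suc n * cos (real k * w t) = cos (w t) ^ n * cos (real 1 * w t)" for t
      using 0 by simp
    then show ?thesis using Suc[of 1] by (simp only:)
  next
    case (Suc j)
    have prod: "cos (w t) ^ Suc n * cos (real k * w t) =
        (1/2) * (cos (w t) ^ n * cos (real (Suc k) * w t)) + (1/2) * (cos (w t) ^ n * cos (real j * w t))" for t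
    proof -
      have e: "real (Suc k) * w t = real k * w t + w t" "real j * w t = real k * w t - w t"
        using Suc by (simp_all add: algebra_simps)
      show ?thesis unfolding e cos_add cos_diff by (simp add: algebra_simps)
    qed
    have i: "(\<lambda>t. (cos (w t) ^ n * cos (real m * w t)) *\<^sub>R F t) integrable_on {0..s}" for m
      by (intro integrable_continuous_interval continuous_intros c w)
    have "integral {0..s} (\<lambda>t. (cos (w t) ^ Suc n * cos (real k * w t)) *\<^sub>R F t) =
       integral {0..s} (\<lambda>t. (1/2) *\<^sub>R ((cos (w t) ^ n * cos (real (Suc k) * w t)) *\<^sub>R F t)
          + (1/2) *\<^sub>R ((cos (w t) ^ n * cos (real j * w t)) *\<^sub>R F t))"
      unfolding prod by (simp only: scaleR_add_left scaleR_scaleR)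
    also have "\<dots> = (1/2) *\<^sub>R integral {0..s} (\<lambda>t. (cos (w t) ^ n * cos (real (Suc k) * w t)) *\<^sub>R F t)
        + (1/2) *\<^sub>R integral {0..s} (\<lambda>t. (cos (w t) ^ n * cos (real j * w t)) *\<^sub>R F t)"
      by (subst Henstock_Kurzweil_Integration.integral_add) (intro integrable_cmul i integral_cmul refl arg_cong2[where f="(+)"])+
    also have "\<dots> = 0" unfolding Suc.IH by simp
    finally show ?thesis .
  qed
qed

text \<open>Polynomials in cos w integrate to zero against \<open>F\<close> by the preceding lemma,
  and by Weierstrass they approximate g (cos w) uniformly.\<close>

lemma integral_fun_cos_eq_zero:
  fixes F :: "real \<Rightarrow> 'a::banach"
  assumes c: "continuous_on {0..s} F"
    and z: "\<And>k::nat. integral {0..s} (\<lambda>t. cos (real k * w t) *\<^sub>R F t) = 0"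
    and w: "continuous_on {0..s} w" and g: "continuous_on {-1..1} g"
  shows "integral {0..s} (\<lambda>t. g (cos (w t)) *\<^sub>R F t) = 0"
proof -
  have gw: "continuous_on {0..s} (\<lambda>t. g (cos (w t)))"
    by (rule continuous_on_compose2[OF g]) (auto intro!: continuous_intros w)
  define K where "K = integral {0..s} (\<lambda>t. norm (F t))"
  have K: "K \<ge> 0" unfolding K_def by (intro integral_nonneg integrable_continuous_interval continuous_intros c) simp
  have bound: "norm (integral {0..s} (\<lambda>t. g (cos (w t)) *\<^sub>R F t)) \<le> e * K" if e: "e > 0" for e
  proof -
    obtain p where p: "real_polynomial_function p" "\<And>x. x \<in> {-1..1} \<Longrightarrow> \<bar>g x - p x\<bar> < e"
      using Stone_Weierstrass_real_polynomial_function[OF _ g e] by auto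
    obtain a n where pa: "p = (\<lambda>x. \<Sum>i\<le>n. a i * x^i)" using p(1) real_polynomial_function_iff_sum by auto
    have pw: "continuous_on {0..s} (\<lambda>t. p (cos (w t)))"
      unfolding pa by (intro continuous_intros w)
    have i: "(\<lambda>t. cos (w t) ^ i *\<^sub>R F t) integrable_on {0..s}" for i
      by (intro integrable_continuous_interval continuous_intros c w)
    have "integral {0..s} (\<lambda>t. p (cos (w t)) *\<^sub>R F t) =
        integral {0..s} (\<lambda>t. \<Sum>i\<le>n. a i *\<^sub>R (cos (w t) ^ i *\<^sub>R F t))"
      unfolding pa by (simp add: scaleR_sum_left)
    also have "\<dots> = (\<Sum>i\<le>n. a i *\<^sub>R integral {0..s} (\<lambda>t. cos (w t) ^ i *\<^sub>R F t))"
      using i by (subst integral_sum) (auto intro: integrable_cmul simp del: scaleR_scaleR)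
    also have "\<dots> = 0"
      using integral_cos_power_eq_zero[OF c z w, where k=0] by simp
    finally have pz: "integral {0..s} (\<lambda>t. p (cos (w t)) *\<^sub>R F t) = 0" .
    have ip: "(\<lambda>t. p (cos (w t)) *\<^sub>R F t) integrable_on {0..s}"
      by (intro integrable_continuous_interval continuous_intros c pw)
    have ig: "(\<lambda>t. g (cos (w t)) *\<^sub>R F t) integrable_on {0..s}"
      by (intro integrable_continuous_interval continuous_intros c gw)
    have "integral {0..s} (\<lambda>t. g (cos (w t)) *\<^sub>R F t) =
        integral {0..s} (\<lambda>t. g (cos (w t)) *\<^sub>R F t - p (cos (w t)) *\<^sub>R F t)"
      using Henstock_Kurzweil_Integration.integral_diff[OF ig ip] pz by simp
    also have "norm \<dots> \<le> integral {0..s} (\<lambda>t. e * norm (F t))"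
    proof (rule integral_norm_bound_integral)
      fix t
      have "norm (g (cos (w t)) *\<^sub>R F t - p (cos (w t)) *\<^sub>R F t) = \<bar>g (cos (w t)) - p (cos (w t))\<bar> * norm (F t)"
        by (simp add: scaleR_left_diff_distrib[symmetric])
      also have "\<dots> \<le> e * norm (F t)"
        using p(2)[of "cos (w t)"] by (intro mult_right_mono) auto
      finally show "norm (g (cos (w t)) *\<^sub>R F t - p (cos (w t)) *\<^sub>R F t) \<le> e * norm (F t)" .
    qed (intro integrable_diff ig ip integrable_continuous_interval continuous_intros c)+
    also have "\<dots> = e * K" unfolding K_def by simp
    finally show ?thesis .
  qed
  have "norm (integral {0..s} (\<lambda>t. g (cos (w t)) *\<^sub>R F t)) \<le> 0 + e" if "e > 0" for e
  proof -
    have "norm (integral {0..s} (\<lambda>t. g (cos (w t)) *\<^sub>R F t)) \<le> e / (K + 1) * K"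
      using bound[of "e / (K + 1)"] that K by simp
    also have "\<dots> \<le> e" using that K by (simp add: field_simps)
    finally show ?thesis by simp
  qed
  then show ?thesis using field_le_epsilon by (metis norm_le_zero_iff)
qed

text \<open>Testing against trigonometric functions amounts to testing against all continuous
  functions of cos w, with w the phase measured from \<open>t0\<close>. Among these is a nonnegative
  bump concentrated at \<open>t0\<close>; its integral against \<open>F\<close> is close to
  \<open>F t0\<close> times its mass, so it cannot vanish unless \<open>F t0\<close> does.\<close>

lemma Fourier_coefficients_eq_zero:
  fixes F :: "real \<Rightarrow> 'a::banach"
  assumes c: "continuous_on {0..s} F"
    and zc: "\<And>k::nat. integral {0..s} (\<lambda>t. cos (2 * pi * real k / s * t) *\<^sub>R F t) = 0"
    and zs: "\<And>k::nat. integral {0..s} (\<lambda>t. sin (2 * pi * real k / s * t) *\<^sub>R F t) = 0"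
    and t0: "0 < t0" "t0 < s"
  shows "F t0 = 0"
proof (rule ccontr)
  assume F0: "F t0 \<noteq> 0"
  \<comment> \<open>Since \<open>t0\<close> is interior, cos (w t) = 1 holds within [0, s] at
    \<open>t0\<close> only, and so large values of cos (w t) occur only near
    \<open>t0\<close>.\<close>
  define w where "w t = 2 * pi / s * (t - t0)" for t
  have w: "continuous_on {0..s} w" unfolding w_def by (intro continuous_intros)
  have z: "integral {0..s} (\<lambda>t. cos (real k * w t) *\<^sub>R F t) = 0" for k :: nat
  proof -
    let ?p = "2 * pi * real k / s"
    have "cos (real k * w t) *\<^sub>R F t =
        cos (?p * t0) *\<^sub>R (cos (?p * t) *\<^sub>R F t) + sin (?p * t0) *\<^sub>R (sin (?p * t) *\<^sub>R F t)" for t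
    proof -
      have e: "real k * w t = ?p * t - ?p * t0"
        unfolding w_def by (simp add: algebra_simps diff_divide_distrib)
      show ?thesis unfolding e cos_diff by (simp add: scaleR_add_left mult.commute)
    qed
    then have "integral {0..s} (\<lambda>t. cos (real k * w t) *\<^sub>R F t) =
        integral {0..s} (\<lambda>t. cos (?p * t0) *\<^sub>R (cos (?p * t) *\<^sub>R F t) + sin (?p * t0) *\<^sub>R (sin (?p * t) *\<^sub>R F t))"
      by (simp only:)
    also have "\<dots> = cos (?p * t0) *\<^sub>R integral {0..s} (\<lambda>t. cos (?p * t) *\<^sub>R F t)
        + sin (?p * t0) *\<^sub>R integral {0..s} (\<lambda>t. sin (?p * t) *\<^sub>R F t)"
      by (subst Henstock_Kurzweil_Integration.integral_add)
        (use t0 in \<open>auto intro!: integrable_continuous_interval continuous_intros c simp del: scaleR_scaleR\<close>)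
    also have "\<dots> = 0" unfolding zc zs by simp
    finally show ?thesis .
  qed
  have "continuous (at t0 within {0..s}) F" using c t0 by (simp add: continuous_on_eq_continuous_within)
  then obtain d where d: "d > 0" "\<And>t. t \<in> {0..s} \<Longrightarrow> \<bar>t - t0\<bar> < d \<Longrightarrow> norm (F t - F t0) < norm (F t0) / 2"
    unfolding continuous_within_eps_delta using F0 by (metis dist_norm half_gt_zero real_norm_def zero_less_norm_iff)
  define C where "C = {t \<in> {0..s}. d \<le> \<bar>t - t0\<bar>}"
  have "C = {0..s} \<inter> {t. d \<le> \<bar>t - t0\<bar>}" unfolding C_def by auto
  then have cC: "compact C" by (auto intro!: compact_Int_closed closed_Collect_le continuous_intros)
  have "\<exists>\<eta>>0. \<forall>t\<in>C. cos (w t) \<le> 1 - \<eta>"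
  proof (cases "C = {}")
    case False
    have "continuous_on C (\<lambda>t. cos (w t))" unfolding w_def by (intro continuous_intros)
    then obtain m where m: "m \<in> C" "\<And>t. t \<in> C \<Longrightarrow> cos (w t) \<le> cos (w m)"
      using continuous_attains_sup[OF cC False] by blast
    have m': "0 \<le> m" "m \<le> s" "d \<le> \<bar>m - t0\<bar>" using m(1) unfolding C_def by auto
    have "cos (w m) \<noteq> 1"
    proof
      assume "cos (w m) = 1"
      then obtain j :: int where j: "w m = of_int j * (2 * pi)" using cos_one_2pi_int by auto
      have "w m = ((m - t0) / s) * (2 * pi)" unfolding w_def by simp
      then have "((m - t0) / s) * (2 * pi) = of_int j * (2 * pi)" using j by (simp only:)
      then have "(m - t0) / s = of_int j" by (subst (asm) mult_right_cancel) auto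
      moreover have "-1 < (m - t0) / s" "(m - t0) / s < 1" using m' t0 by (auto simp: field_simps)
      ultimately have "j = 0" by simp
      then have "m = t0" using \<open>(m - t0) / s = of_int j\<close> t0 by simp
      then show False using m' d(1) by simp
    qed
    then have "1 - cos (w m) > 0" using cos_le_one[of "w m"] by linarith
    then show ?thesis using m(2) by (intro exI[of _ "1 - cos (w m)"]) auto
  qed (auto intro: exI[of _ 1])
  then obtain \<eta> where \<eta>: "\<eta> > 0" "\<And>t. t \<in> C \<Longrightarrow> cos (w t) \<le> 1 - \<eta>" by blast
  \<comment> \<open>Subtracting 1 - \<eta>, a bound for cos (w t) on \<open>C\<close>, leaves a bump
    supported within distance \<open>d\<close> of \<open>t0\<close>.\<close>
  define g where "g x = max 0 (x - (1 - \<eta>))" for x :: real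
  have gc: "continuous_on X g" for X unfolding g_def by (intro continuous_intros)
  define b where "b t = g (cos (w t))" for t
  have bc: "continuous_on {0..s} b"
    unfolding b_def by (rule continuous_on_compose2[OF gc[of UNIV]]) (auto intro!: continuous_intros w)
  have b0: "b t \<ge> 0" for t unfolding b_def g_def by simp
  have bC: "b t = 0" if "t \<in> C" for t unfolding b_def g_def using \<eta>(2)[OF that] by simp
  have "b t0 > 0" unfolding b_def g_def w_def using \<eta>(1) by simp
  then have "\<not> (\<forall>t\<in>{0..s}. b t = 0)" using t0 by (metis atLeastAtMost_iff less_imp_le less_irrefl)
  then have "integral {0..s} b \<noteq> 0" using integral_eq_0_iff[OF bc] b0 t0 by simp
  moreover have "integral {0..s} b \<ge> 0" by (intro integral_nonneg integrable_continuous_interval bc b0)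
  ultimately have bpos: "integral {0..s} b > 0" by simp
  have bz: "integral {0..s} (\<lambda>t. b t *\<^sub>R F t) = 0"
    unfolding b_def by (rule integral_fun_cos_eq_zero[OF c z w gc])
  \<comment> \<open>As the integral of b F vanishes, this is \<open>F t0\<close> times the mass of
    \<open>b\<close>; but on the support of \<open>b\<close> the integrand is at most half as large
    as that requires.\<close>
  have "integral {0..s} (\<lambda>t. b t *\<^sub>R (F t0 - F t)) = integral {0..s} (\<lambda>t. b t *\<^sub>R F t0 - b t *\<^sub>R F t)"
    by (simp add: scaleR_right_diff_distrib)
  also have "\<dots> = integral {0..s} (\<lambda>t. b t *\<^sub>R F t0)"
    using bz by (subst Henstock_Kurzweil_Integration.integral_diff) (auto intro!: integrable_continuous_interval continuous_intros c bc)
  also have "\<dots> = integral {0..s} b *\<^sub>R F t0"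
    using integral_linear[OF integrable_continuous_interval[OF bc] bounded_linear_scaleR_left, of "F t0"] by (simp add: o_def)
  finally have "norm (integral {0..s} b *\<^sub>R F t0) = norm (integral {0..s} (\<lambda>t. b t *\<^sub>R (F t0 - F t)))" by simp
  also have "\<dots> \<le> integral {0..s} (\<lambda>t. b t * (norm (F t0) / 2))"
  proof (rule integral_norm_bound_integral)
    fix t assume t: "t \<in> {0..s}"
    show "norm (b t *\<^sub>R (F t0 - F t)) \<le> b t * (norm (F t0) / 2)"
    proof (cases "t \<in> C")
      case False
      then have "norm (F t0 - F t) \<le> norm (F t0) / 2"
        using d(2)[OF t] t unfolding C_def by (auto simp: norm_minus_commute)
      then show ?thesis using b0[of t] by (simp add: mult_left_mono del: times_divide_eq_right)
    qed (simp add: bC)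
  qed (auto intro!: integrable_continuous_interval continuous_intros c bc)
  also have "\<dots> = integral {0..s} b * (norm (F t0) / 2)" by simp
  finally show False using bpos F0 by simp
qed

text \<open>Subtracting the mean removes the coefficient for k = 0, and a constant contributes
  nothing to the others.\<close>

lemma eq_mean_if_Fourier_coefficients_eq_zero:
  fixes F :: "real \<Rightarrow> 'a::banach"
  assumes c: "continuous_on {0..s} F"
    and zc: "\<And>k::nat. k > 0 \<Longrightarrow> integral {0..s} (\<lambda>t. cos (2 * pi * real k / s * t) *\<^sub>R F t) = 0"
    and zs: "\<And>k::nat. k > 0 \<Longrightarrow> integral {0..s} (\<lambda>t. sin (2 * pi * real k / s * t) *\<^sub>R F t) = 0"
    and t0: "0 < t0" "t0 < s"
  shows "F t0 = (1 / s) *\<^sub>R integral {0..s} F"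
proof -
  have s: "s > 0" using t0 by simp
  define m where "m = (1 / s) *\<^sub>R integral {0..s} F"
  have "F t0 - m = 0"
  proof (rule Fourier_coefficients_eq_zero[OF _ _ _ t0])
    show "continuous_on {0..s} (\<lambda>t. F t - m)" by (intro continuous_intros c)
    have split: "integral {0..s} (\<lambda>t. h t *\<^sub>R (F t - m)) = integral {0..s} (\<lambda>t. h t *\<^sub>R F t) - integral {0..s} h *\<^sub>R m"
      if h: "continuous_on {0..s} h" for h :: "real \<Rightarrow> real"
    proof -
      have "integral {0..s} (\<lambda>t. h t *\<^sub>R (F t - m)) = integral {0..s} (\<lambda>t. h t *\<^sub>R F t) - integral {0..s} (\<lambda>t. h t *\<^sub>R m)"
        unfolding scaleR_right_diff_distrib
        by (intro Henstock_Kurzweil_Integration.integral_diff integrable_continuous_interval continuous_intros c h)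
      also have "integral {0..s} (\<lambda>t. h t *\<^sub>R m) = integral {0..s} h *\<^sub>R m"
        using integral_linear[OF integrable_continuous_interval[OF h] bounded_linear_scaleR_left, of m] by (simp add: o_def)
      finally show ?thesis .
    qed
    fix k :: nat
    have dc: "integral {0..s} (\<lambda>t. cos (2 * pi * real k / s * t)) = 0" if "k > 0"
    proof -
      have "((\<lambda>t. cos (2 * pi * real k / s * t)) has_integral
         sin (2 * pi * real k / s * s) / (2 * pi * real k / s) - sin (2 * pi * real k / s * 0) / (2 * pi * real k / s)) {0..s}"
        using s by (intro fundamental_theorem_of_calculus)
          (use s that in \<open>auto intro!: derivative_eq_intros simp flip: has_real_derivative_iff_has_vector_derivative\<close>)
      moreover have "sin (2 * pi * real k / s * s) = 0"
        using s sin_int_2pin[of "int k"] by simp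
      ultimately show ?thesis by (simp add: integral_unique)
    qed
    have ds: "integral {0..s} (\<lambda>t. sin (2 * pi * real k / s * t)) = 0" if "k > 0"
    proof -
      have "((\<lambda>t. sin (2 * pi * real k / s * t)) has_integral
         - cos (2 * pi * real k / s * s) / (2 * pi * real k / s) - (- cos (2 * pi * real k / s * 0) / (2 * pi * real k / s))) {0..s}"
        using s by (intro fundamental_theorem_of_calculus)
          (use s that in \<open>auto intro!: derivative_eq_intros simp flip: has_real_derivative_iff_has_vector_derivative\<close>)
      moreover have "cos (2 * pi * real k / s * s) = 1"
        using s cos_int_2pin[of "int k"] by simp
      ultimately show ?thesis by (simp add: integral_unique)
    qed
    show "integral {0..s} (\<lambda>t. cos (2 * pi * real k / s * t) *\<^sub>R (F t - m)) = 0"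
    proof (cases "k = 0")
      case True
      then show ?thesis using split[of "\<lambda>_. 1"] s unfolding m_def by simp
    next
      case False
      then show ?thesis using zc[of k] dc by (subst split) (use s in \<open>auto intro!: continuous_intros\<close>)
    qed
    show "integral {0..s} (\<lambda>t. sin (2 * pi * real k / s * t) *\<^sub>R (F t - m)) = 0"
    proof (cases "k = 0")
      case False
      then show ?thesis using zs[of k] ds by (subst split) (use s in \<open>auto intro!: continuous_intros\<close>)
    qed simp
  qed
  then show ?thesis unfolding m_def by simp
qed

section \<open>Calculus in Banach algebras\<close>

text \<open>The resolvent identity has exactly this shape: it gives the difference quotient in
  closed form, and only its limit remains to be found.\<close>

lemma has_vector_derivative_Caratheodory:
  fixes f g :: "real \<Rightarrow> 'a::real_normed_vector"
  assumes eq: "\<forall>\<^sub>F y in at x. f y - f x = (y - x) *\<^sub>R g y" and g: "(g \<longlongrightarrow> g') (at x)"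
  shows "(f has_vector_derivative g') (at x)"
  unfolding has_vector_derivative_def has_derivative_iff_norm
proof
  show "bounded_linear (\<lambda>h. h *\<^sub>R g')" by (rule bounded_linear_scaleR_left)
  have "\<forall>\<^sub>F y in at x. norm (g y - g') = norm (f y - f x - (y - x) *\<^sub>R g') / norm (y - x)"
    using eq eventually_neq_at_within[of x x UNIV]
  proof eventually_elim
    case (elim y)
    then have "f y - f x - (y - x) *\<^sub>R g' = (y - x) *\<^sub>R (g y - g')" by (simp add: scaleR_right_diff_distrib)
    then show ?case using elim(2) by simp
  qed
  moreover have "((\<lambda>y. norm (g y - g')) \<longlongrightarrow> 0) (at x)"
    using g by (simp add: LIM_zero tendsto_norm_zero)
  ultimately show "((\<lambda>y. norm (f y - f x - (y - x) *\<^sub>R g') / norm (y - x)) \<longlongrightarrow> 0) (at x)"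
    by (rule Lim_transform_eventually[rotated])
qed

lemma norm_exp_minus_two_terms_le:
  fixes x :: "'b::{real_normed_algebra_1,banach}"
  shows "norm (exp x - 1 - x) \<le> exp (norm x) - 1 - norm x"
proof -
  let ?f = "\<lambda>x::'b. \<lambda>n. x ^ (n + 2) /\<^sub>R fact (n + 2)"
  let ?g = "\<lambda>n. (norm x) ^ (n + 2) /\<^sub>R fact (n + 2)"
  have e: "exp x - 1 - x = (\<Sum>n. ?f x n)" using exp_first_two_terms[of x] by simp
  have g: "exp (norm x) - 1 - norm x = (\<Sum>n. ?g n)" using exp_first_two_terms[of "norm x"] by simp
  have sg: "summable ?g"
    using summable_exp_generic[of "norm x"] summable_iff_shift[of "\<lambda>n. (norm x) ^ n /\<^sub>R fact n" 2] by simp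
  have le: "norm (?f x n) \<le> ?g n" for n
    by (simp only: norm_scaleR real_scaleR_def) (auto intro!: mult_left_mono norm_power_ineq simp: abs_mult simp del: power_Suc fact_Suc)
  show ?thesis unfolding e g by (rule norm_suminf_le[OF le sg])
qed

lemma isCont_exp_algebra: "isCont exp (x::'b::{real_normed_algebra_1,banach})"
proof -
  let ?B = "ball (0::'b) (norm x + 1)"
  have "uniform_limit ?B (\<lambda>n y. \<Sum>i<n. y ^ i /\<^sub>R fact i) (\<lambda>y. suminf (\<lambda>i. y ^ i /\<^sub>R fact i)) sequentially"
  proof (rule Weierstrass_m_test)
    fix n and y :: 'b assume y: "y \<in> ?B"
    have "norm (y ^ n) \<le> (norm x + 1) ^ n"
      using norm_power_ineq[of y n] power_mono[of "norm y" "norm x + 1" n] y by simp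
    then show "norm (y ^ n /\<^sub>R fact n) \<le> (norm x + 1) ^ n /\<^sub>R fact n"
      by (simp add: mult_left_mono)
  qed (rule summable_exp_generic)
  then have "uniform_limit ?B (\<lambda>n y. \<Sum>i<n. y ^ i /\<^sub>R fact i) exp sequentially"
    unfolding exp_def .
  then have "continuous_on ?B (exp :: 'b \<Rightarrow> 'b)"
    by (rule uniform_limit_theorem[rotated]) (auto intro!: always_eventually continuous_intros)
  then show ?thesis by (rule continuous_on_interior) simp
qed

lemma tendsto_exp_algebra:
  fixes f :: "'c \<Rightarrow> 'b::{real_normed_algebra_1,banach}"
  shows "(f \<longlongrightarrow> l) F \<Longrightarrow> ((\<lambda>x. exp (f x)) \<longlongrightarrow> exp l) F"
  by (rule isCont_tendsto_compose[OF isCont_exp_algebra])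

text \<open>The usual chain rule for exp fails without commutation. With it, exp (K y) = exp (K x)
  exp (K y - K x), so only the derivative of exp at 0 is needed, where the remainder of the series
  is compared with that of the real exponential.\<close>

lemma exp_has_vector_derivative_commuting:
  fixes K :: "real \<Rightarrow> 'b::{real_normed_algebra_1,banach}"
  assumes comm: "\<forall>\<^sub>F y in at x. K y * K x = K x * K y"
    and K: "(K has_vector_derivative k) (at x)"
  shows "((\<lambda>t. exp (K t)) has_vector_derivative exp (K x) * k) (at x)"
proof -
  have "(exp has_derivative (\<lambda>h::'b. h)) (at 0)"
    unfolding has_derivative_iff_norm
  proof
    have "(exp has_real_derivative 1) (at (0::real))" using DERIV_exp[of 0] by simp
    then have "((\<lambda>h. norm (exp h - 1 - h) / norm h) \<longlongrightarrow> 0) (at (0::real))"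
      unfolding has_field_derivative_def has_derivative_iff_norm by simp
    then have "((\<lambda>y::'b. norm (exp (norm y) - 1 - norm y) / norm (norm y)) \<longlongrightarrow> 0) (at 0)"
    proof (rule filterlim_compose)
      have "((\<lambda>y::'b. norm y) \<longlongrightarrow> 0) (at 0)" by (rule tendsto_norm_zero[OF tendsto_ident_at])
      then show "filterlim (norm :: 'b \<Rightarrow> real) (at 0) (at 0)"
        unfolding filterlim_at by (simp add: eventually_at_filter)
    qed
    then show "((\<lambda>y::'b. norm (exp y - exp 0 - (y - 0)) / norm (y - 0)) \<longlongrightarrow> 0) (at 0)"
    proof (rule Lim_null_comparison[rotated])
      have "norm (norm (exp y - exp 0 - (y - 0)) / norm (y - 0)) \<le> norm (exp (norm y) - 1 - norm y) / norm (norm y)" for y :: 'b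
      proof -
        have "norm (exp y - 1 - y) \<le> norm (exp (norm y) - 1 - norm y)"
          using norm_exp_minus_two_terms_le[of y] by (metis abs_ge_self order_trans real_norm_def)
        from divide_right_mono[OF this norm_ge_zero[of y]] show ?thesis by simp
      qed
      then show "\<forall>\<^sub>F y::'b in at 0. norm (norm (exp y - exp 0 - (y - 0)) / norm (y - 0)) \<le> norm (exp (norm y) - 1 - norm y) / norm (norm y)"
        by (rule always_eventually[OF allI])
    qed
  qed (rule bounded_linear_ident)
  then have e0: "(exp has_derivative (\<lambda>h::'b. h)) (at ((\<lambda>y. K y - K x) x))" by simp
  have d: "((\<lambda>y. K y - K x) has_vector_derivative k) (at x)"
    using K by (auto intro!: derivative_eq_intros)
  have "((exp \<circ> (\<lambda>y. K y - K x)) has_vector_derivative k) (at x)"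
    using vector_diff_chain_at[where g=exp] diff_chain_at[OF d[unfolded has_vector_derivative_def] e0]
    by (simp add: has_vector_derivative_def o_def)
  then have der: "((\<lambda>y. exp (K x) * exp (K y - K x)) has_vector_derivative exp (K x) * k) (at x)"
    using bounded_linear.has_vector_derivative[OF bounded_linear_mult_right] by (auto simp: o_def)
  have "\<forall>\<^sub>F y in at x. exp (K x) * exp (K y - K x) = exp (K y)"
    using comm
  proof eventually_elim
    case (elim y)
    then have "K x * (K y - K x) = (K y - K x) * K x" by (simp add: algebra_simps)
    from exp_add_commuting[OF this] show ?case by simp
  qed
  then have "\<forall>\<^sub>F y in nhds x. exp (K x) * exp (K y - K x) = exp (K y)"
    unfolding eventually_at_filter by (rule eventually_mono) auto
  then obtain S where "open S" "x \<in> S" "\<And>y. y \<in> S \<Longrightarrow> exp (K x) * exp (K y - K x) = exp (K y)"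
    unfolding eventually_nhds by blast
  from has_vector_derivative_transform_within_open[OF der this] show ?thesis .
qed

text \<open>Identities in the parameter e are proved by showing that a derivative vanishes; the
  constant is then read off at infinity, where e + b behaves like e.\<close>

lemma eq_limit_if_derivative_zero:
  fixes f :: "real \<Rightarrow> 'a::real_normed_vector"
  assumes d: "\<And>x. x > 0 \<Longrightarrow> (f has_vector_derivative 0) (at x)"
    and l: "(\<lambda>n. f (real (Suc n))) \<longlonglongrightarrow> l" and x: "x > 0"
  shows "f x = l"
proof -
  have "\<exists>c. \<forall>y\<in>{0<..}. f y = c"
  proof -
    have "(f has_derivative (\<lambda>h. 0)) (at y within {0<..})" if "y \<in> {0<..}" for y
      using d[of y] that has_derivative_at_withinI unfolding has_vector_derivative_def by fastforce
    then show ?thesis using has_derivative_zero_constant[of "{0<..}" f] by auto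
  qed
  then obtain c where c: "\<And>y. y > 0 \<Longrightarrow> f y = c" by auto
  have "(\<lambda>n. c) \<longlonglongrightarrow> l" using l c by (simp del: of_nat_Suc)
  then show ?thesis using c[OF x] LIMSEQ_unique[OF tendsto_const] by simp
qed

lemma norm_diff_le_if_derivative_le:
  fixes f :: "real \<Rightarrow> 'a::real_normed_vector"
  assumes "a \<le> b" "\<And>x. x \<in> {a..b} \<Longrightarrow> (f has_vector_derivative f' x) (at x)"
    "\<And>x. x \<in> {a..b} \<Longrightarrow> (\<phi> has_real_derivative \<phi>' x) (at x)" "\<And>x. x \<in> {a..b} \<Longrightarrow> norm (f' x) \<le> \<phi>' x"
  shows "norm (f b - f a) \<le> \<phi> b - \<phi> a"
proof (cases "a = b")
  case False
  then have "a < b" using assms(1) by simp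
  then show ?thesis
  proof (rule differentiable_bound_general[where f'=f' and \<phi>'=\<phi>'])
    show "continuous_on {a..b} f" using assms(2)
      by (intro continuous_at_imp_continuous_on ballI) (use has_vector_derivative_continuous in blast)
    show "continuous_on {a..b} \<phi>" using assms(3)
      by (intro continuous_at_imp_continuous_on ballI) (use DERIV_isCont in blast)
  qed (use assms in \<open>auto simp: has_real_derivative_iff_has_vector_derivative\<close>)
qed simp

lemma LIMSEQ_inverse_Suc: "(\<lambda>n. c / real (Suc n)) \<longlonglongrightarrow> 0"
  using tendsto_mult[OF tendsto_const[of c] LIMSEQ_inverse_real_of_nat] by (simp add: divide_inverse)

section \<open>Resolvent families\<close>

text \<open>A pseudo-resolvent with the estimate of a nonnegative operator. No element with these
  resolvents is assumed, because for an unbounded A the algebra contains (A + a)^-1 but not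
  A.\<close>

locale resolvent_family =
  fixes R :: "real \<Rightarrow> 'b::{real_normed_algebra_1,banach}" and M :: real
  assumes resolvent_identity: "0 < a \<Longrightarrow> 0 < b \<Longrightarrow> R a - R b = (b - a) *\<^sub>R (R a * R b)"
    and norm_R_le: "0 < a \<Longrightarrow> norm (R a) \<le> M / a"
begin

lemma M_nonneg: "0 \<le> M"
  using norm_R_le[of 1] norm_ge_zero[of "R 1"] by linarith

lemma R_commute:
  assumes "0 < a" "0 < b"
  shows "R a * R b = R b * R a"
proof (cases "a = b")
  case False
  have "(b - a) *\<^sub>R (R a * R b) = (b - a) *\<^sub>R (R b * R a)"
    using resolvent_identity[OF assms] resolvent_identity[OF assms(2,1)] by (metis minus_diff_eq scaleR_minus_left)
  then show ?thesis using False by simp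
qed simp

lemma isCont_R: "isCont R a" if a: "0 < a"
proof -
  have "((\<lambda>y. R y - R a) \<longlongrightarrow> 0) (at a)"
  proof (rule Lim_null_comparison)
    have "\<forall>\<^sub>F y in at a. y \<in> {a/2<..}" by (rule eventually_at_in_open') (use a in auto)
    then show "\<forall>\<^sub>F y in at a. norm (R y - R a) \<le> \<bar>a - y\<bar> * (M / (a/2) * (M / a))"
    proof eventually_elim
      case (elim y)
      then have y: "0 < y" "a / 2 < y" using a by auto
      have "norm (R y - R a) = \<bar>a - y\<bar> * norm (R y * R a)" using resolvent_identity[OF y(1) a] by simp
      also have "norm (R y * R a) \<le> norm (R y) * norm (R a)" by (rule norm_mult_ineq)
      also have "\<dots> \<le> M / y * (M / a)" by (intro mult_mono norm_R_le y a) (use M_nonneg y in auto)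
      also have "\<dots> \<le> M / (a / 2) * (M / a)"
        using M_nonneg y a by (intro mult_right_mono divide_left_mono) auto
      finally show ?case by (simp add: mult_left_mono)
    qed
    show "((\<lambda>y. \<bar>a - y\<bar> * (M / (a/2) * (M / a))) \<longlongrightarrow> 0) (at a)"
    proof -
      have "((\<lambda>y. \<bar>a - y\<bar> * (M / (a/2) * (M / a))) \<longlongrightarrow> \<bar>a - a\<bar> * (M / (a/2) * (M / a))) (at a)"
        using a by (intro tendsto_intros)
      then show ?thesis by simp
    qed
  qed
  then show ?thesis unfolding isCont_def by (rule LIM_zero_cancel)
qed

lemma continuous_on_R: "continuous_on {0<..} R"
  using isCont_R by (intro continuous_at_imp_continuous_on) auto

lemma continuous_on_R_compose [continuous_intros]:
  "continuous_on A f \<Longrightarrow> (\<And>x. x \<in> A \<Longrightarrow> 0 < f x) \<Longrightarrow> continuous_on A (\<lambda>x. R (f x))"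
  by (rule continuous_on_compose2[OF continuous_on_R]) auto

lemma R_has_vector_derivative: "(R has_vector_derivative - (R a * R a)) (at a)" if a: "0 < a"
proof (rule has_vector_derivative_Caratheodory)
  have "\<forall>\<^sub>F y in at a. y \<in> {0<..}" by (rule eventually_at_in_open') (use a in auto)
  then show "\<forall>\<^sub>F y in at a. R y - R a = (y - a) *\<^sub>R (- (R y * R a))"
  proof eventually_elim
    case (elim y)
    then show ?case using resolvent_identity[of y a] a
      by (simp add: scaleR_minus_left[symmetric] del: scaleR_minus_left)
  qed
  show "((\<lambda>y. - (R y * R a)) \<longlongrightarrow> - (R a * R a)) (at a)"
    using isCont_R[OF a] unfolding isCont_def by (intro tendsto_intros)
qed

text \<open>The oriented integral of \<open>R\<close> from 1 to \<open>t\<close>; whichever interval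
  is empty contributes zero. It stands for log(A + t) - log(A + 1), which is bounded even if neither
  logarithm is.\<close>

definition G :: "real \<Rightarrow> 'b" where
  "G t = integral {1..t} R - integral {t..1} R"

lemma R_integrable: "0 < a \<Longrightarrow> R integrable_on {a..b}"
  by (rule integrable_on_trunc[OF continuous_on_R])

text \<open>A base point below \<open>t\<close> makes \<open>G\<close> an ordinary indefinite
  integral near \<open>t\<close>, ready to be differentiated.\<close>

lemma G_eq: "G t = integral {p..t} R - integral {p..1} R" if "0 < p" "p \<le> 1" "p \<le> t"
proof (cases "1 \<le> t")
  case True
  then have "integral {p..1} R + integral {1..t} R = integral {p..t} R"
    using that by (intro Henstock_Kurzweil_Integration.integral_combine R_integrable)
  moreover have "integral {t..1} R = 0" using True by (cases "t = 1") auto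
  ultimately show ?thesis unfolding G_def by (simp add: algebra_simps)
next
  case False
  then have "integral {p..t} R + integral {t..1} R = integral {p..1} R"
    using that by (intro Henstock_Kurzweil_Integration.integral_combine R_integrable) auto
  moreover have "integral {1..t} R = 0" using False by simp
  ultimately show ?thesis unfolding G_def by (simp add: algebra_simps)
qed

lemma G_has_vector_derivative: "(G has_vector_derivative R t) (at t)" if t: "0 < t"
proof -
  define p where "p = min 1 t / 2"
  have p: "0 < p" "p \<le> 1" "p < t" using t unfolding p_def by auto
  have "((\<lambda>u. integral {p..u} R) has_vector_derivative R t) (at t within {p..t+1})"
    by (rule integral_has_vector_derivative[OF continuous_on_subset[OF continuous_on_R]]) (use p in auto)
  then have "((\<lambda>u. integral {p..u} R) has_vector_derivative R t) (at t)"
    using at_within_Icc_at[of p t "t+1"] p by simp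
  then have "((\<lambda>u. integral {p..u} R - integral {p..1} R) has_vector_derivative R t) (at t)"
    by (auto intro!: derivative_eq_intros)
  then show ?thesis
    by (rule has_vector_derivative_transform_within_open[where S="{p<..}"]) (use p G_eq in auto)
qed

text \<open>Commutation with an arbitrary \<open>x\<close> is the form that passes on to everything
  derived from \<open>R\<close>. Inserting first \<open>R a\<close> and then \<open>G r\<close> for
  \<open>x\<close> shows that these objects commute with one another.\<close>

lemma G_commute_if:
  assumes x: "\<And>a. 0 < a \<Longrightarrow> x * R a = R a * x" and t: "0 < t"
  shows "x * G t = G t * x"
proof -
  have i: "x * integral {a..b} R = integral {a..b} R * x" if "0 < a" for a b
  proof -
    have "x * integral {a..b} R = integral {a..b} (\<lambda>t. x * R t)"
      using integral_linear[OF R_integrable[OF that] bounded_linear_mult_right, of b x] by (simp add: o_def)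
    also have "\<dots> = integral {a..b} (\<lambda>t. R t * x)"
      by (rule integral_cong) (use x that in auto)
    also have "\<dots> = integral {a..b} R * x"
      using integral_linear[OF R_integrable[OF that] bounded_linear_mult_left, of b x] by (simp add: o_def)
    finally show ?thesis .
  qed
  show ?thesis unfolding G_def using i t by (simp add: algebra_simps)
qed

lemma R_G_commute: "0 < a \<Longrightarrow> 0 < t \<Longrightarrow> R a * G t = G t * R a"
  by (rule G_commute_if) (auto intro: R_commute)

lemma G_commute: "0 < r \<Longrightarrow> 0 < t \<Longrightarrow> G r * G t = G t * G r"
  by (rule G_commute_if) (auto simp: R_G_commute)

lemma isCont_G: "0 < t \<Longrightarrow> isCont G t"
  using G_has_vector_derivative has_vector_derivative_continuous by blast

end

lemma exp_commute_if:
  fixes x y :: "'b::{real_normed_algebra_1,banach}"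
  assumes "x * y = y * x"
  shows "x * exp y = exp y * x"
proof -
  have p: "x * y ^ n = y ^ n * x" for n
    by (induction n) (simp_all add: assms mult.assoc[symmetric], simp add: assms mult.assoc)
  have s: "summable (\<lambda>n. y ^ n /\<^sub>R fact n)" by (rule summable_exp_generic)
  have "x * exp y = (\<Sum>n. x * (y ^ n /\<^sub>R fact n))"
    unfolding exp_def by (rule suminf_mult[OF s, symmetric])
  also have "\<dots> = (\<Sum>n. (y ^ n /\<^sub>R fact n) * x)" using p by simp
  also have "\<dots> = exp y * x" unfolding exp_def by (rule suminf_mult2[OF s, symmetric])
  finally show ?thesis .
qed

section \<open>Fractional powers of nonnegative elements of a Banach algebra\<close>

locale bounded_nonneg =
  fixes b :: "'b::{real_normed_algebra_1,banach}" and R :: "real \<Rightarrow> 'b" and M :: real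
  assumes R_right: "0 < a \<Longrightarrow> (a *\<^sub>R 1 + b) * R a = 1"
    and R_left: "0 < a \<Longrightarrow> R a * (a *\<^sub>R 1 + b) = 1"
    and norm_R: "0 < a \<Longrightarrow> norm (R a) \<le> M / a"

sublocale bounded_nonneg \<subseteq> resolvent_family R M
proof
  fix a c :: real assume ac: "0 < a" "0 < c"
  have "R a * ((c *\<^sub>R 1 + b) - (a *\<^sub>R 1 + b)) * R c = R a * ((c *\<^sub>R 1 + b) * R c) - R a * (a *\<^sub>R 1 + b) * R c"
    by (simp add: algebra_simps)
  also have "\<dots> = R a - R c" using R_right[OF ac(2)] R_left[OF ac(1)] by simp
  finally show "R a - R c = (c - a) *\<^sub>R (R a * R c)" by (simp add: algebra_simps)
qed (rule norm_R)

section \<open>The logarithm of e + b and its exponentials\<close>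

context bounded_nonneg
begin

lemma b_R: "0 < a \<Longrightarrow> b * R a = 1 - a *\<^sub>R R a"
  using R_right[of a] by (simp add: algebra_simps)

lemma R_b: "0 < a \<Longrightarrow> R a * b = 1 - a *\<^sub>R R a"
  using R_left[of a] by (simp add: algebra_simps)

lemma b_R_commute: "0 < a \<Longrightarrow> b * R a = R a * b"
  by (simp add: b_R R_b)

lemma norm_b_R_le: "0 < a \<Longrightarrow> norm (b * R a) \<le> norm b * M / a"
  using norm_mult_ineq[of b "R a"] mult_left_mono[OF norm_R[of a], of "norm b"] by simp

lemma norm_b_R_le': "0 < a \<Longrightarrow> norm (b * R a) \<le> 1 + M"
proof -
  assume a: "0 < a"
  have "norm (b * R a) \<le> norm (1::'b) + norm (a *\<^sub>R R a)" unfolding b_R[OF a] by (rule norm_triangle_ineq4)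
  also have "norm (a *\<^sub>R R a) \<le> M" using norm_R[OF a] a by (simp add: field_simps)
  finally show ?thesis by simp
qed

text \<open>Both terms diverge at infinity, but the derivative 1/t - R t = b R t / t of the
  difference is of order 1/t^2, so \<open>K\<close> converges.\<close>

definition K :: "real \<Rightarrow> 'b" where "K t = ln t *\<^sub>R 1 - G t"

lemma K_has_vector_derivative:
  assumes t: "0 < t" shows "(K has_vector_derivative (1 / t) *\<^sub>R (b * R t)) (at t)"
proof -
  have "((\<lambda>t. ln t *\<^sub>R (1::'b)) has_vector_derivative (1 / t) *\<^sub>R 1) (at t)"
    using t by (auto intro!: derivative_eq_intros simp: has_real_derivative_iff_has_vector_derivative[symmetric] divide_inverse)
  then have "(K has_vector_derivative (1 / t) *\<^sub>R 1 - R t) (at t)"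
    unfolding K_def[abs_def] by (rule has_vector_derivative_diff[OF _ G_has_vector_derivative[OF t]])
  then show ?thesis using t by (simp add: b_R scaleR_right_diff_distrib)
qed

lemma K_diff_le:
  assumes "0 < r" "r \<le> t"
  shows "norm (K t - K r) \<le> norm b * M / r"
proof -
  have "norm (K t - K r) \<le> - (norm b * M / t) - (- (norm b * M / r))"
  proof (rule norm_diff_le_if_derivative_le[OF assms(2)])
    fix x assume "x \<in> {r..t}"
    then have x: "0 < x" using assms by auto
    show "(K has_vector_derivative (1 / x) *\<^sub>R (b * R x)) (at x)" by (rule K_has_vector_derivative[OF x])
    show "((\<lambda>t. - (norm b * M / t)) has_real_derivative norm b * M / (x * x)) (at x)"
      using x by (auto intro!: derivative_eq_intros)
    show "norm ((1 / x) *\<^sub>R (b * R x)) \<le> norm b * M / (x * x)"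
      using norm_b_R_le[OF x] x by (simp add: field_simps)
  qed
  also have "\<dots> \<le> norm b * M / r" using assms M_nonneg by simp
  finally show ?thesis .
qed

definition C :: 'b where "C = lim (\<lambda>n. K (real (Suc n)))"

lemma K_tendsto: "(\<lambda>n. K (real (Suc n))) \<longlonglongrightarrow> C"
proof -
  have "Cauchy (\<lambda>n. K (real (Suc n)))"
  proof (rule metric_CauchyI)
    fix e :: real assume e: "e > 0"
    obtain N :: nat where N: "norm b * M / e < real N" using reals_Archimedean2 by blast
    have half: "norm (K (real (Suc m)) - K (real (Suc n))) < e" if mn: "N \<le> n" "n \<le> m" for m n
    proof -
      have "norm (K (real (Suc m)) - K (real (Suc n))) \<le> norm b * M / real (Suc n)"
        using mn by (intro K_diff_le) auto
      moreover have "norm b * M / e < real (Suc n)" using N mn by simp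
      then have "norm b * M / real (Suc n) < e" using e by (simp add: field_simps del: of_nat_Suc)
      ultimately show ?thesis by simp
    qed
    have "dist (K (real (Suc m))) (K (real (Suc n))) < e" if "m \<ge> N" "n \<ge> N" for m n
      using half[of n m] half[of m n] that by (cases "n \<le> m") (auto simp: dist_norm norm_minus_commute)
    then show "\<exists>N. \<forall>m\<ge>N. \<forall>n\<ge>N. dist (K (real (Suc m))) (K (real (Suc n))) < e" by blast
  qed
  then show ?thesis unfolding C_def by (simp add: Cauchy_convergent_iff convergent_LIMSEQ_iff)
qed

text \<open>\<open>L e\<close> is the logarithm of \<open>e + b\<close>: it has the derivative \<open>(e + b)\<^sup>-\<^sup>1\<close> in \<open>e\<close>, and
  \<open>C\<close> is chosen such that \<open>L e - ln e\<close> tends to 0 as \<open>e\<close> tends to infinity.\<close>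

definition L :: "real \<Rightarrow> 'b" where "L e = G e + C"

lemma L_has_vector_derivative:
  assumes e: "0 < e" shows "(L has_vector_derivative R e) (at e)"
proof -
  have "((\<lambda>e. G e + C) has_vector_derivative R e + 0) (at e)"
    by (rule has_vector_derivative_add[OF G_has_vector_derivative[OF e] has_vector_derivative_const])
  moreover have "L = (\<lambda>e. G e + C)" by (rule ext) (rule L_def)
  ultimately show ?thesis by (simp only: add_0_right)
qed

lemma norm_L_le: assumes e: "0 < e" shows "norm (L e - ln e *\<^sub>R 1) \<le> norm b * M / e"
proof -
  have "(\<lambda>n. norm (K (real (Suc n)) - K e)) \<longlonglongrightarrow> norm (C - K e)"
    by (intro tendsto_intros K_tendsto)
  moreover obtain N :: nat where "e < real N" using reals_Archimedean2 by blast
  then have "\<forall>n\<ge>N. norm (K (real (Suc n)) - K e) \<le> norm b * M / e"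
    using e by (intro allI impI K_diff_le) auto
  ultimately have "norm (C - K e) \<le> norm b * M / e" by (rule LIMSEQ_le_const2[OF _ exI])
  then show ?thesis unfolding L_def K_def by (simp add: algebra_simps)
qed

lemma L_tendsto: "(\<lambda>n. L (real (Suc n)) - ln (real (Suc n)) *\<^sub>R 1) \<longlonglongrightarrow> 0"
  by (rule Lim_null_comparison[OF _ LIMSEQ_inverse_Suc[of "norm b * M"]])
    (simp add: norm_L_le del: of_nat_Suc)

text \<open>Identifies the logarithms of \<delta> + R e and \<delta> + 1 - R 1 with explicit
  expressions in \<open>G\<close>, see \<open>P_RS\<close> and \<open>P_RT\<close>.\<close>

lemma L_unique:
  assumes d: "\<And>e. 0 < e \<Longrightarrow> (f has_vector_derivative R e) (at e)"
    and l: "(\<lambda>n. f (real (Suc n)) - ln (real (Suc n)) *\<^sub>R 1) \<longlonglongrightarrow> 0" and e: "0 < e"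
  shows "f e = L e"
proof -
  have "f e - L e = 0"
  proof (rule eq_limit_if_derivative_zero[OF _ _ e])
    fix x :: real assume "x > 0"
    then show "((\<lambda>e. f e - L e) has_vector_derivative 0) (at x)"
      using has_vector_derivative_diff[OF d L_has_vector_derivative] by fastforce
  next
    show "(\<lambda>n. f (real (Suc n)) - L (real (Suc n))) \<longlonglongrightarrow> 0"
      using tendsto_diff[OF l L_tendsto] by simp
  qed
  then show ?thesis by simp
qed

lemma C_commute_if:
  assumes "\<And>a. 0 < a \<Longrightarrow> x * R a = R a * x"
  shows "x * C = C * x"
proof -
  have e: "x * K (real (Suc n)) = K (real (Suc n)) * x" for n
    unfolding K_def using G_commute_if[OF assms, of "real (Suc n)"] by (simp add: algebra_simps del: of_nat_Suc)
  have "(\<lambda>n. x * K (real (Suc n))) \<longlonglongrightarrow> x * C" "(\<lambda>n. x * K (real (Suc n))) \<longlonglongrightarrow> C * x"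
    by (intro tendsto_intros K_tendsto) (unfold e, intro tendsto_intros K_tendsto)
  then show ?thesis by (rule LIMSEQ_unique)
qed

lemma L_commute_if:
  assumes "\<And>a. 0 < a \<Longrightarrow> x * R a = R a * x" "0 < t"
  shows "x * L t = L t * x"
  unfolding L_def using C_commute_if[OF assms(1)] G_commute_if[OF assms] by (simp add: algebra_simps)

lemma R_L_commute: "0 < a \<Longrightarrow> 0 < t \<Longrightarrow> R a * L t = L t * R a"
  by (rule L_commute_if) (auto intro: R_commute)

lemma L_commute: "0 < r \<Longrightarrow> 0 < t \<Longrightarrow> L r * L t = L t * L r"
  by (rule L_commute_if) (auto simp: R_L_commute)

text \<open>Thus \<open>P e s\<close> is \<open>(e + b)\<^sup>s\<close>; below, \<open>Pw s\<close> is \<open>b\<^sup>s\<close>.\<close>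

definition P :: "real \<Rightarrow> real \<Rightarrow> 'b" where "P e s = exp (s *\<^sub>R L e)"

lemma P_commute_if:
  assumes "\<And>a. 0 < a \<Longrightarrow> x * R a = R a * x" "0 < t"
  shows "x * P t s = P t s * x"
  unfolding P_def by (rule exp_commute_if) (simp add: L_commute_if[OF assms])

lemma P_add: "P e (s + t) = P e s * P e t"
  unfolding P_def scaleR_add_left by (rule exp_add_commuting) simp

lemma P_zero: "P e 0 = 1"
  unfolding P_def by simp

lemma P_has_vector_derivative:
  assumes e: "0 < e"
  shows "((\<lambda>e. P e s) has_vector_derivative s *\<^sub>R (P e s * R e)) (at e)"
proof -
  have "((\<lambda>e. exp (s *\<^sub>R L e)) has_vector_derivative exp (s *\<^sub>R L e) * (s *\<^sub>R R e)) (at e)"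
  proof (rule exp_has_vector_derivative_commuting)
    have "\<forall>\<^sub>F y in at e. y \<in> {0<..}" by (rule eventually_at_in_open') (use e in auto)
    then show "\<forall>\<^sub>F y in at e. s *\<^sub>R L y * s *\<^sub>R L e = s *\<^sub>R L e * s *\<^sub>R L y"
      by eventually_elim (use L_commute e in auto)
    show "((\<lambda>e. s *\<^sub>R L e) has_vector_derivative s *\<^sub>R R e) (at e)"
      by (rule bounded_linear.has_vector_derivative[OF bounded_linear_scaleR_right L_has_vector_derivative[OF e]])
  qed
  then show ?thesis unfolding P_def by simp
qed

lemma isCont_P: "0 < e \<Longrightarrow> isCont (\<lambda>e. P e s) e"
  using P_has_vector_derivative has_vector_derivative_continuous by blast

lemma P_asymp: "(\<lambda>n. real (Suc n) powr (- s) *\<^sub>R P (real (Suc n)) s) \<longlonglongrightarrow> 1"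
proof -
  have "real (Suc n) powr (- s) *\<^sub>R P (real (Suc n)) s = exp (s *\<^sub>R (L (real (Suc n)) - ln (real (Suc n)) *\<^sub>R 1))" for n
  proof -
    let ?x = "real (Suc n)"
    have "s *\<^sub>R (L ?x - ln ?x *\<^sub>R 1) = s *\<^sub>R L ?x + of_real (- s * ln ?x)"
      by (simp add: algebra_simps of_real_def del: of_nat_Suc)
    also have "exp \<dots> = exp (s *\<^sub>R L ?x) * exp (of_real (- s * ln ?x))"
      by (rule exp_add_commuting) (simp add: of_real_def)
    also have "exp (of_real (- s * ln ?x)) = of_real (?x powr (- s))"
      unfolding exp_of_real by (simp add: powr_def mult.commute)
    finally show ?thesis unfolding P_def by (simp add: of_real_def)
  qed
  moreover have "(\<lambda>n. exp (s *\<^sub>R (L (real (Suc n)) - ln (real (Suc n)) *\<^sub>R 1))) \<longlonglongrightarrow> exp (s *\<^sub>R 0)"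
    by (intro tendsto_exp_algebra tendsto_intros L_tendsto)
  ultimately show ?thesis by simp
qed

text \<open>\<open>R e * P e 1\<close> has derivative R P R - R R P = 0 and tends to 1 at infinity,
  because e R e and e^-1 P e 1 both do.\<close>

lemma P_one: assumes e: "0 < e" shows "P e 1 = e *\<^sub>R 1 + b"
proof -
  have "R e * P e 1 = 1"
  proof (rule eq_limit_if_derivative_zero[OF _ _ e])
    fix x :: real assume x: "x > 0"
    have "((\<lambda>e. R e * P e 1) has_vector_derivative R x * (1 *\<^sub>R (P x 1 * R x)) + - (R x * R x) * P x 1) (at x)"
      by (rule has_vector_derivative_mult[OF R_has_vector_derivative[OF x] P_has_vector_derivative[OF x]])
    moreover have "P x 1 * R x = R x * P x 1"
      using P_commute_if[of "R x" x 1] R_commute x by simp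
    ultimately show "((\<lambda>e. R e * P e 1) has_vector_derivative 0) (at x)" by (simp add: mult.assoc)
  next
    have 1: "(\<lambda>n. real (Suc n) *\<^sub>R R (real (Suc n))) \<longlonglongrightarrow> 1"
    proof -
      have "(\<lambda>n. b * R (real (Suc n))) \<longlonglongrightarrow> 0"
        by (rule Lim_null_comparison[OF _ LIMSEQ_inverse_Suc[of "norm b * M"]])
          (simp add: norm_b_R_le del: of_nat_Suc)
      from tendsto_diff[OF tendsto_const this, of 1] show ?thesis
        by (simp add: b_R del: of_nat_Suc)
    qed
    have "R (real (Suc n)) * P (real (Suc n)) 1 =
        (real (Suc n) *\<^sub>R R (real (Suc n))) * (real (Suc n) powr (- 1) *\<^sub>R P (real (Suc n)) 1)" for n
      by (simp add: powr_minus_divide del: of_nat_Suc)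
    then show "(\<lambda>n. R (real (Suc n)) * P (real (Suc n)) 1) \<longlonglongrightarrow> 1"
      using tendsto_mult[OF 1 P_asymp[of 1]] by (simp del: of_nat_Suc)
  qed
  then have "(e *\<^sub>R 1 + b) * (R e * P e 1) = e *\<^sub>R 1 + b" by simp
  then show ?thesis using R_right[OF e] by (simp only: mult.assoc[symmetric]) simp
qed

end

lemma powr_tendsto_zero: "s < 0 \<Longrightarrow> (\<lambda>n. real (Suc n) powr s) \<longlonglongrightarrow> 0"
  by (rule tendsto_neg_powr) (simp_all add: filterlim_compose[OF filterlim_real_sequentially filterlim_Suc] del: of_nat_Suc)

lemma powr_tendsto_zero_at_right: "0 < s \<Longrightarrow> ((\<lambda>e::real. c * e powr s) \<longlongrightarrow> 0) (at_right 0)"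
proof -
  assume s: "0 < s"
  have "\<forall>\<^sub>F e::real in at_right 0. 0 \<le> e" by (simp add: eventually_at_filter)
  then have "((\<lambda>e::real. c * e powr s) \<longlongrightarrow> c * (0 powr s)) (at_right 0)"
    using s by (intro tendsto_intros tendsto_powr2) auto
  then show ?thesis by simp
qed

lemma sin_pi_pos: "0 < s \<Longrightarrow> s < 1 \<Longrightarrow> 0 < sin (s * pi)" for s :: real
  by (rule sin_gt_zero) auto

section \<open>Balakrishnan integrals\<close>

context bounded_nonneg
begin

text \<open>If \<open>H e\<close> is the integral, \<open>P e (1 - s) * H e\<close> is constant in \<open>e\<close>: integration by parts shows
  that the derivative of its truncated version only involves the boundary terms \<open>\<beta>\<close>. The constant is read
  off as \<open>e\<close> tends to infinity.\<close>

lemma integral_negative_power: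
  assumes s: "0 < s" "s < 1" and e: "0 < e"
  shows "has_improper_integral (\<lambda>x. x powr (s - 1) *\<^sub>R R (x + e)) ((pi / sin (s * pi)) *\<^sub>R P e (s - 1))"
proof -
  define c where "c = pi / sin (s * pi)"
  have c0: "c > 0" unfolding c_def using sin_pi_pos[OF s] by simp
  define f where "f e x = x powr (s - 1) *\<^sub>R R (x + e)" for e x
  define Hn where "Hn n e = integral {1 / real (Suc n)..real (Suc n)} (f e)" for n e
  have fc: "continuous_on {0<..} (f e)" if "0 < e" for e
    unfolding f_def using that by (intro continuous_intros) auto
  \<comment> \<open>The case b = 0 with a factor \<open>k\<close>: it is a majorant for the
    integrand and supplies the leading term for large \<open>e\<close>.\<close>
  have scal: "has_improper_integral (\<lambda>x. k * (x powr (s - 1) / (x + e))) (k * (e powr (s - 1) * c))" if "0 < e" for k e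
    unfolding c_def
    by (rule has_improper_integral_linear[OF has_improper_integral_powr[OF s that] bounded_linear_mult_right])
  have "\<exists>I. has_improper_integral (f e) I" if e: "0 < e" for e
  proof (rule has_improper_integral_dominated[OF fc[OF e] scal[OF e, of M]])
    fix x :: real assume x: "x > 0"
    have "norm (f e x) = x powr (s - 1) * norm (R (x + e))" unfolding f_def by simp
    also have "\<dots> \<le> x powr (s - 1) * (M / (x + e))" using x e by (intro mult_left_mono norm_R) auto
    finally show "norm (f e x) \<le> M * (x powr (s - 1) / (x + e))" by (simp add: mult.commute)
  qed
  then obtain H where H: "\<And>e. 0 < e \<Longrightarrow> has_improper_integral (f e) (H e)" by metis
  have HnH: "(\<lambda>n. Hn n e) \<longlonglongrightarrow> H e" if "0 < e" for e
    using H[OF that] unfolding has_improper_integral_def Hn_def by simp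
  define \<beta> where "\<beta> n e = real (Suc n) powr s *\<^sub>R R (real (Suc n) + e)
      - (1 / real (Suc n)) powr s *\<^sub>R R (1 / real (Suc n) + e)" for n e
  have Hn_der: "((\<lambda>e. Hn n e) has_vector_derivative - (R e * ((1 - s) *\<^sub>R Hn n e + \<beta> n e))) (at e)"
    if e: "0 < e" for n e
  proof -
    let ?p = "1 / real (Suc n)" and ?q = "real (Suc n)"
    have p: "0 < ?p" "?p \<le> ?q" by (auto simp: field_simps)
    have x0: "x > 0" if "x \<in> {?p..?q}" for x using that by (rule trunc_gt_zero)
    let ?g = "\<lambda>y x. x powr (s - 1) *\<^sub>R (- (R (x + y) * R (x + y)))"
    have "((\<lambda>y. integral (cbox ?p ?q) (f y)) has_vector_derivative integral (cbox ?p ?q) (?g e)) (at e within {0<..})"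
    proof (rule leibniz_rule_vector_derivative)
      fix y x :: real assume y: "y \<in> {0<..}" and "x \<in> cbox ?p ?q"
      then have x: "x > 0" using x0 by (simp only: cbox_interval)
      have "((R \<circ> (\<lambda>y. x + y)) has_vector_derivative 1 *\<^sub>R (- (R (x + y) * R (x + y)))) (at y)"
        by (rule vector_diff_chain_at[OF _ R_has_vector_derivative])
          (use x y in \<open>auto intro!: derivative_eq_intros\<close>)
      then have "((\<lambda>y. R (x + y)) has_vector_derivative - (R (x + y) * R (x + y))) (at y within {0<..})"
        by (simp add: o_def has_vector_derivative_at_within)
      then show "((\<lambda>y. f y x) has_vector_derivative ?g y x) (at y within {0<..})"
        unfolding f_def by (rule bounded_linear.has_vector_derivative[OF bounded_linear_scaleR_right])
    next
      fix y :: real assume "y \<in> {0<..}"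
      then show "f y integrable_on cbox ?p ?q"
        using integrable_on_trunc[OF fc p(1)] by (simp only: cbox_interval greaterThan_iff)
    next
      show "continuous_on ({0<..} \<times> cbox ?p ?q) (\<lambda>(y, x). ?g y x)"
        unfolding split_beta cbox_interval
        by (intro continuous_intros) (auto dest!: x0 simp del: of_nat_Suc intro: add_pos_pos)
    qed (use e in auto)
    then have der: "((\<lambda>y. Hn n y) has_vector_derivative integral {?p..?q} (?g e)) (at e)"
      unfolding Hn_def cbox_interval using e by (simp add: at_within_open[of e "{0<..}"] del: of_nat_Suc)
    \<comment> \<open>The identity R (x + e) = R e - x R e R (x + e) splits off \<open>R e\<close>;
      what remains, x R (x + e)^2, is the term to be integrated by parts.\<close>
    have RR: "R (x + e) * R (x + e) = R e * (R (x + e) - x *\<^sub>R (R (x + e) * R (x + e)))" if "x > 0" for x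
    proof -
      have "R (x + e) = R e - x *\<^sub>R (R e * R (x + e))"
        using resolvent_identity[OF e, of "x + e"] that e by (simp add: algebra_simps)
      then have "R (x + e) * R (x + e) = (R e - x *\<^sub>R (R e * R (x + e))) * R (x + e)" by (rule arg_cong)
      then show ?thesis by (simp add: algebra_simps)
    qed
    let ?h = "\<lambda>x. x powr s *\<^sub>R (R (x + e) * R (x + e))"
    have hi: "?h integrable_on {?p..?q}"
      by (rule integrable_on_trunc[OF _ p(1)]) (use e in \<open>auto intro!: continuous_intros\<close>)
    have fi: "f e integrable_on {?p..?q}" by (rule integrable_on_trunc[OF fc[OF e] p(1)])
    have "integral {?p..?q} (?g e) = integral {?p..?q} (\<lambda>x. - (R e * (f e x - ?h x)))"
    proof (rule integral_cong)
      fix x assume "x \<in> {?p..?q}"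
      then have x: "x > 0" by (rule x0)
      have pw: "x powr (s - 1) * x = x powr s" using x by (simp add: powr_diff)
      have "?g e x = - (R e * (x powr (s - 1) *\<^sub>R R (x + e) - (x powr (s - 1) * x) *\<^sub>R (R (x + e) * R (x + e))))"
        by (subst RR[OF x]) (simp add: algebra_simps)
      then show "?g e x = - (R e * (f e x - ?h x))" unfolding pw f_def .
    qed
    also have "\<dots> = - (R e * integral {?p..?q} (\<lambda>x. f e x - ?h x))"
      using integral_linear[OF integrable_diff[OF fi hi] bounded_linear_mult_right, of "R e"] by (simp add: o_def)
    also have "integral {?p..?q} (\<lambda>x. f e x - ?h x) = Hn n e - integral {?p..?q} ?h"
      unfolding Hn_def by (rule Henstock_Kurzweil_Integration.integral_diff[OF fi hi])
    \<comment> \<open>Integrates the derivative s x^(s-1) R (x + e) - x^s R (x + e)^2 of x^s R (x +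
      e) over the truncation interval.\<close>
    also have "integral {?p..?q} ?h = s *\<^sub>R Hn n e - \<beta> n e"
    proof -
      have "((\<lambda>x. s *\<^sub>R f e x - ?h x) has_integral (?q powr s *\<^sub>R R (?q + e)) - (?p powr s *\<^sub>R R (?p + e))) {?p..?q}"
      proof (rule fundamental_theorem_of_calculus[OF p(2)])
        fix x assume "x \<in> {?p..?q}"
        then have x: "x > 0" by (rule x0)
        have "((R \<circ> (\<lambda>x. x + e)) has_vector_derivative 1 *\<^sub>R (- (R (x + e) * R (x + e)))) (at x)"
          by (rule vector_diff_chain_at[OF _ R_has_vector_derivative])
            (use x e in \<open>auto intro!: derivative_eq_intros\<close>)
        then have dR: "((\<lambda>x. R (x + e)) has_vector_derivative - (R (x + e) * R (x + e))) (at x)"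
          by (simp add: o_def)
        have "((\<lambda>x. x powr s) has_real_derivative s * x powr (s - 1)) (at x)"
          using x by (rule has_real_derivative_powr)
        from has_vector_derivative_scaleR[OF this dR]
        have "((\<lambda>x. x powr s *\<^sub>R R (x + e)) has_vector_derivative
            x powr s *\<^sub>R (- (R (x + e) * R (x + e))) + (s * x powr (s - 1)) *\<^sub>R R (x + e)) (at x)" .
        then show "((\<lambda>x. x powr s *\<^sub>R R (x + e)) has_vector_derivative s *\<^sub>R f e x - ?h x) (at x within {?p..?q})"
          unfolding f_def by (simp add: has_vector_derivative_at_within)
      qed
      moreover have "integral {?p..?q} (\<lambda>x. s *\<^sub>R f e x - ?h x) = s *\<^sub>R Hn n e - integral {?p..?q} ?h"
        unfolding Hn_def
        by (subst Henstock_Kurzweil_Integration.integral_diff[OF integrable_cmul[OF fi] hi]) (simp only: integral_cmul)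
      ultimately have "s *\<^sub>R Hn n e - integral {?p..?q} ?h = \<beta> n e" unfolding \<beta>_def by (simp only: integral_unique)
      then show ?thesis by (simp add: algebra_simps)
    qed
    finally have "integral {?p..?q} (?g e) = - (R e * ((1 - s) *\<^sub>R Hn n e + \<beta> n e))" by (simp add: algebra_simps)
    then show ?thesis using der by simp
  qed
  \<comment> \<open>The upper end contributes n^s / n and the lower end n^-s. Both vanish for 0 < s
    < 1, uniformly for \<open>e\<close> bounded away from 0.\<close>
  have \<beta>_le: "norm (\<beta> n e) \<le> M * real (Suc n) powr (s - 1) + M / e * real (Suc n) powr (- s)" if e: "0 < e" for n e
  proof -
    let ?q = "real (Suc n)"
    have "norm (R (?q + e)) \<le> M / (?q + e)" using e by (intro norm_R) auto
    also have "\<dots> \<le> M / ?q" using e M_nonneg by (intro divide_left_mono) auto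
    finally have 1: "norm (?q powr s *\<^sub>R R (?q + e)) \<le> ?q powr s * (M / ?q)"
      by (simp add: mult_left_mono del: of_nat_Suc times_divide_eq_right)
    have eq1: "?q powr s * (M / ?q) = M * ?q powr (s - 1)" by (simp add: powr_diff del: of_nat_Suc)
    have "norm (R (1 / ?q + e)) \<le> M / (1 / ?q + e)" using e by (intro norm_R) (auto intro: add_pos_pos)
    also have "\<dots> \<le> M / e" using e M_nonneg by (intro divide_left_mono) (auto intro!: mult_pos_pos add_pos_pos)
    finally have 2: "norm ((1 / ?q) powr s *\<^sub>R R (1 / ?q + e)) \<le> (1 / ?q) powr s * (M / e)"
      by (simp add: mult_left_mono del: of_nat_Suc times_divide_eq_right)
    have eq2: "(1 / ?q) powr s * (M / e) = M / e * ?q powr (- s)" by (simp add: powr_divide powr_minus_divide del: of_nat_Suc)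
    show ?thesis unfolding \<beta>_def using order_trans[OF norm_triangle_ineq4 add_mono[OF 1 2]] unfolding eq1 eq2 .
  qed
  have const: "P a (1 - s) * H a = P d (1 - s) * H d" if ad: "0 < a" "a \<le> d" for a d
  proof -
    have "continuous_on {a..d} (\<lambda>e. P e (1 - s))"
      using ad isCont_P by (intro continuous_at_imp_continuous_on) auto
    then have "bounded ((\<lambda>e. P e (1 - s)) ` {a..d})"
      by (intro compact_imp_bounded compact_continuous_image) auto
    then obtain B where B: "\<And>e. e \<in> {a..d} \<Longrightarrow> norm (P e (1 - s)) \<le> B" unfolding bounded_iff by blast
    define \<delta> where "\<delta> n = M * real (Suc n) powr (s - 1) + M / a * real (Suc n) powr (- s)" for n
    have le: "norm (P d (1 - s) * Hn n d - P a (1 - s) * Hn n a) \<le> B * (M / a * \<delta> n) * d - B * (M / a * \<delta> n) * a" for n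
    proof (rule norm_diff_le_if_derivative_le[OF ad(2)])
      fix e assume "e \<in> {a..d}"
      then have e: "0 < e" "a \<le> e" "e \<in> {a..d}" using ad by auto
      have "((\<lambda>e. P e (1 - s) * Hn n e) has_vector_derivative
          P e (1 - s) * (- (R e * ((1 - s) *\<^sub>R Hn n e + \<beta> n e))) + (1 - s) *\<^sub>R (P e (1 - s) * R e) * Hn n e) (at e)"
        by (rule has_vector_derivative_mult[OF P_has_vector_derivative[OF e(1)] Hn_der[OF e(1)]])
      then show "((\<lambda>e. P e (1 - s) * Hn n e) has_vector_derivative - (P e (1 - s) * (R e * \<beta> n e))) (at e)"
        by (simp add: algebra_simps)
      show "((\<lambda>e. B * (M / a * \<delta> n) * e) has_real_derivative B * (M / a * \<delta> n)) (at e)"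
        by (rule DERIV_cmult_Id)
      have "norm (R e) \<le> M / a"
        using norm_R[OF e(1)] divide_left_mono[OF e(2) M_nonneg] ad e by (simp add: order_trans)
      moreover have "norm (\<beta> n e) \<le> \<delta> n"
      proof -
        have "M / e * real (Suc n) powr (- s) \<le> M / a * real (Suc n) powr (- s)"
          using e ad M_nonneg by (intro mult_right_mono divide_left_mono) auto
        then show ?thesis using \<beta>_le[OF e(1), of n] unfolding \<delta>_def by linarith
      qed
      ultimately have "norm (R e * \<beta> n e) \<le> M / a * \<delta> n"
        using M_nonneg ad by (intro order_trans[OF norm_mult_ineq] mult_mono) auto
      then have "norm (P e (1 - s) * (R e * \<beta> n e)) \<le> B * (M / a * \<delta> n)"
        using order_trans[OF norm_ge_zero B[OF e(3)]]
        by (intro order_trans[OF norm_mult_ineq mult_mono[OF B[OF e(3)]]]) auto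
      then show "norm (- (P e (1 - s) * (R e * \<beta> n e))) \<le> B * (M / a * \<delta> n)" by simp
    qed
    have "\<delta> \<longlonglongrightarrow> M * 0 + M / a * 0"
      unfolding \<delta>_def using s by (intro tendsto_intros powr_tendsto_zero) auto
    then have "(\<lambda>n. B * (M / a * \<delta> n) * d - B * (M / a * \<delta> n) * a) \<longlonglongrightarrow> B * (M / a * 0) * d - B * (M / a * 0) * a"
      by (intro tendsto_intros) (use ad in auto)
    then have "(\<lambda>n. B * (M / a * \<delta> n) * d - B * (M / a * \<delta> n) * a) \<longlonglongrightarrow> 0" by simp
    then have "(\<lambda>n. P d (1 - s) * Hn n d - P a (1 - s) * Hn n a) \<longlonglongrightarrow> 0"
      by (rule Lim_null_comparison[rotated]) (use le in auto)
    moreover have "(\<lambda>n. P d (1 - s) * Hn n d - P a (1 - s) * Hn n a) \<longlonglongrightarrow> P d (1 - s) * H d - P a (1 - s) * H a"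
      using ad by (intro tendsto_intros HnH) auto
    ultimately have "P d (1 - s) * H d - P a (1 - s) * H a = 0" using LIMSEQ_unique by blast
    then show ?thesis by simp
  qed
  \<comment> \<open>Against the case b = 0 the integrand changes by b R (x + e) / (x + e) times
    x^(s-1), which is smaller by a factor of order 1/e.\<close>
  have H_asymp: "norm (e powr (1 - s) *\<^sub>R H e - c *\<^sub>R 1) \<le> norm b * M * c / e" if e: "0 < e" for e
  proof -
    have "has_improper_integral (\<lambda>x. (1 * (x powr (s - 1) / (x + e))) *\<^sub>R (1::'b)) ((1 * (e powr (s - 1) * c)) *\<^sub>R 1)"
      by (rule has_improper_integral_linear[OF scal[OF e] bounded_linear_scaleR_left])
    from has_improper_integral_diff[OF H[OF e] this]
    have "norm (H e - (1 * (e powr (s - 1) * c)) *\<^sub>R 1) \<le> norm b * M / e * (e powr (s - 1) * c)"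
    proof (rule has_improper_integral_norm_bound[OF _ scal[OF e, of "norm b * M / e"]])
      fix x :: real assume x: "0 < x"
      have "f e x - (1 * (x powr (s - 1) / (x + e))) *\<^sub>R 1 = - (x powr (s - 1) / (x + e)) *\<^sub>R (b * R (x + e))"
        unfolding f_def using x e by (simp add: b_R scaleR_right_diff_distrib)
      then have "norm (f e x - (1 * (x powr (s - 1) / (x + e))) *\<^sub>R 1) = x powr (s - 1) / (x + e) * norm (b * R (x + e))"
        using x e by (simp add: abs_mult)
      also have "\<dots> \<le> x powr (s - 1) / (x + e) * (norm b * M / (x + e))"
        using x e by (intro mult_left_mono norm_b_R_le) auto
      also have "\<dots> \<le> x powr (s - 1) / (x + e) * (norm b * M / e)"
        using x e M_nonneg by (intro mult_left_mono divide_left_mono) auto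
      finally show "norm (f e x - (1 * (x powr (s - 1) / (x + e))) *\<^sub>R 1) \<le> norm b * M / e * (x powr (s - 1) / (x + e))"
        by (simp add: mult.commute)
    qed
    then have "e powr (1 - s) * norm (H e - (e powr (s - 1) * c) *\<^sub>R 1) \<le> e powr (1 - s) * (norm b * M / e * (e powr (s - 1) * c))"
      by (intro mult_left_mono) auto
    also have "\<dots> = (e powr (1 - s) * e powr (s - 1)) * (norm b * M / e * c)" by (simp only: mult_ac)
    also have "e powr (1 - s) * e powr (s - 1) = 1" using e by (simp flip: powr_add)
    finally have "norm (e powr (1 - s) *\<^sub>R (H e - (e powr (s - 1) * c) *\<^sub>R 1)) \<le> norm b * M * c / e" by simp
    moreover have "e powr (1 - s) *\<^sub>R (H e - (e powr (s - 1) * c) *\<^sub>R 1) = e powr (1 - s) *\<^sub>R H e - c *\<^sub>R 1"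
      using \<open>e powr (1 - s) * e powr (s - 1) = 1\<close> by (simp add: scaleR_right_diff_distrib mult.assoc[symmetric])
    ultimately show ?thesis by simp
  qed
  have lim: "(\<lambda>n. P (real (Suc n)) (1 - s) * H (real (Suc n))) \<longlonglongrightarrow> c *\<^sub>R 1"
  proof -
    have "(\<lambda>n. real (Suc n) powr (1 - s) *\<^sub>R H (real (Suc n)) - c *\<^sub>R 1) \<longlonglongrightarrow> 0"
      by (rule Lim_null_comparison[OF _ LIMSEQ_inverse_Suc[of "norm b * M * c"]])
        (simp add: H_asymp del: of_nat_Suc)
    then have "(\<lambda>n. real (Suc n) powr (1 - s) *\<^sub>R H (real (Suc n))) \<longlonglongrightarrow> c *\<^sub>R 1" by (simp only: LIM_zero_iff)
    from tendsto_mult[OF P_asymp[of "1 - s"] this]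
    have "(\<lambda>n. (real (Suc n) powr (- (1 - s)) * real (Suc n) powr (1 - s)) *\<^sub>R (P (real (Suc n)) (1 - s) * H (real (Suc n)))) \<longlonglongrightarrow> c *\<^sub>R 1"
      by (simp add: mult.commute del: of_nat_Suc)
    moreover have "real (Suc n) powr (- (1 - s)) * real (Suc n) powr (1 - s) = 1" for n
      unfolding powr_add[symmetric] by (simp del: of_nat_Suc)
    ultimately show ?thesis by simp
  qed
  have "P (real (Suc n)) (1 - s) * H (real (Suc n)) = P e (1 - s) * H e" for n
  proof (cases "e \<le> real (Suc n)")
    case True show ?thesis by (rule const[OF e True, symmetric])
  next
    case False
    have "0 < real (Suc n)" by simp
    then show ?thesis by (rule const) (use False in linarith)
  qed
  then have "P e (1 - s) * H e = c *\<^sub>R 1" using LIMSEQ_unique[OF tendsto_const] lim by (simp only:)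
  then have "P e (s - 1) * (P e (1 - s) * H e) = c *\<^sub>R P e (s - 1)" by simp
  moreover have "P e (s - 1) * P e (1 - s) = 1" using P_add[of e "s - 1" "1 - s"] P_zero by simp
  ultimately have "H e = c *\<^sub>R P e (s - 1)" by (simp flip: mult.assoc)
  then show ?thesis using H[OF e] unfolding c_def f_def by simp
qed

text \<open>The bound 1 + M is good near 0 and norm b * M / x near infinity; combined, they make
  x^(s-1) b R x integrable at both ends.\<close>

lemma norm_b_R_le_divide:
  assumes x: "0 < x" shows "norm (b * R x) \<le> (1 + M + norm b * M) / (x + 1)"
proof -
  have "norm (b * R x) * (x + 1) = norm (b * R x) * x + norm (b * R x)" by (simp add: algebra_simps)
  also have "norm (b * R x) * x \<le> norm b * M" using norm_b_R_le[OF x] x by (simp add: field_simps)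
  also have "norm (b * R x) \<le> 1 + M" by (rule norm_b_R_le'[OF x])
  finally show ?thesis using x by (simp add: field_simps)
qed

text \<open>If \<open>b\<close> is not invertible it has no logarithm, and b^s cannot be an
  exponential; so it is approached through the invertible elements e + b.\<close>

definition Pw :: "real \<Rightarrow> 'b" where "Pw s = Lim (at_right 0) (\<lambda>e. P e s)"

text \<open>As (e + b)^s = (e + b) (e + b)^(s-1), its integrand is x^(s-1) (e + b) R (x + e), which
  differs from x^(s-1) b R x by x^(s-1) x e R x R (x + e). This is at most M^2 e x^(s-1) / (x + e),
  with an integral of order e^s; the limit and its rate follow together.\<close>

lemma integral_power_aux:
  assumes s: "0 < s" "s < 1"
  shows "has_improper_integral (\<lambda>x. x powr (s - 1) *\<^sub>R (b * R x)) ((pi / sin (s * pi)) *\<^sub>R Pw s)"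
    and "((\<lambda>e. P e s) \<longlongrightarrow> Pw s) (at_right 0)"
    and "\<And>e. 0 < e \<Longrightarrow> norm (P e s - Pw s) \<le> M\<^sup>2 * e powr s"
proof -
  define c where "c = pi / sin (s * pi)"
  have c0: "c > 0" unfolding c_def using sin_pi_pos[OF s] by simp
  have scal: "has_improper_integral (\<lambda>x. k * (x powr (s - 1) / (x + e))) (k * (e powr (s - 1) * c))" if "0 < e" for k e
    unfolding c_def
    by (rule has_improper_integral_linear[OF has_improper_integral_powr[OF s that] bounded_linear_mult_right])
  define B where "B = 1 + M + norm b * M"
  have bR: "norm (b * R x) \<le> B / (x + 1)" if "0 < x" for x
    unfolding B_def by (rule norm_b_R_le_divide[OF that])
  have cont: "continuous_on {0<..} (\<lambda>x. x powr (s - 1) *\<^sub>R (b * R x))"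
    by (intro continuous_intros) auto
  obtain W where W: "has_improper_integral (\<lambda>x. x powr (s - 1) *\<^sub>R (b * R x)) W"
  proof -
    have "norm (x powr (s - 1) *\<^sub>R (b * R x)) \<le> B * (x powr (s - 1) / (x + 1))" if "0 < x" for x
      using mult_left_mono[OF bR[OF that], of "x powr (s - 1)"] by (simp add: mult.commute)
    then show ?thesis using has_improper_integral_dominated[OF cont scal[of 1 B]] that by auto
  qed
  define V where "V = (1 / c) *\<^sub>R W"
  have WV: "W = c *\<^sub>R V" unfolding V_def using c0 by simp
  have near: "norm (P e s - V) \<le> M\<^sup>2 * e powr s" if e: "0 < e" for e
  proof -
    have "has_improper_integral (\<lambda>x. P e 1 * (x powr (s - 1) *\<^sub>R R (x + e))) (P e 1 * (c *\<^sub>R P e (s - 1)))"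
      unfolding c_def
      by (rule has_improper_integral_linear[OF integral_negative_power[OF s e] bounded_linear_mult_right])
    moreover have "P e 1 * (c *\<^sub>R P e (s - 1)) = c *\<^sub>R P e s"
      using P_add[of e 1 "s - 1"] by simp
    ultimately have "has_improper_integral (\<lambda>x. P e 1 * (x powr (s - 1) *\<^sub>R R (x + e))) (c *\<^sub>R P e s)" by (simp only:)
    from has_improper_integral_diff[OF this W]
    have "norm (c *\<^sub>R P e s - W) \<le> (M\<^sup>2 * e) * (e powr (s - 1) * c)"
    proof (rule has_improper_integral_norm_bound[OF _ scal[OF e]])
      fix x :: real assume x: "0 < x"
      have "P e 1 * R (x + e) - b * R x = x *\<^sub>R (R x - R (x + e))"
      proof -
        have "P e 1 * R (x + e) = 1 - x *\<^sub>R R (x + e)"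
          unfolding P_one[OF e] using b_R[of "x + e"] x e by (simp add: algebra_simps)
        then show ?thesis using b_R[OF x] by (simp add: algebra_simps)
      qed
      also have "\<dots> = (x * e) *\<^sub>R (R x * R (x + e))"
        using resolvent_identity[OF x, of "x + e"] x e by simp
      finally have eq: "P e 1 * (x powr (s - 1) *\<^sub>R R (x + e)) - x powr (s - 1) *\<^sub>R (b * R x)
          = (x powr (s - 1) * (x * e)) *\<^sub>R (R x * R (x + e))"
        by (simp add: scaleR_right_diff_distrib[symmetric])
      have "norm (R x * R (x + e)) \<le> (M / x) * (M / (x + e))"
        using x e M_nonneg by (intro order_trans[OF norm_mult_ineq] mult_mono norm_R) auto
      then have "(x powr (s - 1) * (x * e)) * norm (R x * R (x + e)) \<le> (x powr (s - 1) * (x * e)) * ((M / x) * (M / (x + e)))"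
        using x e by (intro mult_left_mono) auto
      also have "\<dots> = (M\<^sup>2 * e) * (x powr (s - 1) / (x + e))"
        using x by (simp add: power2_eq_square)
      finally show "norm (P e 1 * (x powr (s - 1) *\<^sub>R R (x + e)) - x powr (s - 1) *\<^sub>R (b * R x)) \<le> (M\<^sup>2 * e) * (x powr (s - 1) / (x + e))"
        unfolding eq using x e by (simp add: abs_mult)
    qed
    also have "(M\<^sup>2 * e) * (e powr (s - 1) * c) = c * (M\<^sup>2 * e powr s)" using e by (simp add: powr_diff)
    finally have "norm (c *\<^sub>R (P e s - V)) \<le> c * (M\<^sup>2 * e powr s)" unfolding WV by (simp only: scaleR_right_diff_distrib)
    then show ?thesis using c0 by simp
  qed
  have tV: "((\<lambda>e. P e s) \<longlongrightarrow> V) (at_right 0)"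
  proof -
    have "((\<lambda>e. M\<^sup>2 * e powr s) \<longlongrightarrow> 0) (at_right 0)" by (rule powr_tendsto_zero_at_right[OF s(1)])
    then have "((\<lambda>e. P e s - V) \<longlongrightarrow> 0) (at_right 0)"
      by (rule Lim_null_comparison[rotated]) (use near in \<open>auto simp: eventually_at_filter\<close>)
    then show ?thesis by (simp only: LIM_zero_iff)
  qed
  then have V: "Pw s = V" unfolding Pw_def by (intro tendsto_Lim) auto
  show "has_improper_integral (\<lambda>x. x powr (s - 1) *\<^sub>R (b * R x)) ((pi / sin (s * pi)) *\<^sub>R Pw s)"
    using W unfolding V WV c_def .
  show "((\<lambda>e. P e s) \<longlongrightarrow> Pw s) (at_right 0)" using tV unfolding V .
  show "\<And>e. 0 < e \<Longrightarrow> norm (P e s - Pw s) \<le> M\<^sup>2 * e powr s" using near unfolding V .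
qed

lemmas integral_power = integral_power_aux(1)
lemmas norm_P_minus_Pw_le = integral_power_aux(3)

section \<open>The semigroup b^s for all positive exponents\<close>

lemma P_power: "P e (real n * s) = P e s ^ n"
proof (induction n)
  case (Suc n)
  have "real (Suc n) * s = s + real n * s" by (simp add: algebra_simps)
  then show ?case using Suc P_add by simp
qed (simp add: P_zero)

lemma ex_div_nat_less_one: "\<exists>n::nat. 0 < n \<and> s / real n < 1"
proof -
  obtain n :: nat where "max s 0 < real n" using reals_Archimedean2 by blast
  then show ?thesis by (intro exI[of _ n]) auto
qed

text \<open>The integral representation is confined to s < 1; larger exponents are reached as n-th
  powers with exponent s/n.\<close>

lemma P_tendsto:
  assumes s: "0 < s" shows "((\<lambda>e. P e s) \<longlongrightarrow> Pw s) (at_right 0)"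
proof -
  obtain n :: nat where n: "0 < n" "s / real n < 1" using ex_div_nat_less_one by blast
  have "((\<lambda>e. P e (s / real n) ^ n) \<longlongrightarrow> Pw (s / real n) ^ n) (at_right 0)"
    using n s by (intro tendsto_power integral_power_aux(2)) auto
  then have l: "((\<lambda>e. P e s) \<longlongrightarrow> Pw (s / real n) ^ n) (at_right 0)"
    using P_power[of _ n "s / real n"] n by simp
  then have "Pw s = Pw (s / real n) ^ n" unfolding Pw_def by (intro tendsto_Lim) auto
  then show ?thesis using l by simp
qed

lemma Pw_eqI: "0 < s \<Longrightarrow> ((\<lambda>e. P e s) \<longlongrightarrow> V) (at_right 0) \<Longrightarrow> Pw s = V"
  using tendsto_unique[OF _ P_tendsto] by auto

lemma Pw_add: "0 < s \<Longrightarrow> 0 < t \<Longrightarrow> Pw (s + t) = Pw s * Pw t"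
  by (rule Pw_eqI) (auto simp: P_add intro!: tendsto_mult P_tendsto)

lemma Pw_power:
  assumes "0 < s" "0 < n" shows "Pw (real n * s) = Pw s ^ n"
  by (rule Pw_eqI) (use assms in \<open>auto simp: P_power intro!: tendsto_power P_tendsto\<close>)

lemma Pw_one: "Pw 1 = b"
proof (rule Pw_eqI)
  have "((\<lambda>e. e *\<^sub>R 1 + b) \<longlongrightarrow> 0 *\<^sub>R 1 + b) (at_right 0)" by (intro tendsto_intros)
  then have "((\<lambda>e. e *\<^sub>R 1 + b) \<longlongrightarrow> b) (at_right 0)" by simp
  then show "((\<lambda>e. P e 1) \<longlongrightarrow> b) (at_right 0)"
    by (rule Lim_transform_eventually) (auto simp: eventually_at_filter P_one)
qed simp

lemma Pw_of_nat: "0 < n \<Longrightarrow> Pw (real n) = b ^ n"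
  using Pw_power[of 1 n] Pw_one by simp

lemma Pw_commute_if:
  assumes "\<And>a. 0 < a \<Longrightarrow> x * R a = R a * x" "0 < s"
  shows "x * Pw s = Pw s * x"
proof -
  have l: "((\<lambda>e. x * P e s) \<longlongrightarrow> x * Pw s) (at_right 0)" "((\<lambda>e. P e s * x) \<longlongrightarrow> Pw s * x) (at_right 0)"
    by (intro tendsto_intros P_tendsto[OF assms(2)])+
  have "\<forall>\<^sub>F e in at_right 0. P e s * x = x * P e s"
    using P_commute_if[OF assms(1), of _ s] by (auto simp: eventually_at_filter)
  with l(2) have "((\<lambda>e. x * P e s) \<longlongrightarrow> Pw s * x) (at_right 0)"
    by (rule Lim_transform_eventually)
  with l(1) show ?thesis by (intro tendsto_unique[of "at_right (0::real)"]) simp_all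
qed

text \<open>Uniform down to s = 0, where b^s need not tend to 1 if \<open>b\<close> is not
  invertible. The telescoping in \<open>Pw_half_if_generator\<close> rests on it.\<close>

lemma norm_Pw_le:
  assumes "0 < s" "s < 1" shows "norm (Pw s) \<le> M\<^sup>2 + exp (norm (L 1))"
proof -
  have "norm (Pw s) \<le> norm (P 1 s - Pw s) + norm (P 1 s)"
    using norm_triangle_ineq4[of "P 1 s" "P 1 s - Pw s"] by simp
  also have "norm (P 1 s - Pw s) \<le> M\<^sup>2" using norm_P_minus_Pw_le[OF assms, of 1] by simp
  also have "norm (P 1 s) \<le> exp (norm (s *\<^sub>R L 1))" unfolding P_def by (rule norm_exp)
  also have "\<dots> \<le> exp (norm (L 1))" using assms by (simp add: mult_left_le_one_le)
  finally show ?thesis by simp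
qed

text \<open>On (a, 1) the convergence of \<open>P e\<close> to \<open>Pw\<close> is uniform, because
  e^s is at most e^a for e < 1; n-th powers carry continuity on to larger exponents.\<close>

lemma continuous_on_Pw: "continuous_on {0<..} Pw"
proof -
  have cP: "continuous_on A (\<lambda>s. P e s)" for A e
    unfolding P_def
    by (rule continuous_at_imp_continuous_on, rule ballI, rule isCont_o2[OF _ isCont_exp_algebra]) simp
  have small: "continuous_on {a<..<1} Pw" if a: "0 < a" for a
  proof (rule uniform_limit_theorem)
    show "\<forall>\<^sub>F e in at_right 0. continuous_on {a<..<1} (P e)" using cP by simp
    show "uniform_limit {a<..<1} P Pw (at_right 0)"
    proof (rule uniform_limitI)
      fix d :: real assume d: "d > 0"
      have "((\<lambda>e. M\<^sup>2 * e powr a) \<longlongrightarrow> 0) (at_right 0)" by (rule powr_tendsto_zero_at_right[OF a])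
      then have "\<forall>\<^sub>F e in at_right 0. M\<^sup>2 * e powr a < d" using d by (rule order_tendstoD)
      moreover have "\<forall>\<^sub>F e in at_right (0::real). e \<in> {0<..<1}" by (rule eventually_at_right_real) simp
      ultimately show "\<forall>\<^sub>F e in at_right 0. \<forall>s\<in>{a<..<1}. dist (P e s) (Pw s) < d"
      proof eventually_elim
        case (elim e)
        show ?case
        proof
          fix s assume s: "s \<in> {a<..<1}"
          have "e powr s \<le> e powr a" using s elim(2) by (intro powr_mono') auto
          then have "M\<^sup>2 * e powr s \<le> M\<^sup>2 * e powr a" by (intro mult_left_mono) auto
          then show "dist (P e s) (Pw s) < d"
            using norm_P_minus_Pw_le[of s e] s a elim by (auto simp: dist_norm)
        qed
      qed
    qed
  qed simp
  have "isCont Pw s" if s: "0 < s" for s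
  proof -
    obtain n :: nat where n: "0 < n" "s / real n < 1" using ex_div_nat_less_one by blast
    have c: "isCont Pw (s / real n)"
    proof -
      have "x \<in> {x / 2<..<1}" if "0 < x" "x < 1" for x :: real using that by simp
      then have "s / real n \<in> {s / real n / 2<..<1}" using s n by (simp only: divide_pos_pos of_nat_0_less_iff)
      moreover have "continuous_on {s / real n / 2<..<1} Pw" by (rule small) (use s n in simp)
      ultimately show ?thesis using continuous_on_eq_continuous_at[OF open_greaterThanLessThan] by blast
    qed
    have "isCont (\<lambda>t. Pw (t / real n) ^ n) s"
      using n by (intro isCont_power isCont_o2[where f="\<lambda>t. t / real n" and g=Pw, OF _ c]) auto
    moreover have "\<forall>\<^sub>F t in nhds s. Pw (t / real n) ^ n = Pw t"
    proof -
      have "\<forall>\<^sub>F t in nhds s. t \<in> {0<..}" by (rule eventually_nhds_in_open) (use s in auto)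
      then show ?thesis by eventually_elim (use Pw_power[of "_ / real n" n] n in simp)
    qed
    ultimately show ?thesis using isCont_cong[of "\<lambda>t. Pw (t / real n) ^ n" Pw s] by (simp only:)
  qed
  then show ?thesis by (intro continuous_at_imp_continuous_on) auto
qed

text \<open>Multiplying by b^(n-s) with an integer n > s leads to a power of \<open>b\<close>
  itself.\<close>

lemma Pw_injective:
  assumes inj: "\<And>x. b * x = 0 \<Longrightarrow> x = 0" and s: "0 < s" and z: "Pw s * x = 0"
  shows "x = 0"
proof -
  obtain n :: nat where n: "s < real n" using reals_Archimedean2 by blast
  have n0: "0 < n" using n s by (cases n) auto
  have "b ^ n * x = Pw (real n - s) * (Pw s * x)"
    using Pw_add[of "real n - s" s] n s Pw_of_nat[OF n0] by (simp add: mult.assoc)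
  then have "b ^ n * x = 0" using z by simp
  then show ?thesis
  proof (induction n)
    case (Suc n)
    then show ?case using inj[of "b ^ n * x"] by (simp add: mult.assoc)
  qed simp
qed

lemma Pw_eigen:
  assumes e: "b * u = lam *\<^sub>R u" and lam: "0 < lam" and s: "0 < s"
  shows "Pw s * u = lam powr s *\<^sub>R u"
proof -
  have R: "R x * u = (1 / (x + lam)) *\<^sub>R u" if "0 < x" for x
  proof -
    have "u = R x * ((x *\<^sub>R 1 + b) * u)" using R_left[OF that] by (simp flip: mult.assoc)
    also have "(x *\<^sub>R 1 + b) * u = (x + lam) *\<^sub>R u" using e by (simp add: algebra_simps)
    finally have "u = (x + lam) *\<^sub>R (R x * u)" by simp
    then have "(1 / (x + lam)) *\<^sub>R u = (1 / (x + lam)) *\<^sub>R ((x + lam) *\<^sub>R (R x * u))" by (rule arg_cong)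
    then show ?thesis using that lam by simp
  qed
  have lt1: "Pw s * u = lam powr s *\<^sub>R u" if s: "0 < s" "s < 1" for s
  proof -
    define c where "c = pi / sin (s * pi)"
    have c0: "c > 0" unfolding c_def using sin_pi_pos[OF s] by simp
    have "has_improper_integral (\<lambda>x. (x powr (s - 1) *\<^sub>R (b * R x)) * u) ((c *\<^sub>R Pw s) * u)"
      unfolding c_def by (rule has_improper_integral_linear[OF integral_power[OF s] bounded_linear_mult_left])
    moreover have "has_improper_integral (\<lambda>x. (x powr (s - 1) / (x + lam)) *\<^sub>R (lam *\<^sub>R u)) ((lam powr (s - 1) * c) *\<^sub>R (lam *\<^sub>R u))"
      unfolding c_def
      by (rule has_improper_integral_linear[OF has_improper_integral_powr[OF s lam] bounded_linear_scaleR_left])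
    then have "has_improper_integral (\<lambda>x. (x powr (s - 1) *\<^sub>R (b * R x)) * u) ((lam powr (s - 1) * c) *\<^sub>R (lam *\<^sub>R u))"
    proof (rule has_improper_integral_cong)
      fix x :: real assume "0 < x"
      then show "(x powr (s - 1) / (x + lam)) *\<^sub>R (lam *\<^sub>R u) = (x powr (s - 1) *\<^sub>R (b * R x)) * u"
        using R[of x] e by (simp add: mult.assoc)
    qed
    ultimately have "(c *\<^sub>R Pw s) * u = (lam powr (s - 1) * c) *\<^sub>R (lam *\<^sub>R u)"
      by (rule has_improper_integral_unique)
    also have "\<dots> = c *\<^sub>R (lam powr s *\<^sub>R u)" using lam by (simp add: powr_diff mult.commute)
    finally have "c *\<^sub>R (Pw s * u) = c *\<^sub>R (lam powr s *\<^sub>R u)" by simp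
    then show ?thesis using c0 by (simp only: scaleR_cancel_left) simp
  qed
  obtain n :: nat where n: "0 < n" "s / real n < 1" using ex_div_nat_less_one by blast
  let ?t = "s / real n"
  have "Pw ?t ^ m * u = (lam powr ?t) ^ m *\<^sub>R u" for m
  proof (induction m)
    case (Suc m)
    have "Pw ?t ^ Suc m * u = Pw ?t ^ m * (Pw ?t * u)" by (simp only: power_Suc2 mult.assoc)
    also have "\<dots> = (lam powr ?t) ^ Suc m *\<^sub>R u" using lt1[of ?t] n s Suc by simp
    finally show ?case .
  qed simp
  then have "Pw s * u = (lam powr ?t) ^ n *\<^sub>R u" using Pw_power[of ?t n] n s by simp
  also have "(lam powr ?t) ^ n = lam powr s" using lam n by (simp add: powr_powr flip: powr_realpow)
  finally show ?thesis .
qed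

text \<open>The end point 1/2 keeps all intermediate exponents below 1, as \<open>norm_Pw_le\<close>
  requires, and the eigenvalue equation can be recovered from this exponent.\<close>

lemma Pw_half_if_generator:
  assumes g: "((\<lambda>s. (1 / s) *\<^sub>R (Pw s * u - u)) \<longlongrightarrow> - (ln lam *\<^sub>R u)) (at_right 0)" and lam: "0 < lam"
  shows "lam powr (1/2) *\<^sub>R (Pw (1/2) * u) = u"
proof -
  define x where "x h = lam powr h *\<^sub>R (Pw h * u)" for h
  \<comment> \<open>The difference quotient of \<open>x\<close> splits into that of the semigroup
    and that of lam^h; their limits -ln lam u and ln lam u cancel.\<close>
  have "((\<lambda>h. lam powr h *\<^sub>R ((1 / h) *\<^sub>R (Pw h * u - u)) + ((lam powr h - 1) / h) *\<^sub>R u)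
      \<longlongrightarrow> lam powr 0 *\<^sub>R (- (ln lam *\<^sub>R u)) + ln lam *\<^sub>R u) (at_right 0)"
  proof (intro tendsto_intros g)
    have "((\<lambda>h. lam powr h) has_real_derivative ln lam) (at 0)"
      using lam by (auto intro!: derivative_eq_intros)
    then have "((\<lambda>h. (lam powr h - 1) / h) \<longlongrightarrow> ln lam) (at 0)"
      using lam by (simp add: has_field_derivative_iff)
    then show "((\<lambda>h. (lam powr h - 1) / h) \<longlongrightarrow> ln lam) (at_right 0)"
      using tendsto_within_subset by blast
  qed (use lam in auto)
  then have "((\<lambda>h. lam powr h *\<^sub>R ((1 / h) *\<^sub>R (Pw h * u - u)) + ((lam powr h - 1) / h) *\<^sub>R u) \<longlongrightarrow> 0) (at_right 0)"
    using lam by simp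
  moreover have "lam powr h *\<^sub>R ((1 / h) *\<^sub>R (Pw h * u - u)) + ((lam powr h - 1) / h) *\<^sub>R u = (1 / h) *\<^sub>R (x h - u)" for h
    unfolding x_def by (simp add: algebra_simps diff_divide_distrib)
  ultimately have x0: "((\<lambda>h. (1 / h) *\<^sub>R (x h - u)) \<longlongrightarrow> 0) (at_right 0)" by simp
  \<comment> \<open>n + 1 steps of this length lead from 0 to 1/2.\<close>
  define h where "h n = 1 / (2 * real (Suc n))" for n
  have h: "h n > 0" "real (Suc n) * h n = 1 / 2" for n unfolding h_def by (auto simp del: of_nat_Suc)
  have "filterlim h (at_right 0) sequentially"
  proof (rule tendsto_imp_filterlim_at_right)
    show "h \<longlonglongrightarrow> 0" using LIMSEQ_inverse_Suc[of "1/2"] unfolding h_def by simp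
  qed (use h in auto)
  from filterlim_compose[OF x0 this] have xn: "(\<lambda>n. (1 / h n) *\<^sub>R (x (h n) - u)) \<longlonglongrightarrow> 0" by simp
  \<comment> \<open>The maximum with 1 covers the zeroth power, which is not of the form lam^t Pw t
    with t > 0.\<close>
  define B where "B = max 1 (max 1 lam * (M\<^sup>2 + exp (norm (L 1))))"
  have pwB: "norm ((lam powr t *\<^sub>R Pw t) :: 'b) \<le> B" if t: "0 < t" "t < 1" for t
  proof -
    have "lam powr t \<le> max 1 lam"
    proof (cases "lam \<le> 1")
      case True then show ?thesis using lam t by (simp add: powr_le1)
    next
      case False then show ?thesis using powr_mono[of t 1 lam] t by simp
    qed
    then have "lam powr t * norm (Pw t) \<le> max 1 lam * (M\<^sup>2 + exp (norm (L 1)))"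
      by (intro mult_mono norm_Pw_le t) auto
    then show ?thesis unfolding B_def by simp
  qed
  have step: "norm (x (1/2) - u) \<le> B * (1/2) * norm ((1 / h n) *\<^sub>R (x (h n) - u))" for n
  proof -
    define Q where "Q = lam powr (h n) *\<^sub>R Pw (h n)"
    have Qk: "Q ^ k = lam powr (real k * h n) *\<^sub>R Pw (real k * h n)" if "0 < k" for k
    proof -
      have "(lam powr h n) ^ k = lam powr (real k * h n)"
        using lam by (simp add: powr_powr mult.commute flip: powr_realpow)
      then show ?thesis unfolding Q_def scaleR_power using Pw_power[OF h(1) that] by simp
    qed
    have Qx: "Q ^ Suc n * u = x (1/2)" using Qk[of "Suc n"] unfolding x_def h by simp
    have Qb: "norm (Q ^ k) \<le> B" if "k < Suc n" for k
    proof (cases "k = 0")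
      case True then show ?thesis unfolding B_def by simp
    next
      case False
      have "real k * h n < real (Suc n) * h n" using that h(1)[of n] by (intro mult_strict_right_mono) auto
      then have "real k * h n < 1" unfolding h(2) by simp
      then show ?thesis using Qk[of k] pwB[of "real k * h n"] False h(1)[of n] by simp
    qed
    have tele: "Q ^ m * u - u = (\<Sum>k<m. Q ^ k * (Q * u - u))" for m
    proof (induction m)
      case (Suc m)
      have "Q ^ Suc m * u - u = Q ^ m * (Q * u - u) + (Q ^ m * u - u)"
        by (simp add: right_diff_distrib mult.assoc power_commutes[symmetric] del: power_Suc add: power_Suc2)
      then show ?case using Suc by simp
    qed simp
    have "norm (x (1/2) - u) \<le> (\<Sum>k<Suc n. norm (Q ^ k * (Q * u - u)))"
      unfolding Qx[symmetric] tele by (rule norm_sum)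
    also have "\<dots> \<le> (\<Sum>k<Suc n. B * norm (Q * u - u))"
      by (intro sum_mono order_trans[OF norm_mult_ineq] mult_right_mono Qb) auto
    also have "\<dots> = real (Suc n) * (B * norm (Q * u - u))" by simp
    also have "Q * u - u = x (h n) - u" unfolding Q_def x_def by simp
    also have "real (Suc n) = 1 / 2 * (1 / h n)" unfolding h_def by simp
    finally show ?thesis using h(1)[of n] by (simp add: mult_ac)
  qed
  have "(\<lambda>n. B * (1/2) * norm ((1 / h n) *\<^sub>R (x (h n) - u))) \<longlonglongrightarrow> B * (1/2) * norm (0::'b)"
    by (intro tendsto_intros xn)
  then have "norm (x (1/2) - u) \<le> B * (1/2) * norm (0::'b)"
    by (rule LIMSEQ_le_const) (use step in auto)
  then show ?thesis unfolding x_def by simp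
qed

end

section \<open>Powers of \<open>(A + eI)\<^sup>-\<^sup>1\<close> and \<open>A (A + I)\<^sup>-\<^sup>1\<close>\<close>

text \<open>With \<open>R t\<close> in the role of \<open>(A + tI)\<^sup>-\<^sup>1\<close>, possibly for an unbounded \<open>A\<close>, \<open>RS e\<close> and \<open>RT\<close> are the
  resolvents of the bounded elements \<open>R e\<close> and \<open>1 - R 1\<close>, whose powers are \<open>PS e s\<close> and \<open>PT s\<close>, and
  \<open>E r t s\<close> is \<open>((A + tI) (A + rI)\<^sup>-\<^sup>1)\<^sup>s\<close>.\<close>

context resolvent_family
begin

definition RS :: "real \<Rightarrow> real \<Rightarrow> 'b" where
  "RS e \<delta> = (1 / \<delta>) *\<^sub>R (1 - (1 / \<delta>) *\<^sub>R R (e + 1 / \<delta>))"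

definition RT :: "real \<Rightarrow> 'b" where
  "RT \<delta> = (1 / (1 + \<delta>)) *\<^sub>R (1 + (1 / (1 + \<delta>)) *\<^sub>R R (\<delta> / (1 + \<delta>)))"

text \<open>\<open>RS\<close> comes from \<delta> + (A + e)^-1 = \<delta> (A + e + 1/\<delta>) (A +
  e)^-1, whose inverse is (1/\<delta>) (A + e) (A + e + 1/\<delta>)^-1.\<close>

lemma bounded_nonneg_R:
  assumes e: "0 < e" shows "bounded_nonneg (R e) (RS e) (1 + M)"
proof
  fix \<delta> :: real assume d: "0 < \<delta>"
  have ed: "0 < e + 1 / \<delta>" using e d by (simp add: add_pos_pos)
  have id: "R e - R (e + 1 / \<delta>) = (1 / \<delta>) *\<^sub>R (R e * R (e + 1 / \<delta>))"
    using resolvent_identity[OF e ed] by simp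
  have "(\<delta> *\<^sub>R 1 + R e) * (1 - (1 / \<delta>) *\<^sub>R R (e + 1 / \<delta>)) =
      \<delta> *\<^sub>R 1 + (R e - R (e + 1 / \<delta>) - (1 / \<delta>) *\<^sub>R (R e * R (e + 1 / \<delta>)))"
    using d by (simp add: algebra_simps)
  then have 1: "(\<delta> *\<^sub>R 1 + R e) * (1 - (1 / \<delta>) *\<^sub>R R (e + 1 / \<delta>)) = \<delta> *\<^sub>R 1" unfolding id by simp
  then show r: "(\<delta> *\<^sub>R 1 + R e) * RS e \<delta> = 1"
    unfolding RS_def using d by (simp add: mult_scaleR_right)
  have "RS e \<delta> * (\<delta> *\<^sub>R 1 + R e) = (\<delta> *\<^sub>R 1 + R e) * RS e \<delta>"
    unfolding RS_def using R_commute[OF e ed] by (simp add: algebra_simps)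
  then show "RS e \<delta> * (\<delta> *\<^sub>R 1 + R e) = 1" using r by simp
  have "norm ((1 / \<delta>) *\<^sub>R R (e + 1 / \<delta>)) \<le> 1 / \<delta> * (M / (e + 1 / \<delta>))"
    using d mult_left_mono[OF norm_R_le[OF ed], of "1 / \<delta>"] by simp
  also have "\<dots> \<le> 1 / \<delta> * (M / (1 / \<delta>))"
    using d e ed M_nonneg by (intro mult_left_mono divide_left_mono) auto
  also have "\<dots> = M" using d by simp
  finally have "norm (1 - (1 / \<delta>) *\<^sub>R R (e + 1 / \<delta>)) \<le> 1 + M"
    using norm_triangle_ineq4[of 1 "(1 / \<delta>) *\<^sub>R R (e + 1 / \<delta>)"] by simp
  then show "norm (RS e \<delta>) \<le> (1 + M) / \<delta>" unfolding RS_def using d by (simp add: divide_right_mono)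
qed

text \<open>\<open>RT\<close> comes from \<delta> + A (A + 1)^-1 = (1 + \<delta>) (A + q) (A + 1)^-1
  with q = \<delta> / (1 + \<delta>).\<close>

lemma bounded_nonneg_one_minus_R: "bounded_nonneg (1 - R 1) RT (1 + M)"
proof
  fix \<delta> :: real assume d: "0 < \<delta>"
  define k where "k = 1 / (1 + \<delta>)"
  define q where "q = \<delta> / (1 + \<delta>)"
  have q: "0 < q" "0 < k" "k \<le> 1" "q - 1 = - k" "k * (1 + \<delta>) = 1" "q = k * \<delta>"
    unfolding q_def k_def using d by (auto simp: field_simps)
  have RT: "RT \<delta> = k *\<^sub>R (1 + k *\<^sub>R R q)" unfolding RT_def k_def q_def ..
  have id: "R q - R 1 = k *\<^sub>R (R q * R 1)"
    using resolvent_identity[OF q(1), of 1] q(4) by (metis minus_diff_eq minus_minus zero_less_one)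
  have "(\<delta> *\<^sub>R 1 + (1 - R 1)) * RT \<delta> = (k *\<^sub>R ((1 + \<delta>) *\<^sub>R 1 - R 1)) * (1 + k *\<^sub>R R q)"
    unfolding RT by (simp add: algebra_simps)
  also have "k *\<^sub>R ((1 + \<delta>) *\<^sub>R 1 - R 1) = 1 - k *\<^sub>R R 1"
    using q(5) by (simp add: scaleR_right_diff_distrib)
  also have "(1 - k *\<^sub>R R 1) * (1 + k *\<^sub>R R q) = 1 + k *\<^sub>R (R q - R 1) - k *\<^sub>R (k *\<^sub>R (R 1 * R q))"
    by (simp add: algebra_simps)
  also have "\<dots> = 1" unfolding id using R_commute[OF q(1), of 1] by simp
  finally show r: "(\<delta> *\<^sub>R 1 + (1 - R 1)) * RT \<delta> = 1" .
  have "RT \<delta> * (\<delta> *\<^sub>R 1 + (1 - R 1)) = (\<delta> *\<^sub>R 1 + (1 - R 1)) * RT \<delta>"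
    unfolding RT using R_commute[OF q(1), of 1] by (simp add: algebra_simps)
  then show "RT \<delta> * (\<delta> *\<^sub>R 1 + (1 - R 1)) = 1" using r by simp
  have "norm (k *\<^sub>R R q) \<le> k * (M / q)" using q norm_R_le[OF q(1)] by (simp add: mult_left_mono del: times_divide_eq_right)
  also have "\<dots> = M / \<delta>" using q d by simp
  finally have "norm (1 + k *\<^sub>R R q) \<le> 1 + M / \<delta>" using norm_triangle_ineq[of 1 "k *\<^sub>R R q"] by simp
  then have "k * norm (1 + k *\<^sub>R R q) \<le> k * (1 + M / \<delta>)" using q by (intro mult_left_mono) auto
  also have "\<dots> = k * ((\<delta> + M) / \<delta>)" using d by (simp add: field_simps)
  also have "\<dots> \<le> (1 + M) / \<delta>"
  proof -
    have "k * (\<delta> + M) \<le> 1 + M"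
      using q d M_nonneg mult_right_mono[of k 1 M] by (simp add: algebra_simps)
    then show ?thesis using d by (simp add: divide_right_mono)
  qed
  finally show "norm (RT \<delta>) \<le> (1 + M) / \<delta>" unfolding RT using q by simp
qed

definition E :: "real \<Rightarrow> real \<Rightarrow> real \<Rightarrow> 'b" where
  "E r t s = exp (s *\<^sub>R (G t - G r))"

lemma E_trans:
  assumes "0 < r" "0 < t" "0 < w" shows "E r t s * E t w s = E r w s"
proof -
  have "s *\<^sub>R (G t - G r) * s *\<^sub>R (G w - G t) = s *\<^sub>R (G w - G t) * s *\<^sub>R (G t - G r)"
    using G_commute assms by (simp add: algebra_simps)
  from exp_add_commuting[OF this] show ?thesis unfolding E_def by (simp flip: scaleR_add_right)
qed

abbreviation PS :: "real \<Rightarrow> real \<Rightarrow> 'b" where "PS e \<equiv> bounded_nonneg.Pw (RS e)"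
abbreviation PT :: "real \<Rightarrow> 'b" where "PT \<equiv> bounded_nonneg.Pw RT"

section \<open>The powers of (A + e)^-1 and A (A + 1)^-1 as limits of E\<close>

lemma exp_scaleR_one_add: "exp (s *\<^sub>R (ln c *\<^sub>R 1 + x)) = c powr s *\<^sub>R exp (s *\<^sub>R x)" if "0 < c" for x :: 'b
proof -
  have "s *\<^sub>R (ln c *\<^sub>R 1 + x) = of_real (s * ln c) + s *\<^sub>R x" by (simp add: of_real_def scaleR_add_right)
  also have "exp \<dots> = exp (of_real (s * ln c)) * exp (s *\<^sub>R x)"
    by (rule exp_add_commuting) (simp add: of_real_def)
  also have "exp (of_real (s * ln c)) = (of_real (c powr s) :: 'b)"
    unfolding exp_of_real using that by (simp add: powr_def)
  finally show ?thesis by (simp add: of_real_def)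
qed

text \<open>The factorization behind \<open>RS\<close> suggests the logarithm ln \<delta> + G (e +
  1/\<delta>) - G e. Its derivative in \<delta> is indeed \<open>RS e \<delta>\<close>, and the two
  values of \<open>G\<close> cancel as \<delta> grows, so uniqueness of the logarithm
  applies.\<close>

lemma P_RS:
  assumes e: "0 < e" and d: "0 < \<delta>"
  shows "bounded_nonneg.P (RS e) \<delta> s = \<delta> powr s *\<^sub>R E e (e + 1 / \<delta>) s"
proof -
  interpret SB: bounded_nonneg "R e" "RS e" "1 + M" by (rule bounded_nonneg_R[OF e])
  have "ln \<delta> *\<^sub>R 1 + (G (e + 1 / \<delta>) - G e) = SB.L \<delta>"
  proof (rule SB.L_unique[OF _ _ d])
    fix x :: real assume x: "0 < x"
    have ex: "0 < e + 1 / x" using e x by (simp add: add_pos_pos)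
    have "((\<lambda>x. e + 1 / x) has_real_derivative - (1 / x\<^sup>2)) (at x)"
      using x by (auto intro!: derivative_eq_intros simp: power2_eq_square)
    then have "((G \<circ> (\<lambda>x. e + 1 / x)) has_vector_derivative (- (1 / x\<^sup>2)) *\<^sub>R R (e + 1 / x)) (at x)"
      by (intro vector_diff_chain_at G_has_vector_derivative[OF ex]) (simp add: has_real_derivative_iff_has_vector_derivative)
    moreover have "((\<lambda>x. ln x *\<^sub>R (1::'b)) has_vector_derivative (1 / x) *\<^sub>R 1) (at x)"
      using x by (auto intro!: derivative_eq_intros simp: has_real_derivative_iff_has_vector_derivative[symmetric] divide_inverse)
    ultimately have "((\<lambda>x. ln x *\<^sub>R (1::'b) + ((G \<circ> (\<lambda>x. e + 1 / x)) x - G e)) has_vector_derivative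
        (1 / x) *\<^sub>R 1 + ((- (1 / x\<^sup>2)) *\<^sub>R R (e + 1 / x) - 0)) (at x)"
      by (intro has_vector_derivative_add has_vector_derivative_diff has_vector_derivative_const)
    moreover have "(1 / x) *\<^sub>R 1 + ((- (1 / x\<^sup>2)) *\<^sub>R R (e + 1 / x) - 0) = RS e x"
      unfolding RS_def by (simp add: scaleR_right_diff_distrib power2_eq_square)
    ultimately show "((\<lambda>x. ln x *\<^sub>R 1 + (G (e + 1 / x) - G e)) has_vector_derivative RS e x) (at x)"
      by (simp add: o_def)
  next
    have "(\<lambda>n. e + 1 / real (Suc n)) \<longlonglongrightarrow> e + 0" by (intro tendsto_intros LIMSEQ_inverse_Suc)
    then have "(\<lambda>n. G (e + 1 / real (Suc n))) \<longlonglongrightarrow> G e"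
      using isCont_tendsto_compose[OF isCont_G[OF e]] by simp
    then have "(\<lambda>n. G (e + 1 / real (Suc n)) - G e) \<longlonglongrightarrow> 0" by (simp only: LIM_zero_iff)
    then show "(\<lambda>n. ln (real (Suc n)) *\<^sub>R 1 + (G (e + 1 / real (Suc n)) - G e) - ln (real (Suc n)) *\<^sub>R 1) \<longlonglongrightarrow> 0"
      by (simp only: add_diff_cancel_left')
  qed
  then have "SB.P \<delta> s = exp (s *\<^sub>R (ln \<delta> *\<^sub>R 1 + (G (e + 1 / \<delta>) - G e)))" unfolding SB.P_def by simp
  then show ?thesis unfolding exp_scaleR_one_add[OF d] E_def .
qed

text \<open>The logarithm suggested by the factorization behind \<open>RT\<close> is ln (1 +
  \<delta>) + G q - G 1 with q = \<delta> / (1 + \<delta>); as \<delta> grows, q tends to 1 and ln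
  (1 + \<delta>) - ln \<delta> to 0.\<close>

lemma P_RT:
  assumes d: "0 < \<delta>"
  shows "bounded_nonneg.P RT \<delta> s = (1 + \<delta>) powr s *\<^sub>R E 1 (\<delta> / (1 + \<delta>)) s"
proof -
  interpret TB: bounded_nonneg "1 - R 1" RT "1 + M" by (rule bounded_nonneg_one_minus_R)
  have "ln (1 + \<delta>) *\<^sub>R 1 + (G (\<delta> / (1 + \<delta>)) - G 1) = TB.L \<delta>"
  proof (rule TB.L_unique[OF _ _ d])
    fix x :: real assume x: "0 < x"
    have ex: "0 < x / (1 + x)" using x by simp
    have "((\<lambda>x. x / (1 + x)) has_real_derivative 1 / (1 + x)\<^sup>2) (at x)"
      using x by (auto intro!: derivative_eq_intros simp: power2_eq_square)
    then have "((G \<circ> (\<lambda>x. x / (1 + x))) has_vector_derivative (1 / (1 + x)\<^sup>2) *\<^sub>R R (x / (1 + x))) (at x)"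
      by (intro vector_diff_chain_at G_has_vector_derivative[OF ex]) (simp add: has_real_derivative_iff_has_vector_derivative)
    moreover have "((\<lambda>x. ln (1 + x) *\<^sub>R (1::'b)) has_vector_derivative (1 / (1 + x)) *\<^sub>R 1) (at x)"
      using x by (auto intro!: derivative_eq_intros simp: has_real_derivative_iff_has_vector_derivative[symmetric] divide_inverse)
    ultimately have "((\<lambda>x. ln (1 + x) *\<^sub>R (1::'b) + ((G \<circ> (\<lambda>x. x / (1 + x))) x - G 1)) has_vector_derivative
        (1 / (1 + x)) *\<^sub>R 1 + ((1 / (1 + x)\<^sup>2) *\<^sub>R R (x / (1 + x)) - 0)) (at x)"
      by (intro has_vector_derivative_add has_vector_derivative_diff has_vector_derivative_const)
    moreover have "(1 / (1 + x)) *\<^sub>R 1 + ((1 / (1 + x)\<^sup>2) *\<^sub>R R (x / (1 + x)) - 0) = RT x"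
      unfolding RT_def by (simp add: scaleR_add_right power2_eq_square)
    ultimately show "((\<lambda>x. ln (1 + x) *\<^sub>R 1 + (G (x / (1 + x)) - G 1)) has_vector_derivative RT x) (at x)"
      by (simp add: o_def)
  next
    have i: "(\<lambda>n. inverse (real (Suc n))) \<longlonglongrightarrow> 0" by (rule LIMSEQ_inverse_real_of_nat)
    have "(\<lambda>n. 1 / (inverse (real (Suc n)) + 1)) \<longlonglongrightarrow> 1 / (0 + 1)" by (intro tendsto_intros i) simp
    moreover have "1 / (inverse (real (Suc n)) + 1) = real (Suc n) / (1 + real (Suc n))" for n
      by (simp add: field_simps)
    ultimately have "(\<lambda>n. real (Suc n) / (1 + real (Suc n))) \<longlonglongrightarrow> 1" by simp
    from isCont_tendsto_compose[OF isCont_G[OF zero_less_one] this]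
    have G: "(\<lambda>n. G (real (Suc n) / (1 + real (Suc n))) - G 1) \<longlonglongrightarrow> 0" by (simp only: LIM_zero_iff)
    have "(\<lambda>n. ln (1 + inverse (real (Suc n)))) \<longlonglongrightarrow> ln (1 + 0)" by (intro tendsto_intros i) simp
    moreover have "ln (1 + inverse (real (Suc n))) = ln (1 + real (Suc n)) - ln (real (Suc n))" for n
    proof -
      have "1 + inverse (real (Suc n)) = (1 + real (Suc n)) / real (Suc n)" by (simp add: field_simps)
      then show ?thesis by (simp add: ln_div del: of_nat_Suc)
    qed
    ultimately have "(\<lambda>n. (ln (1 + real (Suc n)) - ln (real (Suc n))) *\<^sub>R (1::'b)) \<longlonglongrightarrow> 0 *\<^sub>R 1"
      by (intro tendsto_intros) simp
    from tendsto_add[OF this G]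
    show "(\<lambda>n. ln (1 + real (Suc n)) *\<^sub>R 1 + (G (real (Suc n) / (1 + real (Suc n))) - G 1) - ln (real (Suc n)) *\<^sub>R 1) \<longlonglongrightarrow> 0"
      by (simp add: scaleR_left_diff_distrib algebra_simps del: of_nat_Suc)
  qed
  then have "TB.P \<delta> s = exp (s *\<^sub>R (ln (1 + \<delta>) *\<^sub>R 1 + (G (\<delta> / (1 + \<delta>)) - G 1)))" unfolding TB.P_def by simp
  also have "\<dots> = (1 + \<delta>) powr s *\<^sub>R E 1 (\<delta> / (1 + \<delta>)) s"
    unfolding E_def by (rule exp_scaleR_one_add) (use d in simp)
  finally show ?thesis .
qed

text \<open>The parameter \<delta> = 1 / (t - e) turns e + 1/\<delta> in \<open>P_RS\<close> into
  \<open>t\<close>, and \<delta> tends to 0 as \<open>t\<close> grows.\<close>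

lemma E_tendsto_PS:
  assumes e: "0 < e" and s: "0 < s"
  shows "((\<lambda>t. t powr (- s) *\<^sub>R E e t s) \<longlongrightarrow> PS e s) at_top"
proof -
  interpret SB: bounded_nonneg "R e" "RS e" "1 + M" by (rule bounded_nonneg_R[OF e])
  have f: "filterlim (\<lambda>t. 1 / (t - e)) (at_right 0) at_top"
  proof (rule tendsto_imp_filterlim_at_right)
    show "((\<lambda>t. 1 / (t - e)) \<longlongrightarrow> 0) at_top" by real_asymp
    show "\<forall>\<^sub>F t in at_top. 0 < 1 / (t - e)" using eventually_gt_at_top[of e] by eventually_elim simp
  qed
  have r: "((\<lambda>t. ((t - e) / t) powr s) \<longlongrightarrow> 1 powr s) at_top"
    by (intro tendsto_intros) (real_asymp, simp)
  have "((\<lambda>t. ((t - e) / t) powr s *\<^sub>R SB.P (1 / (t - e)) s) \<longlongrightarrow> 1 powr s *\<^sub>R PS e s) at_top"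
    by (rule tendsto_scaleR[OF r filterlim_compose[OF SB.P_tendsto[OF s] f]])
  then have "((\<lambda>t. ((t - e) / t) powr s *\<^sub>R SB.P (1 / (t - e)) s) \<longlongrightarrow> PS e s) at_top" by simp
  moreover have "\<forall>\<^sub>F t in at_top. ((t - e) / t) powr s *\<^sub>R SB.P (1 / (t - e)) s = t powr (- s) *\<^sub>R E e t s"
    using eventually_gt_at_top[of e]
  proof eventually_elim
    case (elim t)
    then show ?case using e P_RS[OF e, of "1 / (t - e)" s]
      by (simp add: powr_divide powr_minus_divide)
  qed
  ultimately show ?thesis by (rule Lim_transform_eventually)
qed

text \<open>The parameter \<delta> = q / (1 - q) turns \<delta> / (1 + \<delta>) in
  \<open>P_RT\<close> into \<open>q\<close>.\<close>

lemma E_tendsto_PT: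
  assumes s: "0 < s"
  shows "((\<lambda>q. E 1 q s) \<longlongrightarrow> PT s) (at_right 0)"
proof -
  interpret TB: bounded_nonneg "1 - R 1" RT "1 + M" by (rule bounded_nonneg_one_minus_R)
  have l: "((\<lambda>q::real. q / (1 - q)) \<longlongrightarrow> 0 / (1 - 0)) (at_right 0)" by (intro tendsto_intros) simp
  have ev: "\<forall>\<^sub>F q in at_right (0::real). q \<in> {0<..<1}" by (rule eventually_at_right_real) simp
  have f: "filterlim (\<lambda>q. q / (1 - q)) (at_right 0) (at_right (0::real))"
  proof (rule tendsto_imp_filterlim_at_right)
    show "((\<lambda>q. q / (1 - q)) \<longlongrightarrow> 0) (at_right (0::real))" using l by simp
    show "\<forall>\<^sub>F q in at_right 0. 0 < q / (1 - q :: real)" using ev by eventually_elim simp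
  qed
  have "((\<lambda>q. (1 - q) powr s) \<longlongrightarrow> (1 - 0) powr s) (at_right 0)"
    by (intro tendsto_intros) simp
  from tendsto_scaleR[OF this filterlim_compose[OF TB.P_tendsto[OF s] f]]
  have "((\<lambda>q. (1 - q) powr s *\<^sub>R TB.P (q / (1 - q)) s) \<longlongrightarrow> PT s) (at_right 0)" by simp
  moreover have "\<forall>\<^sub>F q in at_right 0. (1 - q) powr s *\<^sub>R TB.P (q / (1 - q)) s = E 1 q s"
    using ev
  proof eventually_elim
    case (elim q)
    then have "1 + q / (1 - q) = 1 / (1 - q)" "q / (1 - q) / (1 / (1 - q)) = q" by (auto simp: field_simps)
    then show ?case using elim P_RT[of "q / (1 - q)" s] by (simp add: powr_divide)
  qed
  ultimately show ?thesis by (rule Lim_transform_eventually)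
qed

lemma PS_commute_if:
  assumes "\<And>a. 0 < a \<Longrightarrow> x * R a = R a * x" "0 < e" "0 < s"
  shows "x * PS e s = PS e s * x"
proof -
  interpret SB: bounded_nonneg "R e" "RS e" "1 + M" by (rule bounded_nonneg_R[OF assms(2)])
  show ?thesis
    by (rule SB.Pw_commute_if) (use assms in \<open>auto simp: RS_def algebra_simps add_pos_pos\<close>)
qed

lemma PT_commute_if:
  assumes "\<And>a. 0 < a \<Longrightarrow> x * R a = R a * x" "0 < s"
  shows "x * PT s = PT s * x"
proof -
  interpret TB: bounded_nonneg "1 - R 1" RT "1 + M" by (rule bounded_nonneg_one_minus_R)
  show ?thesis
    by (rule TB.Pw_commute_if) (use assms in \<open>auto simp: RT_def algebra_simps add_pos_pos\<close>)
qed

lemma PS_R_commute: "0 < a \<Longrightarrow> 0 < e \<Longrightarrow> 0 < s \<Longrightarrow> PS e s * R a = R a * PS e s"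
  by (rule PS_commute_if[symmetric]) (auto intro: R_commute)

lemma PS_PT_commute: "0 < e \<Longrightarrow> 0 < s \<Longrightarrow> 0 < t \<Longrightarrow> PS e s * PT t = PT t * PS e s"
  by (rule PT_commute_if) (auto intro: PS_R_commute)

text \<open>Reduces case (c) to bounded operators: u = (A + e)^-s v becomes E 1 e s u = (A + 1)^-s
  v, an equation in which e can tend to 0.\<close>

lemma E_PS:
  assumes e: "0 < e" and s: "0 < s" shows "E 1 e s * PS e s = PS 1 s"
proof -
  have "((\<lambda>t. E 1 e s * (t powr (- s) *\<^sub>R E e t s)) \<longlongrightarrow> E 1 e s * PS e s) at_top"
    by (intro tendsto_intros E_tendsto_PS e s)
  moreover have "\<forall>\<^sub>F t in at_top. E 1 e s * (t powr (- s) *\<^sub>R E e t s) = t powr (- s) *\<^sub>R E 1 t s"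
    using eventually_gt_at_top[of 0] by eventually_elim (simp add: E_trans e)
  ultimately have "((\<lambda>t. t powr (- s) *\<^sub>R E 1 t s) \<longlongrightarrow> E 1 e s * PS e s) at_top"
    by (rule Lim_transform_eventually)
  then show ?thesis using tendsto_unique[OF trivial_limit_at_top_linorder _ E_tendsto_PS[OF zero_less_one s]] by simp
qed

end

text \<open>With (q + b)^s in place of b^s all factors are limits of exponentials, and G t - G 1 + L
  q = L t + (G q - G 1) exchanges the two variables. Since t^-s (t + b)^s tends to 1, only E 1 q s
  is left, and then q tends to 0.\<close>

lemma (in bounded_nonneg) PS_Pw:
  assumes s: "0 < s" shows "PS 1 s * Pw s = PT s"
proof -
  have PSP: "PS 1 s * P q s = E 1 q s" if q: "0 < q" for q
  proof -
    have f: "filterlim (\<lambda>n. real (Suc n)) at_top sequentially"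
      by (rule filterlim_compose[OF filterlim_real_sequentially filterlim_Suc])
    have "(\<lambda>n. (real (Suc n) powr (- s) *\<^sub>R E 1 (real (Suc n)) s) * P q s) \<longlonglongrightarrow> PS 1 s * P q s"
      by (intro tendsto_mult tendsto_const filterlim_compose[OF E_tendsto_PS[OF zero_less_one s] f])
    moreover have "(real (Suc n) powr (- s) *\<^sub>R E 1 (real (Suc n)) s) * P q s =
        (real (Suc n) powr (- s) *\<^sub>R P (real (Suc n)) s) * E 1 q s" for n
    proof -
      let ?t = "real (Suc n)"
      have t: "0 < ?t" by simp
      have "E 1 ?t s * P q s = exp (s *\<^sub>R (G ?t - G 1) + s *\<^sub>R L q)"
        unfolding E_def P_def
        by (rule exp_add_commuting[symmetric])
          (simp add: algebra_simps L_commute_if[OF R_G_commute[symmetric], OF _ t q] L_commute_if[OF R_G_commute[symmetric], OF _ zero_less_one q] del: of_nat_Suc)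
      also have "s *\<^sub>R (G ?t - G 1) + s *\<^sub>R L q = s *\<^sub>R L ?t + s *\<^sub>R (G q - G 1)"
        unfolding L_def by (simp add: algebra_simps del: of_nat_Suc)
      also have "exp \<dots> = P ?t s * E 1 q s"
        unfolding E_def P_def
        by (rule exp_add_commuting)
          (simp add: algebra_simps L_commute_if[OF R_G_commute[symmetric], OF _ q t] L_commute_if[OF R_G_commute[symmetric], OF _ zero_less_one t] del: of_nat_Suc)
      finally show ?thesis by simp
    qed
    moreover have "(\<lambda>n. (real (Suc n) powr (- s) *\<^sub>R P (real (Suc n)) s) * E 1 q s) \<longlonglongrightarrow> 1 * E 1 q s"
      by (intro tendsto_mult tendsto_const P_asymp)
    ultimately show ?thesis using LIMSEQ_unique by simp
  qed
  have "((\<lambda>q. PS 1 s * P q s) \<longlongrightarrow> PS 1 s * Pw s) (at_right 0)"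
    by (intro tendsto_intros P_tendsto s)
  moreover have "\<forall>\<^sub>F q in at_right 0. PS 1 s * P q s = E 1 q s"
    using PSP by (auto simp: eventually_at_filter)
  ultimately have "((\<lambda>q. E 1 q s) \<longlongrightarrow> PS 1 s * Pw s) (at_right 0)" by (rule Lim_transform_eventually)
  then show ?thesis using tendsto_unique[OF _ _ E_tendsto_PT[OF s]] by auto
qed

section \<open>Eigenvectors of fractional powers\<close>

text \<open>Here \<open>F\<close> is controlled on [0, s + 1] only, where both exponents of the
  later application are positive. The shift by \<open>r\<close> is compensated by moving the piece
  over [0, r] to [s, s + r].\<close>

lemma integral_periodic_shift:
  fixes F :: "real \<Rightarrow> 'a::banach" and h :: "real \<Rightarrow> real"
  assumes F: "continuous_on {0..s + 1} F" and h: "continuous_on UNIV h"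
    and Fp: "\<And>t. t \<in> {0..1} \<Longrightarrow> F (t + s) = F t" and hp: "\<And>t. h (t + s) = h t"
    and s: "0 < s" and r: "0 \<le> r" "r \<le> 1"
  shows "integral {0..s} (\<lambda>t. h t *\<^sub>R F (t + r)) = integral {0..s} (\<lambda>t. h (t - r) *\<^sub>R F t)"
proof -
  define g where "g t = h (t - r) *\<^sub>R F t" for t
  have gc: "continuous_on {0..s + 1} g"
    unfolding g_def by (intro continuous_intros F continuous_on_compose2[OF h]) auto
  have gi: "g integrable_on {a..b}" if "0 \<le> a" "b \<le> s + 1" for a b
    by (rule integrable_continuous_interval, rule continuous_on_subset[OF gc]) (use that in auto)
  have shift: "integral {a..b} (\<lambda>t. f (t + c)) = integral {a + c..b + c} f"
    if "continuous_on {a + c..b + c} f" "a \<le> b" for a b c :: real and f :: "real \<Rightarrow> 'a"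
  proof -
    have "((\<lambda>x. f (1 *\<^sub>R x + c)) has_integral (1 / \<bar>1\<bar> ^ DIM(real)) *\<^sub>R integral (cbox (a + c) (b + c)) f)
        ((\<lambda>x. (1 / 1) *\<^sub>R x + - ((1 / 1) *\<^sub>R c)) ` cbox (a + c) (b + c))"
      by (rule has_integral_affinity) (use that integrable_integral[OF integrable_continuous_interval[OF that(1)]] in auto)
    moreover have "(\<lambda>x. (1 / 1) *\<^sub>R x + - ((1 / 1) *\<^sub>R c)) ` cbox (a + c) (b + c) = {a..b}"
      by (auto simp: image_iff intro!: bexI[of _ "_ + c"])
    ultimately show ?thesis by (simp add: integral_unique)
  qed
  have gp: "g (t + s) = g t" if "t \<in> {0..1}" for t
    unfolding g_def using Fp[OF that] hp[of "t - r"] by (simp add: algebra_simps)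
  have "integral {0..s} (\<lambda>t. h t *\<^sub>R F (t + r)) = integral {0..s} (\<lambda>t. g (t + r))"
    unfolding g_def by simp
  also have "\<dots> = integral {0 + r..s + r} g"
    by (rule shift) (use r s in \<open>auto intro: continuous_on_subset[OF gc]\<close>)
  finally have 1: "integral {0..s} (\<lambda>t. h t *\<^sub>R F (t + r)) = integral {r..s + r} g" by simp
  have "integral {0..r} (\<lambda>t. g (t + s)) = integral {0 + s..r + s} g"
    by (rule shift) (use r s in \<open>auto intro: continuous_on_subset[OF gc]\<close>)
  moreover have "integral {0..r} (\<lambda>t. g (t + s)) = integral {0..r} g"
    by (rule integral_cong) (use gp r in auto)
  ultimately have 2: "integral {0..r} g = integral {s..s + r} g" by (simp add: add.commute)
  have "integral {0..s} g + integral {s..s + r} g = integral {0..s + r} g"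
    using r s by (intro Henstock_Kurzweil_Integration.integral_combine gi) auto
  moreover have "integral {0..r} g + integral {r..s + r} g = integral {0..s + r} g"
    using r s by (intro Henstock_Kurzweil_Integration.integral_combine gi) auto
  ultimately have "integral {0..s} g = integral {r..s + r} g"
    using 2 by (metis add.commute add_right_cancel)
  then show ?thesis unfolding 1 unfolding g_def by simp
qed

text \<open>Pairs \<open>(x, y)\<close> stand for the elements \<open>x + iy\<close> of the complexification.\<close>

definition cmult :: "complex \<Rightarrow> 'b \<times> 'b \<Rightarrow> 'b \<times> 'b::real_vector" where
  "cmult z p = (Re z *\<^sub>R fst p - Im z *\<^sub>R snd p, Re z *\<^sub>R snd p + Im z *\<^sub>R fst p)"

definition lmult :: "'b \<Rightarrow> 'b \<times> 'b \<Rightarrow> 'b \<times> 'b::real_algebra" where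
  "lmult a p = (a * fst p, a * snd p)"

lemma cmult_mult: "cmult (z * w) p = cmult z (cmult w p)"
  unfolding cmult_def by (simp add: algebra_simps)

lemma cmult_add: "cmult (z + w) p = cmult z p + cmult w p"
  unfolding cmult_def by (simp add: algebra_simps)

lemma cmult_diff: "cmult (z - w) p = cmult z p - cmult w p"
  unfolding cmult_def by (simp add: algebra_simps)

lemma cmult_of_real: "cmult (of_real r) p = r *\<^sub>R p"
  unfolding cmult_def by (simp add: prod_eq_iff)

lemma cmult_scaleR: "cmult (r *\<^sub>R z) p = r *\<^sub>R cmult z p"
  unfolding cmult_def by (simp add: prod_eq_iff algebra_simps)

lemma cmult_one: "cmult 1 p = p"
  using cmult_of_real[of 1 p] by simp

lemma cmult_eq_zero: "cmult z p = 0 \<Longrightarrow> z \<noteq> 0 \<Longrightarrow> p = 0"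
  using cmult_mult[of "inverse z" z p] cmult_one[of p] unfolding cmult_def by simp

lemma lmult_cmult: "lmult a (cmult z p) = cmult z (lmult a p)"
  unfolding cmult_def lmult_def by (simp add: algebra_simps)

lemma lmult_mult: "lmult (a * c) p = lmult a (lmult c p)"
  unfolding lmult_def by (simp add: mult.assoc)

lemma lmult_diff: "lmult (a - c) p = lmult a p - lmult c p"
  unfolding lmult_def by (simp add: algebra_simps)

lemma lmult_diff_right: "lmult a (p - q) = lmult a p - lmult a q"
  unfolding lmult_def by (simp add: algebra_simps)

lemma lmult_scaleR: "lmult (r *\<^sub>R a) p = r *\<^sub>R lmult a p"
  unfolding lmult_def by simp

lemma lmult_one: "lmult (1::'b::real_algebra_1) p = p"
  unfolding lmult_def by simp

lemma bounded_linear_cmult: "bounded_linear (\<lambda>z. cmult z (p :: 'b \<times> 'b::real_normed_vector))"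
  unfolding cmult_def
  by (intro bounded_linear_Pair bounded_linear_sub bounded_linear_add
      bounded_linear_compose[OF bounded_linear_scaleR_left bounded_linear_Re]
      bounded_linear_compose[OF bounded_linear_scaleR_left bounded_linear_Im])

lemma bounded_linear_lmult: "bounded_linear (\<lambda>a. lmult a (p :: 'b \<times> 'b::real_normed_algebra))"
  unfolding lmult_def by (intro bounded_linear_Pair bounded_linear_mult_left)

lemma lmult_exp:
  fixes a :: "'b::{real_normed_algebra_1,banach}"
  assumes "lmult a p = cmult z p"
  shows "lmult (exp a) p = cmult (exp z) p"
proof -
  have pow: "lmult (a ^ n) p = cmult (z ^ n) p" for n
  proof (induction n)
    case (Suc n)
    have "lmult (a ^ Suc n) p = lmult (a ^ n) (lmult a p)" by (simp only: power_Suc2 lmult_mult)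
    also have "\<dots> = cmult z (cmult (z ^ n) p)" unfolding assms lmult_cmult Suc ..
    finally show ?case by (simp add: cmult_mult)
  qed (simp add: lmult_one cmult_one)
  have sums: "(\<lambda>n. lmult (a ^ n /\<^sub>R fact n) p) sums lmult (exp a) p"
    by (rule bounded_linear.sums[OF bounded_linear_lmult exp_converges])
  have "(\<lambda>n. cmult (z ^ n /\<^sub>R fact n) p) sums cmult (exp z) p"
    by (rule bounded_linear.sums[OF bounded_linear_cmult exp_converges])
  moreover have "lmult (a ^ n /\<^sub>R fact n) p = cmult (z ^ n /\<^sub>R fact n) p" for n
    unfolding lmult_scaleR cmult_scaleR pow ..
  ultimately show ?thesis using sums_unique2[OF sums] by simp
qed

section \<open>Eigenvectors in the complexification and uniqueness of the root\<close>

context resolvent_family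
begin

text \<open>On a joint eigenvector \<open>G t\<close> acts as Ln (t + z) up to a constant, both
  having the derivative 1 / (t + z); as z avoids the nonpositive axis, t + z stays where Ln is
  smooth. Exponentiation gives the action of \<open>E 1 t r\<close>; t to 0 and t to infinity yield
  the two claims.\<close>

lemma lmult_PT_PS:
  assumes w: "\<And>t. 0 < t \<Longrightarrow> lmult (R t) w = cmult (1 / (of_real t + z)) w"
    and z: "z \<notin> \<real>\<^sub>\<le>\<^sub>0" and r: "0 < r"
  shows "lmult (PT r) w = cmult (exp (of_real r * (Ln z - Ln (1 + z)))) w"
    and "lmult (PS 1 r) w = cmult (exp (of_real r * (- Ln (1 + z)))) w"
proof -
  have tz: "of_real t + z \<notin> \<real>\<^sub>\<le>\<^sub>0" if "0 \<le> t" for t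
    using z that by (auto simp: complex_nonpos_Reals_iff)
  define D where "D t = lmult (G t) w - cmult (Ln (of_real t + z)) w" for t
  have D0: "(D has_vector_derivative 0) (at t)" if t: "0 < t" for t
  proof -
    have "((\<lambda>t. Ln (of_real t + z)) has_vector_derivative 1 / (of_real t + z)) (at t)"
    proof -
      have "((\<lambda>t. of_real t + z) has_vector_derivative 1) (at t)"
        by (auto intro!: derivative_eq_intros has_vector_derivative_of_real)
      moreover have "(Ln has_field_derivative inverse (of_real t + z)) (at (of_real t + z))"
        by (rule has_field_derivative_Ln) (use tz[of t] t in simp)
      ultimately have "((Ln \<circ> (\<lambda>t. of_real t + z)) has_vector_derivative 1 * inverse (of_real t + z)) (at t)"
        by (rule field_vector_diff_chain_at)
      then show ?thesis by (simp add: o_def divide_inverse)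
    qed
    then have "(D has_vector_derivative lmult (R t) w - cmult (1 / (of_real t + z)) w) (at t)"
      unfolding D_def
      by (intro has_vector_derivative_diff bounded_linear.has_vector_derivative[OF bounded_linear_cmult]
          bounded_linear.has_vector_derivative[OF bounded_linear_lmult] G_has_vector_derivative t)
    then show ?thesis using w[OF t] by simp
  qed
  have "\<exists>c. \<forall>t\<in>{0<..}. D t = c"
  proof -
    have "(D has_derivative (\<lambda>h. 0)) (at t within {0<..})" if "t \<in> {0<..}" for t
      using D0[of t] that has_derivative_at_withinI unfolding has_vector_derivative_def by fastforce
    then show ?thesis using has_derivative_zero_constant[of "{0<..}" D] by auto
  qed
  then have D1: "D t = D 1" if "0 < t" for t using that by (metis greaterThan_iff zero_less_one)
  have E: "lmult (E 1 t r) w = cmult (exp (of_real r * (Ln (of_real t + z) - Ln (1 + z)))) w" if t: "0 < t" for t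
  proof -
    have "lmult (G t - G 1) w = cmult (Ln (of_real t + z) - Ln (1 + z)) w"
      using D1[OF t] unfolding D_def lmult_diff cmult_diff by (simp add: algebra_simps)
    then have "lmult (r *\<^sub>R (G t - G 1)) w = cmult (of_real r * (Ln (of_real t + z) - Ln (1 + z))) w"
      unfolding lmult_scaleR cmult_mult cmult_of_real by simp
    then show ?thesis unfolding E_def by (rule lmult_exp)
  qed
  show "lmult (PT r) w = cmult (exp (of_real r * (Ln z - Ln (1 + z)))) w"
  proof (rule tendsto_unique)
    show "((\<lambda>q. lmult (E 1 q r) w) \<longlongrightarrow> lmult (PT r) w) (at_right 0)"
      by (rule bounded_linear.tendsto[OF bounded_linear_lmult E_tendsto_PT[OF r]])
    have "((\<lambda>q. exp (of_real r * (Ln (of_real q + z) - Ln (1 + z)))) \<longlongrightarrow>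
        exp (of_real r * (Ln (of_real 0 + z) - Ln (1 + z)))) (at_right 0)"
      using tz[of 0] by (intro tendsto_intros) auto
    then have "((\<lambda>q. cmult (exp (of_real r * (Ln (of_real q + z) - Ln (1 + z)))) w) \<longlongrightarrow>
        cmult (exp (of_real r * (Ln z - Ln (1 + z)))) w) (at_right 0)"
      by (intro bounded_linear.tendsto[OF bounded_linear_cmult]) simp
    then show "((\<lambda>q. lmult (E 1 q r) w) \<longlongrightarrow> cmult (exp (of_real r * (Ln z - Ln (1 + z)))) w) (at_right 0)"
      by (rule Lim_transform_eventually) (simp add: eventually_at_filter E)
  qed simp
  show "lmult (PS 1 r) w = cmult (exp (of_real r * (- Ln (1 + z)))) w"
  proof (rule tendsto_unique)
    show "((\<lambda>t. lmult (t powr (- r) *\<^sub>R E 1 t r) w) \<longlongrightarrow> lmult (PS 1 r) w) at_top"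
      by (rule bounded_linear.tendsto[OF bounded_linear_lmult E_tendsto_PS[OF zero_less_one r]])
    have "((\<lambda>t::real. 1 / t) \<longlongrightarrow> 0) at_top" by real_asymp
    then have "((\<lambda>t. exp (of_real r * (Ln (1 + of_real (1 / t) * z) - Ln (1 + z)))) \<longlongrightarrow>
        exp (of_real r * (Ln (1 + of_real 0 * z) - Ln (1 + z)))) at_top"
      by (intro tendsto_intros) auto
    then have "((\<lambda>t. cmult (exp (of_real r * (Ln (1 + of_real (1 / t) * z) - Ln (1 + z)))) w) \<longlongrightarrow>
        cmult (exp (of_real r * (- Ln (1 + z)))) w) at_top"
      by (intro bounded_linear.tendsto[OF bounded_linear_cmult]) simp
    then show "((\<lambda>t. lmult (t powr (- r) *\<^sub>R E 1 t r) w) \<longlongrightarrow> cmult (exp (of_real r * (- Ln (1 + z)))) w) at_top"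
    proof (rule Lim_transform_eventually)
      show "\<forall>\<^sub>F t in at_top. cmult (exp (of_real r * (Ln (1 + of_real (1 / t) * z) - Ln (1 + z)))) w =
          lmult (t powr (- r) *\<^sub>R E 1 t r) w"
        using eventually_gt_at_top[of 0]
      proof eventually_elim
        case (elim t)
        have "of_real t + z = of_real t * (1 + of_real (1 / t) * z)" using elim by (simp add: field_simps)
        moreover have "1 + of_real (1 / t) * z \<noteq> 0"
        proof
          assume "1 + of_real (1 / t) * z = 0"
          then have "of_real t + z = 0" using elim by (simp add: field_simps)
          then show False using tz[of t] elim by simp
        qed
        \<comment> \<open>A positive factor leaves the argument unchanged, so no multiple of 2 pi i
          enters when \<open>t\<close> is split off.\<close>
        ultimately have Ln: "Ln (of_real t + z) = of_real (ln t) + Ln (1 + of_real (1 / t) * z)"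
          using Ln_times_of_real[OF elim] Ln_of_real[OF elim] by simp
        have "exp (of_real r * (Ln (1 + of_real (1 / t) * z) - Ln (1 + z))) =
            exp (of_real (- r * ln t) + of_real r * (Ln (of_real t + z) - Ln (1 + z)))"
          unfolding Ln by (simp add: algebra_simps)
        also have "\<dots> = exp (of_real (- r * ln t)) * exp (of_real r * (Ln (of_real t + z) - Ln (1 + z)))"
          by (rule exp_add)
        also have "exp (of_real (- r * ln t)) = complex_of_real (t powr (- r))"
          unfolding exp_of_real using elim by (simp add: powr_def)
        finally show ?case unfolding lmult_scaleR E[OF elim] cmult_mult[symmetric] cmult_of_real[symmetric] by simp
      qed
    qed
  qed simp
qed

lemma no_rotated_eigenvector:
  assumes inj: "\<And>x. R 1 * x = 0 \<Longrightarrow> x = 0" and lam: "0 < lam" and \<phi>: "pi < \<phi>"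
    and eq: "\<And>r. 0 < r \<Longrightarrow> r \<le> 1 \<Longrightarrow> lmult (PT r) w = lmult (PS 1 r) (cmult (of_real (lam powr r) * cis (\<phi> * r)) w)"
  shows "w = 0"
proof (rule ccontr)
  assume w0: "w \<noteq> 0"
  interpret TB: bounded_nonneg "1 - R 1" RT "1 + M" by (rule bounded_nonneg_one_minus_R)
  interpret SB: bounded_nonneg "R 1" "RS 1" "1 + M" by (rule bounded_nonneg_R) simp
  define z where "z = of_real lam * cis \<phi>"
  have inj2: "p = 0" if "lmult (R 1) p = 0" for p
    using that inj[of "fst p"] inj[of "snd p"] unfolding lmult_def by (simp add: prod_eq_iff zero_prod_def)
  have "lmult (1 - R 1) w = lmult (R 1) (cmult z w)"
    using eq[of 1] lam unfolding TB.Pw_one SB.Pw_one z_def by simp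
  \<comment> \<open>In terms of A this is w = (1 + z) (A + 1)^-1 w, that is, A w = z w.\<close>
  then have wS: "w = cmult (1 + z) (lmult (R 1) w)"
    unfolding lmult_diff lmult_one lmult_cmult cmult_add cmult_one by (simp add: algebra_simps)
  \<comment> \<open>The resolvent identity relates \<open>R 1\<close> and \<open>R t\<close> on
    \<open>w\<close>; then \<open>R 1\<close> is factored out and cancelled by injectivity.\<close>
  have Rw: "cmult (of_real t + z) (lmult (R t) w) = w" if t: "0 < t" for t
  proof -
    have id: "lmult (R 1) (lmult (R t) w) = lmult (R t) (lmult (R 1) w)"
      unfolding lmult_mult[symmetric] using R_commute[OF t, of 1] by simp
    have "lmult (R 1) w - lmult (R t) w = (t - 1) *\<^sub>R lmult (R 1) (lmult (R t) w)"
      unfolding lmult_mult[symmetric] lmult_scaleR[symmetric] lmult_diff[symmetric]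
      using resolvent_identity[OF zero_less_one t] by simp
    then have "lmult (R 1) w - lmult (R t) w = cmult (of_real (t - 1)) (lmult (R 1) (lmult (R t) w))"
      unfolding cmult_of_real .
    moreover have "lmult (R t) w = cmult (1 + z) (lmult (R 1) (lmult (R t) w))"
      using arg_cong[OF wS, of "lmult (R t)"] unfolding lmult_cmult id .
    ultimately have "lmult (R 1) w = cmult (of_real (t - 1) + (1 + z)) (lmult (R 1) (lmult (R t) w))"
      unfolding cmult_add[of "of_real (t - 1)"] by (simp add: algebra_simps)
    then have "lmult (R 1) (cmult (of_real t + z) (lmult (R t) w) - w) = 0"
      unfolding lmult_diff_right lmult_cmult by simp
    then show ?thesis using inj2 by fastforce
  qed
  \<comment> \<open>An eigenvalue z = -t is impossible, A + t being invertible; hence z avoids the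
    branch cut of the logarithm.\<close>
  have tz: "of_real t + z \<noteq> 0" if "0 < t" for t
  proof
    assume "of_real t + z = 0"
    then have "w = 0" using Rw[OF that] unfolding cmult_def by (simp add: zero_prod_def)
    then show False using w0 by simp
  qed
  have z0: "z \<noteq> 0" unfolding z_def using lam by simp
  have z: "z \<notin> \<real>\<^sub>\<le>\<^sub>0"
  proof
    assume "z \<in> \<real>\<^sub>\<le>\<^sub>0"
    then have "Re z \<le> 0" "Im z = 0" by (auto simp: complex_nonpos_Reals_iff)
    then have "0 < - Re z" "of_real (- Re z) + z = 0" using z0 by (auto simp: complex_eq_iff)
    then show False using tz by blast
  qed
  have Rt: "lmult (R t) w = cmult (1 / (of_real t + z)) w" if "0 < t" for t
  proof -
    have "cmult (1 / (of_real t + z)) w = cmult (1 / (of_real t + z)) (cmult (of_real t + z) (lmult (R t) w))"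
      by (subst Rw[OF that]) (rule refl)
    also have "\<dots> = lmult (R t) w" unfolding cmult_mult[symmetric] using tz[OF that] by (simp add: cmult_one)
    finally show ?thesis by simp
  qed
  have main: "exp (of_real r * Ln z) = of_real (lam powr r) * cis (\<phi> * r)" if r: "0 < r" "r \<le> 1" for r
  proof (rule ccontr)
    let ?S = "exp (of_real r * (- Ln (1 + z)))"
    assume ne: "exp (of_real r * Ln z) \<noteq> of_real (lam powr r) * cis (\<phi> * r)"
    have e: "exp (of_real r * (Ln z - Ln (1 + z))) = exp (of_real r * Ln z) * ?S"
      by (simp add: algebra_simps flip: exp_add)
    have "cmult (exp (of_real r * (Ln z - Ln (1 + z)))) w = cmult (of_real (lam powr r) * cis (\<phi> * r)) (cmult ?S w)"
      using eq[OF r] unfolding lmult_cmult lmult_PT_PS(1)[OF Rt z r(1), simplified] lmult_PT_PS(2)[OF Rt z r(1), simplified] by simp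
    then have "cmult (exp (of_real r * Ln z) * ?S - of_real (lam powr r) * cis (\<phi> * r) * ?S) w = 0"
      unfolding e cmult_diff cmult_mult by simp
    moreover have "exp (of_real r * Ln z) * ?S - of_real (lam powr r) * cis (\<phi> * r) * ?S \<noteq> 0"
      using ne by (simp flip: left_diff_distrib)
    ultimately show False using cmult_eq_zero w0 by blast
  qed
  \<comment> \<open>The excess of the prescribed argument over the principal one. By
    \<open>main\<close>, \<open>cis (r * \<theta>) = 1\<close> for every r in (0, 1], which is false
    once 0 < r \<theta> \<le> pi.\<close>
  define \<theta> where "\<theta> = \<phi> - Im (Ln z)"
  have \<theta>: "\<theta> > 0" unfolding \<theta>_def using Im_Ln_le_pi[OF z0] \<phi> by simp
  have nz: "cmod z = lam" unfolding z_def using lam by (simp add: norm_mult)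
  define r where "r = min 1 (pi / \<theta>)"
  have r: "0 < r" "r \<le> 1" "r * \<theta> \<le> pi"
    unfolding r_def using \<theta> pi_gt_zero mult_right_mono[of "min 1 (pi / \<theta>)" "pi / \<theta>" \<theta>] by auto
  have "Ln z = of_real (ln lam) + \<i> * of_real (Im (Ln z))"
    using Re_Ln[OF z0] nz by (simp add: complex_eq_iff)
  then have "of_real r * Ln z = of_real r * (of_real (ln lam) + \<i> * of_real (Im (Ln z)))" by (rule arg_cong)
  also have "\<dots> = of_real (r * ln lam) + \<i> * of_real (r * Im (Ln z))" by (simp add: algebra_simps)
  finally have "exp (of_real r * Ln z) = exp (of_real (r * ln lam)) * exp (\<i> * of_real (r * Im (Ln z)))"
    by (simp only: exp_add)
  also have "exp (of_real (r * ln lam)) = complex_of_real (lam powr r)"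
    unfolding exp_of_real using lam by (simp add: powr_def)
  also have "exp (\<i> * of_real (r * Im (Ln z))) = cis (r * Im (Ln z))" by (simp only: cis_conv_exp)
  finally have "complex_of_real (lam powr r) * cis (r * Im (Ln z)) = of_real (lam powr r) * cis (\<phi> * r)"
    using main[OF r(1,2)] by (simp only:)
  then have "cis (r * Im (Ln z)) = cis (\<phi> * r)" using lam by simp
  then have "cis (\<phi> * r) * cis (- (r * Im (Ln z))) = 1" by (simp add: cis_mult flip: \<open>cis (r * Im (Ln z)) = cis (\<phi> * r)\<close>)
  then have "cis (r * \<theta>) = 1" unfolding cis_mult \<theta>_def by (simp add: algebra_simps)
  then have "cos (r * \<theta>) = 1" by (metis cis.simps(1) one_complex.simps(1))
  moreover have "cos (r * \<theta>) < cos 0" using r \<theta> by (intro cos_monotone_0_pi) auto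
  ultimately show False by simp
qed

theorem eigenvector_if_power_eigenvector:
  assumes inj: "\<And>x. R 1 * x = 0 \<Longrightarrow> x = 0" and s: "0 < s" "s < 2" and lam: "0 < lam"
    and eq: "PT s * u = lam powr s *\<^sub>R (PS 1 s * u)"
  shows "(1 - R 1) * u = lam *\<^sub>R (R 1 * u)"
proof -
  interpret TB: bounded_nonneg "1 - R 1" RT "1 + M" by (rule bounded_nonneg_one_minus_R)
  interpret SB: bounded_nonneg "R 1" "RS 1" "1 + M" by (rule bounded_nonneg_R) simp
  have comm: "PT a * PS 1 b = PS 1 b * PT a" if "0 < a" "0 < b" for a b
    using PS_PT_commute[of 1 b a] that by simp
  \<comment> \<open>The offsets s + 2 and s keep both exponents positive on [0, s + 1]; additivity
    and continuity of \<open>PS 1\<close> and \<open>PT\<close> are established for positive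
    exponents.\<close>
  define F where "F t = lam powr (- t) *\<^sub>R (PS 1 (s + 2 - t) * PT (s + t) * u)" for t
  have PTs: "PT (t + s) * u = lam powr s *\<^sub>R (PS 1 s * (PT t * u))" if "0 < t" for t
  proof -
    have "PT (t + s) * u = PT t * (PT s * u)" using TB.Pw_add[OF that s(1)] by (simp add: mult.assoc)
    also have "\<dots> = lam powr s *\<^sub>R (PT t * PS 1 s * u)" unfolding eq by (simp add: mult.assoc)
    finally show ?thesis using comm[OF that s(1)] by (simp add: mult.assoc)
  qed
  have Fc: "continuous_on {0..s + 1} F"
    unfolding F_def using s lam
    by (intro continuous_intros continuous_on_compose2[OF SB.continuous_on_Pw] continuous_on_compose2[OF TB.continuous_on_Pw]) auto
  have Fp: "F (t + s) = F t" if t: "t \<in> {0..1}" for t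
  proof -
    have "F (t + s) = lam powr (- (t + s)) *\<^sub>R (PS 1 (2 - t) * (PT ((s + t) + s) * u))"
      unfolding F_def by (simp add: algebra_simps)
    also have "PT ((s + t) + s) * u = lam powr s *\<^sub>R (PS 1 s * (PT (s + t) * u))"
      by (rule PTs) (use t s in auto)
    also have "PS 1 (2 - t) * (lam powr s *\<^sub>R (PS 1 s * (PT (s + t) * u))) = lam powr s *\<^sub>R (PS 1 (2 - t + s) * PT (s + t) * u)"
      using SB.Pw_add[of "2 - t" s] t s by (simp add: mult.assoc)
    also have "lam powr (- (t + s)) *\<^sub>R (lam powr s *\<^sub>R (PS 1 (2 - t + s) * PT (s + t) * u)) = F t"
      unfolding F_def using lam by (simp add: algebra_simps flip: powr_add)
    finally show ?thesis .
  qed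
  \<comment> \<open>\<open>PT r\<close> raises one exponent of \<open>F\<close>, and
    \<open>PS 1 r\<close> restores the other after the shift. Integrated against a trigonometric
    function this becomes the equation for the Fourier coefficients.\<close>
  have Fshift: "PT r * F t = lam powr r *\<^sub>R (PS 1 r * F (t + r))" if r: "0 < r" "r \<le> 1" and t: "t \<in> {0..s}" for r t
  proof -
    have p: "0 < s + 2 - t" "0 < s + t" "0 < s + 2 - (t + r)" using r t s by auto
    have "PT r * F t = lam powr (- t) *\<^sub>R (PT r * PS 1 (s + 2 - t) * PT (s + t) * u)"
      unfolding F_def by (simp add: mult.assoc)
    also have "PT r * PS 1 (s + 2 - t) * PT (s + t) = PS 1 (s + 2 - t) * (PT r * PT (s + t))"
      using comm[OF r(1) p(1)] by (simp add: mult.assoc)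
    also have "PT r * PT (s + t) = PT (s + (t + r))"
      using TB.Pw_add[OF r(1) p(2)] by (simp add: algebra_simps)
    also have "PS 1 (s + 2 - t) = PS 1 r * PS 1 (s + 2 - (t + r))"
      using SB.Pw_add[OF r(1) p(3)] by (simp add: algebra_simps)
    also have "lam powr (- t) = lam powr r * lam powr (- (t + r))" by (simp flip: powr_add)
    finally show ?thesis unfolding F_def by (simp add: mult.assoc)
  qed
  have zero: "integral {0..s} (\<lambda>t. cos (2 * pi * real k / s * t) *\<^sub>R F t) = 0 \<and>
      integral {0..s} (\<lambda>t. sin (2 * pi * real k / s * t) *\<^sub>R F t) = 0" if k: "0 < k" for k :: nat
  proof -
    define \<phi> where "\<phi> = 2 * pi * real k / s"
    have "pi < \<phi>"
    proof -
      have "s < 2 * real k" using s k by (cases k) auto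
      then have "pi * s < pi * (2 * real k)" by (intro mult_strict_left_mono) auto
      then show ?thesis unfolding \<phi>_def using s by (simp add: field_simps)
    qed
    define c where "c = integral {0..s} (\<lambda>t. cos (\<phi> * t) *\<^sub>R F t)"
    define d where "d = integral {0..s} (\<lambda>t. sin (\<phi> * t) *\<^sub>R F t)"
    have Fc': "continuous_on {0..s} F" by (rule continuous_on_subset[OF Fc]) auto
    have ci: "(\<lambda>t. cos (\<phi> * t) *\<^sub>R F t) integrable_on {0..s}" "(\<lambda>t. sin (\<phi> * t) *\<^sub>R F t) integrable_on {0..s}"
      by (intro integrable_continuous_interval continuous_intros Fc')+
    have \<phi>s: "\<phi> * s = 2 * pi * of_int (int k)" unfolding \<phi>_def using s by simp
    have per: "cos (\<phi> * (t + s)) = cos (\<phi> * t)" "sin (\<phi> * (t + s)) = sin (\<phi> * t)" for t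
      unfolding distrib_left cos_add sin_add \<phi>s by (simp_all add: cos_int_2pin sin_int_2pin del: of_int_of_nat_eq)
    have shiftI: "PT r * integral {0..s} (\<lambda>t. h t *\<^sub>R F t) = lam powr r *\<^sub>R (PS 1 r * integral {0..s} (\<lambda>t. h (t - r) *\<^sub>R F t))"
      if r: "0 < r" "r \<le> 1" and h: "continuous_on UNIV h" "\<And>t. h (t + s) = h t" for r h
    proof -
      have hF: "(\<lambda>t. h t *\<^sub>R F t) integrable_on {0..s}"
        by (intro integrable_continuous_interval continuous_intros Fc' continuous_on_subset[OF h(1)]) auto
      have hFr: "(\<lambda>t. h t *\<^sub>R F (t + r)) integrable_on {0..s}"
        by (intro integrable_continuous_interval continuous_intros continuous_on_compose2[OF Fc] continuous_on_subset[OF h(1)])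
          (use r in auto)
      have "PT r * integral {0..s} (\<lambda>t. h t *\<^sub>R F t) = integral {0..s} (\<lambda>t. PT r * (h t *\<^sub>R F t))"
        using integral_linear[OF hF bounded_linear_mult_right, of "PT r"] by (simp add: o_def)
      also have "\<dots> = integral {0..s} (\<lambda>t. lam powr r *\<^sub>R (PS 1 r * (h t *\<^sub>R F (t + r))))"
        by (rule integral_cong) (simp add: Fshift[OF r])
      also have "\<dots> = lam powr r *\<^sub>R integral {0..s} (\<lambda>t. PS 1 r * (h t *\<^sub>R F (t + r)))"
        by (rule integral_cmul)
      also have "integral {0..s} (\<lambda>t. PS 1 r * (h t *\<^sub>R F (t + r))) = PS 1 r * integral {0..s} (\<lambda>t. h t *\<^sub>R F (t + r))"
        using integral_linear[OF hFr bounded_linear_mult_right, of "PS 1 r"] by (simp add: o_def)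
      also have "integral {0..s} (\<lambda>t. h t *\<^sub>R F (t + r)) = integral {0..s} (\<lambda>t. h (t - r) *\<^sub>R F t)"
        by (rule integral_periodic_shift[OF Fc h(1) Fp h(2) s(1)]) (use r in auto)
      finally show ?thesis .
    qed
    have "PT r * c = lam powr r *\<^sub>R (PS 1 r * (cos (\<phi> * r) *\<^sub>R c + sin (\<phi> * r) *\<^sub>R d)) \<and>
        PT r * d = lam powr r *\<^sub>R (PS 1 r * (cos (\<phi> * r) *\<^sub>R d - sin (\<phi> * r) *\<^sub>R c))"
      if r: "0 < r" "r \<le> 1" for r
    proof -
      have "cos (\<phi> * (t - r)) *\<^sub>R F t = cos (\<phi> * r) *\<^sub>R (cos (\<phi> * t) *\<^sub>R F t) + sin (\<phi> * r) *\<^sub>R (sin (\<phi> * t) *\<^sub>R F t)" for t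
        unfolding right_diff_distrib cos_diff by (simp add: scaleR_add_left mult.commute)
      then have "integral {0..s} (\<lambda>t. cos (\<phi> * (t - r)) *\<^sub>R F t) =
          integral {0..s} (\<lambda>t. cos (\<phi> * r) *\<^sub>R (cos (\<phi> * t) *\<^sub>R F t) + sin (\<phi> * r) *\<^sub>R (sin (\<phi> * t) *\<^sub>R F t))" by (simp only:)
      also have "\<dots> = cos (\<phi> * r) *\<^sub>R c + sin (\<phi> * r) *\<^sub>R d"
        unfolding c_def d_def
        by (subst Henstock_Kurzweil_Integration.integral_add[OF integrable_cmul[OF ci(1)] integrable_cmul[OF ci(2)]]) (simp only: integral_cmul)
      finally have 1: "integral {0..s} (\<lambda>t. cos (\<phi> * (t - r)) *\<^sub>R F t) = cos (\<phi> * r) *\<^sub>R c + sin (\<phi> * r) *\<^sub>R d" .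
      have "sin (\<phi> * (t - r)) *\<^sub>R F t = cos (\<phi> * r) *\<^sub>R (sin (\<phi> * t) *\<^sub>R F t) - sin (\<phi> * r) *\<^sub>R (cos (\<phi> * t) *\<^sub>R F t)" for t
        unfolding right_diff_distrib sin_diff by (simp add: scaleR_diff_left mult.commute)
      then have "integral {0..s} (\<lambda>t. sin (\<phi> * (t - r)) *\<^sub>R F t) =
          integral {0..s} (\<lambda>t. cos (\<phi> * r) *\<^sub>R (sin (\<phi> * t) *\<^sub>R F t) - sin (\<phi> * r) *\<^sub>R (cos (\<phi> * t) *\<^sub>R F t))" by (simp only:)
      also have "\<dots> = cos (\<phi> * r) *\<^sub>R d - sin (\<phi> * r) *\<^sub>R c"
        unfolding c_def d_def
        by (subst Henstock_Kurzweil_Integration.integral_diff[OF integrable_cmul[OF ci(2)] integrable_cmul[OF ci(1)]]) (simp only: integral_cmul)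
      finally have 2: "integral {0..s} (\<lambda>t. sin (\<phi> * (t - r)) *\<^sub>R F t) = cos (\<phi> * r) *\<^sub>R d - sin (\<phi> * r) *\<^sub>R c" .
      have "PT r * c = lam powr r *\<^sub>R (PS 1 r * integral {0..s} (\<lambda>t. cos (\<phi> * (t - r)) *\<^sub>R F t))"
        unfolding c_def by (rule shiftI[OF r]) (auto intro!: continuous_intros simp: per)
      moreover have "PT r * d = lam powr r *\<^sub>R (PS 1 r * integral {0..s} (\<lambda>t. sin (\<phi> * (t - r)) *\<^sub>R F t))"
        unfolding d_def by (rule shiftI[OF r]) (auto intro!: continuous_intros simp: per)
      ultimately show ?thesis unfolding 1 2 by blast
    qed
    note rot = this
    \<comment> \<open>The pair stands for c - i d, the integral of e^(-i \<phi> t) F t; the two real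
      formulas merge into multiplication by \<open>cis (\<phi> * r)\<close>.\<close>
    have rotc: "lmult (PT r) (c, - d) = lmult (PS 1 r) (cmult (of_real (lam powr r) * cis (\<phi> * r)) (c, - d))"
      if "0 < r" "r \<le> 1" for r
      using rot[OF that] unfolding lmult_def cmult_def by (simp add: algebra_simps)
    have "(c, - d) = 0" by (rule no_rotated_eigenvector[OF inj lam \<open>pi < \<phi>\<close> rotc])
    then show ?thesis unfolding c_def d_def \<phi>_def by (simp add: zero_prod_def)
  qed
  define m where "m = (1 / s) *\<^sub>R integral {0..s} F"
  have "continuous_on {0..s} F" by (rule continuous_on_subset[OF Fc]) auto
  then have Fm: "F t = m" if "t \<in> {0<..<s}" for t
    unfolding m_def by (rule eq_mean_if_Fourier_coefficients_eq_zero) (use zero that in auto)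
  \<comment> \<open>The Fourier argument reaches interior points only; the end point follows by
    continuity.\<close>
  have F0: "F 0 = m"
  proof (rule continuous_constant_on_closure[of "{0<..<s}"])
    show "continuous_on (closure {0<..<s}) F" using s \<open>continuous_on {0..s} F\<close> by simp
  qed (use Fm s in auto)
  \<comment> \<open>The exponent r = 1/n lies inside the period, so that F r = F 0, and its n-th
    multiple is the exponent 1 of the claim.\<close>
  obtain n :: nat where n: "1 / s < real n" using reals_Archimedean2 by blast
  have n0: "0 < n" using n s by (cases n) (auto simp: divide_less_0_iff)
  define r where "r = 1 / real n"
  have r: "0 < r" "r < s" "real n * r = 1" unfolding r_def using n n0 s by (auto simp: field_simps)
  have "PT r * u = lam powr r *\<^sub>R (PS 1 r * u)"
  proof -
    \<comment> \<open>The power of S common to \<open>F r\<close> and \<open>F 0\<close>; being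
      injective, it can be cancelled.\<close>
    define b where "b = 2 * s + 2 - r"
    have b: "0 < b" unfolding b_def using r s by simp
    have "F r = lam powr (- r) *\<^sub>R (PS 1 (s + 2 - r) * (PT (r + s) * u))"
      unfolding F_def by (simp add: mult.assoc add.commute)
    also have "\<dots> = (lam powr (- r) * lam powr s) *\<^sub>R (PS 1 (s + 2 - r) * PS 1 s * (PT r * u))"
      unfolding PTs[OF r(1)] by (simp add: mult.assoc)
    also have "PS 1 (s + 2 - r) * PS 1 s = PS 1 b"
      unfolding b_def using SB.Pw_add[of "s + 2 - r" s] r s by (simp add: algebra_simps)
    finally have Fr: "F r = (lam powr (- r) * lam powr s) *\<^sub>R (PS 1 b * (PT r * u))" .
    have "F 0 = PS 1 (s + 2) * (PT s * u)" unfolding F_def using lam by (simp add: mult.assoc)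
    also have "\<dots> = lam powr s *\<^sub>R (PS 1 (s + 2) * PS 1 s * u)" unfolding eq by (simp add: mult.assoc)
    also have "PS 1 (s + 2) * PS 1 s = PS 1 b * PS 1 r"
      unfolding b_def using SB.Pw_add[of "s + 2" s] SB.Pw_add[of "2 * s + 2 - r" r] r s by (simp add: algebra_simps)
    finally have F0': "F 0 = lam powr s *\<^sub>R (PS 1 b * (PS 1 r * u))" by (simp add: mult.assoc)
    have "F r = F 0" using Fm[of r] F0 r by simp
    then have "(lam powr (- r) * lam powr s) *\<^sub>R (PS 1 b * (PT r * u)) = lam powr s *\<^sub>R (PS 1 b * (PS 1 r * u))"
      unfolding Fr F0' .
    moreover have "lam powr s *\<^sub>R (PS 1 b * (lam powr (- r) *\<^sub>R (PT r * u) - PS 1 r * u)) =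
        (lam powr (- r) * lam powr s) *\<^sub>R (PS 1 b * (PT r * u)) - lam powr s *\<^sub>R (PS 1 b * (PS 1 r * u))"
      by (simp only: right_diff_distrib scaleR_right_diff_distrib mult_scaleR_right scaleR_scaleR mult.commute[of "lam powr s"])
    ultimately have "lam powr s *\<^sub>R (PS 1 b * (lam powr (- r) *\<^sub>R (PT r * u) - PS 1 r * u)) = 0" by simp
    then have "PS 1 b * (lam powr (- r) *\<^sub>R (PT r * u) - PS 1 r * u) = 0" using lam by simp
    then have "lam powr (- r) *\<^sub>R (PT r * u) - PS 1 r * u = 0"
      by (rule SB.Pw_injective[rotated 2]) (rule inj, assumption, rule b)
    then have "lam powr (- r) *\<^sub>R (PT r * u) = PS 1 r * u" by (simp only: right_minus_eq)
    then have "lam powr r *\<^sub>R (lam powr (- r) *\<^sub>R (PT r * u)) = lam powr r *\<^sub>R (PS 1 r * u)" by simp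
    then show ?thesis using lam by (simp flip: powr_add)
  qed
  then have "PT r ^ k * u = (lam powr r) ^ k *\<^sub>R (PS 1 r ^ k * u)" for k
  proof (induction k)
    case (Suc k)
    have "PT r ^ k * PS 1 r = PS 1 r * PT r ^ k"
      using comm[OF r(1) r(1)] by (simp add: power_commuting_commutes)
    then have "PT r ^ Suc k * u = lam powr r *\<^sub>R (PS 1 r * (PT r ^ k * u))"
      using Suc.prems by (simp only: power_Suc2 mult.assoc) (simp add: mult.assoc[symmetric])
    then show ?case using Suc by (simp add: mult.assoc)
  qed simp
  from this[of n] have "PT 1 * u = (lam powr r) ^ n *\<^sub>R (PS 1 1 * u)"
    using TB.Pw_power[OF r(1) n0] SB.Pw_power[OF r(1) n0] r(3) by simp
  moreover have "(lam powr r) ^ n = lam"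
    using lam r(3) by (simp add: powr_powr mult.commute flip: powr_realpow)
  ultimately show ?thesis unfolding TB.Pw_one SB.Pw_one by simp
qed

end

section \<open>The Banach algebra of bounded operators\<close>

text \<open>The extra summand \<open>\<real>\<close> makes the space nontrivial, so that the identity has norm 1, and lets a
  vector \<open>u\<close> be represented by the operator \<open>(x, r) \<mapsto> (r u, 0)\<close> of the same algebra.\<close>

typedef (overloaded) 'a bop = "UNIV :: (('a::real_normed_vector \<times> real) \<Rightarrow>\<^sub>L ('a \<times> real)) set"
  morphisms of_bop Bop by simp

setup_lifting type_definition_bop

instantiation bop :: (real_normed_vector) real_normed_vector
begin

lift_definition zero_bop :: "'a bop" is 0 .
lift_definition plus_bop :: "'a bop \<Rightarrow> 'a bop \<Rightarrow> 'a bop" is "(+)" .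
lift_definition minus_bop :: "'a bop \<Rightarrow> 'a bop \<Rightarrow> 'a bop" is "(-)" .
lift_definition uminus_bop :: "'a bop \<Rightarrow> 'a bop" is uminus .
lift_definition scaleR_bop :: "real \<Rightarrow> 'a bop \<Rightarrow> 'a bop" is scaleR .
lift_definition norm_bop :: "'a bop \<Rightarrow> real" is norm .
definition dist_bop :: "'a bop \<Rightarrow> 'a bop \<Rightarrow> real" where "dist_bop a b = norm (a - b)"
definition sgn_bop :: "'a bop \<Rightarrow> 'a bop" where "sgn_bop a = inverse (norm a) *\<^sub>R a"
definition uniformity_bop :: "('a bop \<times> 'a bop) filter" where
  "uniformity_bop = (INF e\<in>{0 <..}. principal {(x, y). dist x y < e})"
definition open_bop :: "'a bop set \<Rightarrow> bool" where
  "open_bop S = (\<forall>x\<in>S. \<forall>\<^sub>F (x', y) in uniformity. x' = x \<longrightarrow> y \<in> S)"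

instance
proof
  fix a b c :: "'a bop" and r s :: real
  show "a + b + c = a + (b + c)" by transfer (rule add.assoc)
  show "a + b = b + a" by transfer (rule add.commute)
  show "0 + a = a" by transfer simp
  show "- a + a = 0" by transfer simp
  show "a - b = a + - b" by transfer simp
  show "r *\<^sub>R (a + b) = r *\<^sub>R a + r *\<^sub>R b" by transfer (rule scaleR_add_right)
  show "(r + s) *\<^sub>R a = r *\<^sub>R a + s *\<^sub>R a" by transfer (rule scaleR_add_left)
  show "r *\<^sub>R s *\<^sub>R a = (r * s) *\<^sub>R a" by transfer simp
  show "1 *\<^sub>R a = a" by transfer simp
  show "(norm a = 0) = (a = 0)" by transfer simp
  show "norm (a + b) \<le> norm a + norm b" by transfer (rule norm_triangle_ineq)
  show "norm (r *\<^sub>R a) = \<bar>r\<bar> * norm a" by transfer simp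
qed (fact dist_bop_def sgn_bop_def uniformity_bop_def open_bop_def)+

end

instantiation bop :: (real_normed_vector) real_normed_algebra_1
begin

lift_definition one_bop :: "'a bop" is id_blinfun .
lift_definition times_bop :: "'a bop \<Rightarrow> 'a bop \<Rightarrow> 'a bop" is blinfun_compose .

lemma norm_id_bop: "norm (1 :: 'a bop) = 1"
proof transfer
  have "norm (blinfun_apply id_blinfun (0::'a, 1::real)) \<le> norm (id_blinfun :: ('a \<times> real) \<Rightarrow>\<^sub>L ('a \<times> real)) * norm (0::'a, 1::real)"
    by (rule norm_blinfun)
  then have "1 \<le> norm (id_blinfun :: ('a \<times> real) \<Rightarrow>\<^sub>L ('a \<times> real))" by (simp add: norm_Pair)
  moreover have "norm (id_blinfun :: ('a \<times> real) \<Rightarrow>\<^sub>L ('a \<times> real)) \<le> 1" by (rule norm_blinfun_bound) auto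
  ultimately show "norm (id_blinfun :: ('a \<times> real) \<Rightarrow>\<^sub>L ('a \<times> real)) = 1" by simp
qed

instance
proof
  fix a b c :: "'a bop" and r :: real
  show "a * b * c = a * (b * c)" by transfer (simp add: blinfun_eqI)
  show "(a + b) * c = a * c + b * c" by transfer (simp add: blinfun_eqI blinfun.add_left)
  show "a * (b + c) = a * b + a * c" by transfer (simp add: blinfun_eqI blinfun.add_left blinfun.add_right)
  show "r *\<^sub>R a * b = r *\<^sub>R (a * b)" by transfer (simp add: blinfun_eqI blinfun.scaleR_left)
  show "a * r *\<^sub>R b = r *\<^sub>R (a * b)" by transfer (simp add: blinfun_eqI blinfun.scaleR_left blinfun.scaleR_right)
  show "1 * a = a" by transfer (simp add: blinfun_eqI)
  show "a * 1 = a" by transfer (simp add: blinfun_eqI)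
  show "(0 :: 'a bop) \<noteq> 1" using norm_id_bop by (metis norm_zero zero_neq_one)
  show "norm (a * b) \<le> norm a * norm b" by transfer (rule norm_blinfun_compose)
  show "norm (1 :: 'a bop) = 1" by (rule norm_id_bop)
qed

end

instance bop :: (banach) banach
proof
  fix X :: "nat \<Rightarrow> 'a bop" assume "Cauchy X"
  then have "Cauchy (\<lambda>n. of_bop (X n))"
    unfolding Cauchy_def dist_norm by transfer
  then obtain l where l: "(\<lambda>n. of_bop (X n)) \<longlonglongrightarrow> l" using Cauchy_convergent_iff convergent_def by blast
  have "norm (X n - Bop l) = norm (of_bop (X n) - l)" for n
    by (simp add: norm_bop.rep_eq minus_bop.rep_eq Bop_inverse)
  then have "X \<longlonglongrightarrow> Bop l" using l unfolding LIMSEQ_def dist_norm by simp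
  then show "convergent X" by (rule convergentI)
qed

section \<open>Vectors and operators of X inside the algebra\<close>

definition vec_op :: "'a::real_normed_vector \<Rightarrow> 'a bop" where
  "vec_op u = Bop (Blinfun (\<lambda>p. (snd p *\<^sub>R u, 0)))"

definition diag :: "('a::real_normed_vector \<Rightarrow> 'a) \<Rightarrow> real \<Rightarrow> 'a bop" where
  "diag f c = Bop (Blinfun (\<lambda>p. (f (fst p), c * snd p)))"

text \<open>A bounded left inverse of \<open>vec_op\<close>, by which integrals computed in the
  algebra return to X.\<close>

definition ev :: "'a::real_normed_vector bop \<Rightarrow> 'a" where
  "ev a = fst (blinfun_apply (of_bop a) (0, 1))"

lemma bop_eqI: "(\<And>p. blinfun_apply (of_bop a) p = blinfun_apply (of_bop b) p) \<Longrightarrow> a = b"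
  by (metis blinfun_eqI of_bop_inject)

lemma of_bop_simps:
  "of_bop (a + b) = of_bop a + of_bop b" "of_bop (a - b) = of_bop a - of_bop b"
  "of_bop (r *\<^sub>R a) = r *\<^sub>R of_bop a" "of_bop (a * b) = of_bop a o\<^sub>L of_bop b"
  "of_bop 1 = id_blinfun" "of_bop 0 = 0"
  by (simp_all add: plus_bop.rep_eq minus_bop.rep_eq scaleR_bop.rep_eq times_bop.rep_eq one_bop.rep_eq zero_bop.rep_eq)

lemma apply_vec_op: "blinfun_apply (of_bop (vec_op u)) p = (snd p *\<^sub>R u, 0)"
proof -
  have "bounded_linear (\<lambda>p::'a \<times> real. (snd p *\<^sub>R u, 0::real))"
    by (intro bounded_linear_Pair bounded_linear_zero bounded_linear_compose[OF bounded_linear_scaleR_left bounded_linear_snd])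
  then show ?thesis unfolding vec_op_def by (simp add: Bop_inverse bounded_linear_Blinfun_apply)
qed

lemma apply_diag:
  assumes "bounded_linear f"
  shows "blinfun_apply (of_bop (diag f c)) p = (f (fst p), c * snd p)"
proof -
  have "bounded_linear (\<lambda>p. (f (fst p), c * snd p))"
    by (intro bounded_linear_Pair bounded_linear_compose[OF assms bounded_linear_fst]
        bounded_linear_compose[OF bounded_linear_mult_right bounded_linear_snd])
  then show ?thesis unfolding diag_def by (simp add: Bop_inverse bounded_linear_Blinfun_apply)
qed

lemma diag_vec_op: "bounded_linear f \<Longrightarrow> diag f c * vec_op u = vec_op (f u)"
  by (rule bop_eqI) (simp add: of_bop_simps apply_vec_op apply_diag linear_simps)

lemma ev_vec_op: "ev (vec_op u) = u"
  unfolding ev_def by (simp add: apply_vec_op)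

lemma vec_op_eq_iff: "vec_op u = vec_op v \<longleftrightarrow> u = v"
  using ev_vec_op by metis

lemma vec_op_add: "vec_op (u + v) = vec_op u + vec_op v"
  by (rule bop_eqI) (simp add: of_bop_simps apply_vec_op blinfun.add_left scaleR_add_right)

lemma vec_op_diff: "vec_op (u - v) = vec_op u - vec_op v"
  by (rule bop_eqI) (simp add: of_bop_simps apply_vec_op blinfun.diff_left scaleR_diff_right)

lemma vec_op_scaleR: "vec_op (r *\<^sub>R u) = r *\<^sub>R vec_op u"
  by (rule bop_eqI) (simp add: of_bop_simps apply_vec_op blinfun.scaleR_left)

lemma norm_vec_op_le: "norm (vec_op u) \<le> norm u"
proof -
  have "norm (of_bop (vec_op u)) \<le> norm u"
  proof (rule norm_blinfun_bound)
    fix p :: "'a \<times> real"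
    have "norm (blinfun_apply (of_bop (vec_op u)) p) = \<bar>snd p\<bar> * norm u" by (simp add: apply_vec_op norm_Pair)
    also have "\<dots> \<le> norm p * norm u" using norm_snd_le[of "snd p" "fst p"] by (intro mult_right_mono) auto
    finally show "norm (blinfun_apply (of_bop (vec_op u)) p) \<le> norm u * norm p" by (simp add: mult.commute)
  qed simp
  then show ?thesis by (simp add: norm_bop.rep_eq)
qed

lemma norm_ev_le: "norm (ev a) \<le> norm a"
proof -
  have "norm (ev a) \<le> norm (blinfun_apply (of_bop a) (0, 1))" unfolding ev_def
    by (metis norm_fst_le prod.collapse)
  also have "\<dots> \<le> norm (of_bop a) * norm (0::'a, 1::real)" by (rule norm_blinfun)
  finally show ?thesis by (simp add: norm_bop.rep_eq norm_Pair)
qed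

lemma bounded_linear_vec_op: "bounded_linear vec_op"
  by (rule bounded_linear_intro[where K=1]) (simp_all add: vec_op_add vec_op_scaleR norm_vec_op_le)

lemma bounded_linear_ev: "bounded_linear ev"
proof (rule bounded_linear_intro[where K=1])
  show "ev (a + b) = ev a + ev b" for a b :: "'a bop"
    unfolding ev_def by (simp add: of_bop_simps blinfun.add_left)
  show "ev (r *\<^sub>R a) = r *\<^sub>R ev a" for r and a :: "'a bop"
    unfolding ev_def by (simp add: of_bop_simps blinfun.scaleR_left)
qed (simp add: norm_ev_le)

lemma norm_diag_le:
  assumes f: "bounded_linear f" and le: "\<And>u. norm (f u) \<le> K * norm u" "\<bar>c\<bar> \<le> K"
  shows "norm (diag f c) \<le> K"
proof -
  have K: "0 \<le> K" using le(2) by linarith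
  have "norm (of_bop (diag f c)) \<le> K"
  proof (rule norm_blinfun_bound[OF K])
    fix p :: "'a \<times> real"
    have a: "norm (f (fst p)) \<le> K * norm (fst p)" by (rule le(1))
    have "norm (c * snd p) = \<bar>c\<bar> * norm (snd p)" by (simp add: abs_mult)
    also have "\<dots> \<le> K * norm (snd p)" using le(2) by (rule mult_right_mono) simp
    finally have b: "norm (c * snd p) \<le> K * norm (snd p)" .
    have "norm (f (fst p), c * snd p) = sqrt ((norm (f (fst p)))\<^sup>2 + (norm (c * snd p))\<^sup>2)" by (simp only: norm_Pair)
    also have "\<dots> \<le> sqrt ((K * norm (fst p))\<^sup>2 + (K * norm (snd p))\<^sup>2)"
      by (intro real_sqrt_le_mono add_mono power_mono a b) auto
    also have "\<dots> = sqrt (K\<^sup>2 * ((norm (fst p))\<^sup>2 + (norm (snd p))\<^sup>2))" by (simp add: power_mult_distrib distrib_left)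
    also have "\<dots> = K * norm p" using K by (simp add: real_sqrt_mult norm_prod_def)
    finally show "norm (blinfun_apply (of_bop (diag f c)) p) \<le> K * norm p" by (simp add: apply_diag[OF f])
  qed
  then show ?thesis by (simp add: norm_bop.rep_eq)
qed

lemma diag_mult: "bounded_linear f \<Longrightarrow> bounded_linear g \<Longrightarrow> diag f c * diag g d = diag (\<lambda>x. f (g x)) (c * d)"
  using bounded_linear_compose[of f g]
  by (intro bop_eqI) (simp add: of_bop_simps apply_diag)

lemma diag_add: "bounded_linear f \<Longrightarrow> bounded_linear g \<Longrightarrow> diag f c + diag g d = diag (\<lambda>x. f x + g x) (c + d)"
  using bounded_linear_add[of f g]
  by (intro bop_eqI) (simp add: of_bop_simps apply_diag blinfun.add_left distrib_right)

lemma diag_diff: "bounded_linear f \<Longrightarrow> bounded_linear g \<Longrightarrow> diag f c - diag g d = diag (\<lambda>x. f x - g x) (c - d)"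
  using bounded_linear_sub[of f g]
  by (intro bop_eqI) (simp add: of_bop_simps apply_diag blinfun.diff_left left_diff_distrib)

lemma diag_scaleR: "bounded_linear f \<Longrightarrow> r *\<^sub>R diag f c = diag (\<lambda>x. r *\<^sub>R f x) (r * c)"
  using bounded_linear_const_scaleR[of f r]
  by (intro bop_eqI) (simp add: of_bop_simps apply_diag blinfun.scaleR_left)

lemma diag_one: "diag (\<lambda>x. x) 1 = 1"
  by (intro bop_eqI) (simp add: of_bop_simps apply_diag bounded_linear_ident)

lemma diag_injective:
  assumes f: "bounded_linear f" and inj: "\<And>u. f u = 0 \<Longrightarrow> u = 0" and c: "c \<noteq> 0" and z: "diag f c * a = 0"
  shows "a = 0"
proof (rule bop_eqI)
  fix p
  have "blinfun_apply (of_bop (diag f c * a)) p = 0" using z by (simp add: of_bop_simps)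
  then have "f (fst (blinfun_apply (of_bop a) p)) = 0" "c * snd (blinfun_apply (of_bop a) p) = 0"
    by (simp_all add: of_bop_simps apply_diag[OF f] prod_eq_iff)
  then show "blinfun_apply (of_bop a) p = blinfun_apply (of_bop 0) p"
    using inj c by (simp add: of_bop_simps prod_eq_iff)
qed

section \<open>Nonnegative operators\<close>

lemma app_eqI: "single_valued A \<Longrightarrow> (u, v) \<in> A \<Longrightarrow> app A u = v"
  unfolding app_def by (rule the_equality) (auto dest: single_valuedD)

lemma app_in: "single_valued A \<Longrightarrow> u \<in> Domain A \<Longrightarrow> (u, app A u) \<in> A"
  by (auto simp: app_eqI)

lemma in_shift_iff: "(u, w) \<in> shift \<mu> A \<longleftrightarrow> (u, w - \<mu> *\<^sub>R u) \<in> A"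
  unfolding shift_def by (auto simp: algebra_simps intro: exI[of _ "w - \<mu> *\<^sub>R u"])

lemma zero_in_resolvent_setD:
  assumes B: "single_valued B" and z: "zero_in_resolvent_set B"
  shows "(app (B\<inverse>) f, f) \<in> B" and "(u, v) \<in> B \<Longrightarrow> app (B\<inverse>) v = u"
proof -
  have bij: "bij_betw (app B) (Domain B) UNIV" using z unfolding zero_in_resolvent_set_def by simp
  have uniq: "u = u'" if "(u, v) \<in> B" "(u', v) \<in> B" for u u' v
    using bij_betw_imp_inj_on[OF bij] app_eqI[OF B that(1)] app_eqI[OF B that(2)] that
    by (auto dest: inj_onD)
  have sv: "single_valued (B\<inverse>)" by (rule single_valuedI) (auto intro: uniq)
  show "(app (B\<inverse>) f, f) \<in> B"
  proof -
    obtain u where "u \<in> Domain B" "app B u = f" using bij unfolding bij_betw_def by (metis UNIV_I imageE)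
    then have "(f, u) \<in> B\<inverse>" using app_in[OF B] by auto
    then show ?thesis using app_in[OF sv, of f] by blast
  qed
  show "(u, v) \<in> B \<Longrightarrow> app (B\<inverse>) v = u" by (rule app_eqI[OF sv]) simp
qed

lemma zero_in_resolvent_setI:
  assumes B: "single_valued B" and r: "bounded_linear r"
    and in_B: "\<And>f. (r f, f) \<in> B" and r_eq: "\<And>u v. (u, v) \<in> B \<Longrightarrow> r v = u"
  shows "zero_in_resolvent_set B" and "app (B\<inverse>) = r"
proof -
  show a: "app (B\<inverse>) = r"
  proof
    fix f
    have "single_valued (B\<inverse>)" by (rule single_valuedI) (use r_eq in auto)
    then show "app (B\<inverse>) f = r f" by (rule app_eqI) (simp add: in_B)
  qed
  have "inj_on (app B) (Domain B)"
    by (rule inj_onI) (metis app_in[OF B] r_eq)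
  moreover have "app B ` Domain B = UNIV"
    using app_eqI[OF B in_B] in_B by (metis Domain.DomainI UNIV_eq_I image_eqI)
  ultimately show "zero_in_resolvent_set B"
    unfolding zero_in_resolvent_set_def a bij_betw_def using r by simp
qed

locale nonneg_op =
  fixes A :: "('a::banach \<times> 'a) set"
  assumes nonneg: "nonnegative_operator A"
begin

lemma single_valued: "single_valued A" and subspace: "subspace A"
  using nonneg unfolding nonnegative_operator_def linear_operator_def by auto

lemma scale: "(u, v) \<in> A \<Longrightarrow> (c *\<^sub>R u, c *\<^sub>R v) \<in> A"
  using subspace_scale[OF subspace, of "(u, v)" c] by simp

lemma diff: "(u, v) \<in> A \<Longrightarrow> (u', v') \<in> A \<Longrightarrow> (u - u', v - v') \<in> A"
  using subspace_diff[OF subspace, of "(u, v)" "(u', v')"] by simp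

lemma add: "(u, v) \<in> A \<Longrightarrow> (u', v') \<in> A \<Longrightarrow> (u + u', v + v') \<in> A"
  using subspace_add[OF subspace, of "(u, v)" "(u', v')"] by simp

lemma zero: "(0, v) \<in> A \<Longrightarrow> v = 0"
  using subspace_0[OF subspace] single_valuedD[OF single_valued] by (metis zero_prod_def)

lemma single_valued_shift: "single_valued (shift \<mu> A)"
proof (rule single_valuedI)
  fix x y z assume "(x, y) \<in> shift \<mu> A" "(x, z) \<in> shift \<mu> A"
  then have "y - \<mu> *\<^sub>R x = z - \<mu> *\<^sub>R x"
    unfolding in_shift_iff by (rule single_valuedD[OF single_valued])
  then show "y = z" by simp
qed

lemma shift_resolvent: "0 < \<mu> \<Longrightarrow> zero_in_resolvent_set (shift \<mu> A)"
  using nonneg unfolding nonnegative_operator_def by simp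

lemma resolvent_in: "0 < \<mu> \<Longrightarrow> (resolvent A \<mu> f, f - \<mu> *\<^sub>R resolvent A \<mu> f) \<in> A"
  using zero_in_resolvent_setD(1)[OF single_valued_shift shift_resolvent]
  unfolding resolvent_def in_shift_iff by blast

lemma resolvent_eq: "0 < \<mu> \<Longrightarrow> (u, v) \<in> A \<Longrightarrow> resolvent A \<mu> (\<mu> *\<^sub>R u + v) = u"
  unfolding resolvent_def
  by (rule zero_in_resolvent_setD(2)[OF single_valued_shift shift_resolvent]) (simp_all add: in_shift_iff)

lemma bounded_linear_resolvent: "0 < \<mu> \<Longrightarrow> bounded_linear (resolvent A \<mu>)"
  using shift_resolvent unfolding zero_in_resolvent_set_def resolvent_def by blast

lemma resolvent_identity_op:
  assumes "0 < a" "0 < b"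
  shows "resolvent A a f - resolvent A b f = (b - a) *\<^sub>R resolvent A a (resolvent A b f)"
proof -
  interpret Ra: bounded_linear "resolvent A a" by (rule bounded_linear_resolvent[OF assms(1)])
  let ?u = "resolvent A b f"
  have e: "a *\<^sub>R ?u + (f - b *\<^sub>R ?u) = f - (b - a) *\<^sub>R ?u" by (simp add: algebra_simps)
  have "resolvent A a (f - (b - a) *\<^sub>R ?u) = ?u"
    using resolvent_eq[OF assms(1) resolvent_in[OF assms(2), of f]] unfolding e .
  then have "resolvent A a f - (b - a) *\<^sub>R resolvent A a ?u = ?u" unfolding Ra.diff Ra.scaleR .
  then show ?thesis by (metis add_diff_cancel_left' diff_add_cancel)
qed

lemma resolvent_injective: "0 < \<mu> \<Longrightarrow> resolvent A \<mu> f = 0 \<Longrightarrow> f = 0"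
  using resolvent_in[of \<mu> f] zero by simp

text \<open>With a constant of at least 1, M / \<mu> also bounds 1 / (\<mu> + 1), the entry of
  \<open>RA\<close> on the extra summand.\<close>

lemma ex_resolvent_bound: "\<exists>M\<ge>1. \<forall>\<mu>>0. \<forall>f. norm (resolvent A \<mu> f) \<le> M / \<mu> * norm f"
proof -
  obtain M where M: "\<And>\<mu>. 0 < \<mu> \<Longrightarrow> onorm (\<lambda>f. \<mu> *\<^sub>R resolvent A \<mu> f) \<le> M"
    using nonneg unfolding nonnegative_operator_def bdd_above_def by auto
  have "norm (resolvent A \<mu> f) \<le> max M 1 / \<mu> * norm f" if \<mu>: "0 < \<mu>" for \<mu> f
  proof -
    have bl: "bounded_linear (\<lambda>f. \<mu> *\<^sub>R resolvent A \<mu> f)"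
      by (rule bounded_linear_const_scaleR[OF bounded_linear_resolvent[OF \<mu>]])
    have "\<mu> * norm (resolvent A \<mu> f) \<le> onorm (\<lambda>f. \<mu> *\<^sub>R resolvent A \<mu> f) * norm f"
      using onorm[OF bl, of f] \<mu> by simp
    also have "\<dots> \<le> max M 1 * norm f" using M[OF \<mu>] by (intro mult_right_mono) auto
    finally show ?thesis using \<mu> by (simp add: field_simps)
  qed
  then show ?thesis by (intro exI[of _ "max M 1"]) auto
qed

text \<open>The resolvents of \<open>A \<oplus> I\<close> on \<open>X \<times> \<real>\<close>.\<close>

definition RA :: "real \<Rightarrow> 'a bop" where "RA \<mu> = diag (resolvent A \<mu>) (1 / (\<mu> + 1))"

lemma RA_vec_op: "0 < \<mu> \<Longrightarrow> RA \<mu> * vec_op u = vec_op (resolvent A \<mu> u)"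
  unfolding RA_def by (rule diag_vec_op[OF bounded_linear_resolvent])

lemma RA_injective: "0 < \<mu> \<Longrightarrow> RA \<mu> * x = 0 \<Longrightarrow> x = 0"
  unfolding RA_def by (rule diag_injective[OF bounded_linear_resolvent]) (auto dest: resolvent_injective)

lemma norm_RA_le:
  assumes "1 \<le> M" "\<And>f. norm (resolvent A \<mu> f) \<le> M / \<mu> * norm f" "0 < \<mu>"
  shows "norm (RA \<mu>) \<le> M / \<mu>"
  unfolding RA_def
proof (rule norm_diag_le[OF bounded_linear_resolvent[OF assms(3)] assms(2)])
  show "\<bar>1 / (\<mu> + 1)\<bar> \<le> M / \<mu>" using assms by (simp add: frac_le)
qed

lemma ex_resolvent_family: "\<exists>M. resolvent_family RA M"
proof -
  obtain M where M: "1 \<le> M" "\<And>\<mu> f. 0 < \<mu> \<Longrightarrow> norm (resolvent A \<mu> f) \<le> M / \<mu> * norm f"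
    using ex_resolvent_bound by blast
  have "resolvent_family RA M"
  proof
    fix a b :: real assume ab: "0 < a" "0 < b"
    note bl = bounded_linear_resolvent[OF ab(1)] bounded_linear_resolvent[OF ab(2)]
    have "1 / (a + 1) - 1 / (b + 1) = (b - a) * (1 / (a + 1) * (1 / (b + 1)))"
      using ab by (simp add: field_simps)
    then show "RA a - RA b = (b - a) *\<^sub>R (RA a * RA b)"
      unfolding RA_def diag_diff[OF bl] diag_mult[OF bl] diag_scaleR[OF bounded_linear_compose[OF bl]]
      using resolvent_identity_op[OF ab] by simp
  next
    fix a :: real assume "0 < a"
    then show "norm (RA a) \<le> M / a" by (intro norm_RA_le M)
  qed
  then show ?thesis by blast
qed

lemma eigen_resolvent:
  assumes "(u, lam *\<^sub>R u) \<in> A" "0 < \<mu>" "0 < lam"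
  shows "resolvent A \<mu> u = (1 / (lam + \<mu>)) *\<^sub>R u"
proof -
  interpret Ra: bounded_linear "resolvent A \<mu>" by (rule bounded_linear_resolvent[OF assms(2)])
  have "(lam + \<mu>) *\<^sub>R resolvent A \<mu> u = u"
    using resolvent_eq[OF assms(2,1)] by (simp add: Ra.scaleR flip: scaleR_add_left) (simp add: add.commute Ra.add Ra.scaleR scaleR_add_left)
  then have "(1 / (lam + \<mu>)) *\<^sub>R u = (1 / (lam + \<mu>)) *\<^sub>R ((lam + \<mu>) *\<^sub>R resolvent A \<mu> u)" by simp
  then show ?thesis using assms by simp
qed

text \<open>\<open>bounded_operator\<close> is an estimate on the domain only. The vectors n (A +
  n)^-1 f lie in the domain and differ from f by A (A + n)^-1 f, which is of order 1/n by that
  estimate. Their images are Cauchy, and A is closed because (A + 1)^-1 is continuous.\<close>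

lemma Domain_eq_UNIV_if_bounded:
  assumes bd: "bounded_operator A" shows "Domain A = UNIV"
proof -
  obtain K0 where K0: "\<And>u. u \<in> Domain A \<Longrightarrow> norm (app A u) \<le> K0 * norm u"
    using bd unfolding bounded_operator_def by blast
  define K where "K = max K0 0"
  have K: "norm v \<le> K * norm u" if "(u, v) \<in> A" for u v
  proof -
    have "norm v \<le> K0 * norm u" using K0[of u] app_eqI[OF single_valued that] that by auto
    also have "\<dots> \<le> K * norm u" unfolding K_def by (intro mult_right_mono) auto
    finally show ?thesis .
  qed
  obtain M where M: "1 \<le> M" "\<And>\<mu> f. 0 < \<mu> \<Longrightarrow> norm (resolvent A \<mu> f) \<le> M / \<mu> * norm f"
    using ex_resolvent_bound by blast
  have "f \<in> Domain A" for f
  proof -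
    define x where "x n = real (Suc n) *\<^sub>R resolvent A (real (Suc n)) f" for n
    define y where "y n = real (Suc n) *\<^sub>R (f - x n)" for n
    have xy: "(x n, y n) \<in> A" for n
      using scale[OF resolvent_in[of "real (Suc n)" f], of "real (Suc n)"] unfolding x_def y_def by simp
    have "norm (x n - f) \<le> K * M * norm f / real (Suc n)" for n
    proof -
      have "norm (f - x n) \<le> K * norm (resolvent A (real (Suc n)) f)"
        using K[OF resolvent_in[of "real (Suc n)" f]] unfolding x_def by simp
      also have "\<dots> \<le> K * (M / real (Suc n) * norm f)"
        by (intro mult_left_mono M) (auto simp: K_def)
      finally show ?thesis by (simp add: norm_minus_commute)
    qed
    then have xf: "x \<longlonglongrightarrow> f"
      using Lim_null_comparison[OF _ LIMSEQ_inverse_Suc[of "K * M * norm f"], of "\<lambda>n. x n - f"]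
      by (simp add: LIM_zero_iff del: of_nat_Suc)
    have "Cauchy y"
    proof (rule metric_CauchyI)
      fix e :: real assume e: "e > 0"
      have K1: "0 < K + 1" unfolding K_def by simp
      have "Cauchy x" using xf by (rule LIMSEQ_imp_Cauchy)
      then obtain N where N: "\<And>m n. m \<ge> N \<Longrightarrow> n \<ge> N \<Longrightarrow> dist (x m) (x n) < e / (K + 1)"
        using metric_CauchyD[of x "e / (K + 1)"] e K1 by auto
      have "dist (y m) (y n) < e" if "m \<ge> N" "n \<ge> N" for m n
      proof -
        have "norm (y m - y n) \<le> K * norm (x m - x n)" by (rule K[OF diff[OF xy xy]])
        also have "\<dots> \<le> (K + 1) * norm (x m - x n)" by (intro mult_right_mono) auto
        also have "\<dots> < (K + 1) * (e / (K + 1))"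
          using N[OF that] K1 by (intro mult_strict_left_mono) (auto simp: dist_norm)
        also have "\<dots> = e" using K1 by simp
        finally show ?thesis by (simp add: dist_norm)
      qed
      then show "\<exists>N. \<forall>m\<ge>N. \<forall>n\<ge>N. dist (y m) (y n) < e" by blast
    qed
    then obtain v where v: "y \<longlonglongrightarrow> v" using Cauchy_convergent_iff convergent_def by blast
    interpret R1: bounded_linear "resolvent A 1" by (rule bounded_linear_resolvent) simp
    have "(\<lambda>n. resolvent A 1 (x n + y n)) \<longlonglongrightarrow> resolvent A 1 (f + v)"
      by (intro R1.tendsto tendsto_intros xf v)
    moreover have "resolvent A 1 (x n + y n) = x n" for n using resolvent_eq[OF _ xy[of n], of 1] by simp
    ultimately have "resolvent A 1 (f + v) = f" using xf LIMSEQ_unique by simp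
    then show ?thesis using resolvent_in[of 1 "f + v"] by auto
  qed
  then show ?thesis by blast
qed

end

text \<open>The resolvents come from (\<mu> + A^-1)^-1 = (1/\<mu>) (1 - (1/\<mu>) (A + 1/\<mu>)^-1),
  which also yields the bound 1 + M.\<close>

lemma nonnegative_operator_converse:
  assumes A: "nonnegative_operator A" and inj: "inj_on (app A) (Domain A)"
  shows "nonnegative_operator (A\<inverse> :: ('a::banach \<times> 'a) set)"
proof -
  interpret nonneg_op A by unfold_locales (rule A)
  have sv: "single_valued (A\<inverse>)"
  proof (rule single_valuedI, goal_cases)
    case (1 v u u')
    then have "app A u = v" "app A u' = v" using app_eqI[OF single_valued] by auto
    then show ?case using inj_onD[OF inj, of u u'] 1 by auto
  qed
  have sub: "subspace (A\<inverse>)"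
    using subspace_0[OF subspace] add scale unfolding subspace_def by (auto simp: zero_prod_def)
  define r where "r \<mu> f = (1 / \<mu>) *\<^sub>R (f - (1 / \<mu>) *\<^sub>R resolvent A (1 / \<mu>) f)" for \<mu> f
  have svs: "single_valued (shift \<mu> (A\<inverse>))" for \<mu>
  proof (rule single_valuedI)
    fix x y z assume "(x, y) \<in> shift \<mu> (A\<inverse>)" "(x, z) \<in> shift \<mu> (A\<inverse>)"
    then have "y - \<mu> *\<^sub>R x = z - \<mu> *\<^sub>R x"
      unfolding in_shift_iff by (rule single_valuedD[OF sv])
    then show "y = z" by simp
  qed
  have blr: "bounded_linear (r \<mu>)" if "0 < \<mu>" for \<mu>
    unfolding r_def using bounded_linear_resolvent[of "1 / \<mu>"] that
    by (intro bounded_linear_const_scaleR bounded_linear_sub bounded_linear_ident) auto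
  have shift_conv: "(r \<mu> f, f) \<in> shift \<mu> (A\<inverse>)" if "0 < \<mu>" for \<mu> f
    using scale[OF resolvent_in[of "1 / \<mu>" f], of "1 / \<mu>"] that
    unfolding in_shift_iff converse_iff r_def by simp
  have r_eq: "r \<mu> w = u" if "0 < \<mu>" "(u, w) \<in> shift \<mu> (A\<inverse>)" for \<mu> u w
  proof -
    have "(w - \<mu> *\<^sub>R u, u) \<in> A" using that(2) unfolding in_shift_iff by simp
    from resolvent_eq[OF _ this, of "1 / \<mu>"] have "resolvent A (1 / \<mu>) ((1 / \<mu>) *\<^sub>R w) = w - \<mu> *\<^sub>R u"
      using that(1) by (simp add: scaleR_diff_right)
    then have "(1 / \<mu>) *\<^sub>R resolvent A (1 / \<mu>) w = w - \<mu> *\<^sub>R u"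
      using linear_simps(5)[OF bounded_linear_resolvent[of "1 / \<mu>"], of "1 / \<mu>" w] that(1) by simp
    then show ?thesis unfolding r_def using that(1) by simp
  qed
  have z: "zero_in_resolvent_set (shift \<mu> (A\<inverse>))" and res: "resolvent (A\<inverse>) \<mu> = r \<mu>" if "0 < \<mu>" for \<mu>
    using zero_in_resolvent_setI[OF svs blr[OF that] shift_conv[OF that] r_eq[OF that]]
    unfolding resolvent_def by blast+
  obtain M where M: "1 \<le> M" "\<And>\<mu> f. 0 < \<mu> \<Longrightarrow> norm (resolvent A \<mu> f) \<le> M / \<mu> * norm f"
    using ex_resolvent_bound by blast
  have "onorm (\<lambda>f. \<mu> *\<^sub>R resolvent (A\<inverse>) \<mu> f) \<le> 1 + M" if \<mu>: "0 < \<mu>" for \<mu>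
  proof (rule onorm_bound)
    fix f
    have "\<mu> *\<^sub>R resolvent (A\<inverse>) \<mu> f = f - (1 / \<mu>) *\<^sub>R resolvent A (1 / \<mu>) f"
      unfolding res[OF \<mu>] r_def using \<mu> by simp
    also have "norm \<dots> \<le> norm f + norm ((1 / \<mu>) *\<^sub>R resolvent A (1 / \<mu>) f)" by (rule norm_triangle_ineq4)
    also have "norm ((1 / \<mu>) *\<^sub>R resolvent A (1 / \<mu>) f) \<le> 1 / \<mu> * (M / (1 / \<mu>) * norm f)"
      using \<mu> mult_left_mono[OF M(2)[of "1 / \<mu>" f], of "1 / \<mu>"] by simp
    also have "\<dots> = M * norm f" using \<mu> by simp
    finally show "norm (\<mu> *\<^sub>R resolvent (A\<inverse>) \<mu> f) \<le> (1 + M) * norm f" by (simp add: algebra_simps)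
  qed (use M in simp)
  then show ?thesis
    unfolding nonnegative_operator_def linear_operator_def using sv sub z by (auto intro!: bdd_aboveI2)
qed

section \<open>The operators \<open>J\<^sup>s\<close>\<close>

lemma relpow_graph:
  fixes b :: "'a \<Rightarrow> 'a"
  shows "range (\<lambda>u. (u, b u)) ^^ n = range (\<lambda>u. (u, (b ^^ n) u))"
proof (induction n)
  case (Suc n)
  have "(x, z) \<in> range (\<lambda>u. (u, b u)) ^^ Suc n \<longleftrightarrow> z = (b ^^ Suc n) x" for x z
  proof
    assume "(x, z) \<in> range (\<lambda>u. (u, b u)) ^^ Suc n"
    then obtain y where "(x, y) \<in> range (\<lambda>u. (u, b u)) ^^ n" "(y, z) \<in> range (\<lambda>u. (u, b u))"
      by (rule relpow_Suc_E)
    then show "z = (b ^^ Suc n) x" unfolding Suc by auto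
  next
    assume z: "z = (b ^^ Suc n) x"
    show "(x, z) \<in> range (\<lambda>u. (u, b u)) ^^ Suc n"
      by (rule relpow_Suc_I[where y="(b ^^ n) x"]) (auto simp: Suc z)
  qed
  then show ?case by (auto simp del: relpow.simps)
qed auto

text \<open>Couples an everywhere defined operator \<open>B\<close> on X with an algebra element
  \<open>b'\<close> acting on the columns \<open>vec_op u\<close> as \<open>B\<close> acts on
  \<open>u\<close>. It is instantiated by a bounded A, by a bounded A^-1 and by (A +
  \<epsilon>I)^-1, so that \<open>J\<close> is analysed once for all cases.\<close>

locale bounded_op = bounded_nonneg b' \<rho> M for b' :: "'a::banach bop" and \<rho> M +
  fixes b :: "'a \<Rightarrow> 'a" and r :: "real \<Rightarrow> 'a \<Rightarrow> 'a" and B :: "('a \<times> 'a) set"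
  assumes b_vec_op: "b' * vec_op u = vec_op (b u)"
    and \<rho>_vec_op: "0 < \<delta> \<Longrightarrow> \<rho> \<delta> * vec_op u = vec_op (r \<delta> u)"
    and B_graph: "B = range (\<lambda>u. (u, b u))"
begin

lemma app_B: "app B u = b u"
  by (rule app_eqI) (auto simp: B_graph intro!: single_valuedI)

lemma resolvent_B: "0 < \<delta> \<Longrightarrow> resolvent B \<delta> f = r \<delta> f"
proof -
  assume d: "0 < \<delta>"
  have left: "r \<delta> (\<delta> *\<^sub>R u + b u) = u" for u
  proof -
    have "\<rho> \<delta> * ((\<delta> *\<^sub>R 1 + b') * vec_op u) = vec_op u" using R_left[OF d] by (simp flip: mult.assoc)
    moreover have "(\<delta> *\<^sub>R 1 + b') * vec_op u = vec_op (\<delta> *\<^sub>R u + b u)"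
      by (simp add: distrib_right b_vec_op vec_op_add vec_op_scaleR)
    ultimately show ?thesis by (simp add: \<rho>_vec_op[OF d] vec_op_eq_iff)
  qed
  have right: "\<delta> *\<^sub>R r \<delta> u + b (r \<delta> u) = u" for u
  proof -
    have "(\<delta> *\<^sub>R 1 + b') * (\<rho> \<delta> * vec_op u) = vec_op u" using R_right[OF d] by (simp flip: mult.assoc)
    moreover have "(\<delta> *\<^sub>R 1 + b') * (\<rho> \<delta> * vec_op u) = vec_op (\<delta> *\<^sub>R r \<delta> u + b (r \<delta> u))"
      by (simp add: distrib_right \<rho>_vec_op[OF d] b_vec_op vec_op_add vec_op_scaleR)
    ultimately show ?thesis by (simp add: vec_op_eq_iff)
  qed
  show ?thesis unfolding resolvent_def
  proof (rule app_eqI)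
    show "single_valued ((shift \<delta> B)\<inverse>)"
    proof (rule single_valuedI)
      fix x y z assume "(x, y) \<in> (shift \<delta> B)\<inverse>" "(x, z) \<in> (shift \<delta> B)\<inverse>"
      then have "x = \<delta> *\<^sub>R y + b y" "x = \<delta> *\<^sub>R z + b z" by (auto simp: in_shift_iff B_graph algebra_simps)
      then show "y = z" using left[of y] left[of z] by (simp only:)
    qed
    have "f - \<delta> *\<^sub>R r \<delta> f = b (r \<delta> f)" using right[of f] by (simp add: algebra_simps)
    then show "(f, r \<delta> f) \<in> (shift \<delta> B)\<inverse>" by (simp add: in_shift_iff B_graph)
  qed
qed

text \<open>The integral for \<open>Pw t\<close> is known in the algebra; multiplying by the column
  \<open>vec_op x\<close> and applying \<open>ev\<close> brings it to X, where the scalar majorant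
  makes it a Bochner integral.\<close>

lemma J_below_one_eq:
  assumes t: "0 < t" "t < 1"
  shows "(x, y) \<in> J_below_one B t \<longleftrightarrow> vec_op y = Pw t * vec_op x"
proof -
  define c where "c = pi / sin (t * pi)"
  have c: "c > 0" "sin (t * pi) / pi = 1 / c" unfolding c_def using sin_pi_pos[OF t] by auto
  define f where "f \<mu> = (\<mu> powr (t - 1)) *\<^sub>R resolvent B \<mu> (app B x)" for \<mu>
  have vf: "vec_op (f \<mu>) = (\<mu> powr (t - 1) *\<^sub>R (b' * \<rho> \<mu>)) * vec_op x" if "0 < \<mu>" for \<mu>
    unfolding f_def using that
    by (simp add: resolvent_B app_B vec_op_scaleR b_R_commute mult.assoc b_vec_op \<rho>_vec_op)
  have "has_improper_integral (\<lambda>\<mu>. (\<mu> powr (t - 1) *\<^sub>R (b' * \<rho> \<mu>)) * vec_op x) ((c *\<^sub>R Pw t) * vec_op x)"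
    unfolding c_def by (rule has_improper_integral_linear[OF integral_power[OF t] bounded_linear_mult_left])
  then have i: "has_improper_integral (\<lambda>\<mu>. vec_op (f \<mu>)) ((c *\<^sub>R Pw t) * vec_op x)"
    by (rule has_improper_integral_cong) (simp add: vf)
  define I where "I = ev ((c *\<^sub>R Pw t) * vec_op x)"
  have fI: "has_improper_integral f I"
    using has_improper_integral_linear[OF i bounded_linear_ev] unfolding I_def ev_vec_op by simp
  have vI: "vec_op I = c *\<^sub>R (Pw t * vec_op x)"
    using has_improper_integral_unique[OF has_improper_integral_linear[OF fI bounded_linear_vec_op] i] by simp
  define k where "k = (1 + M + norm b' * M) * norm (vec_op x)"
  have "bochner_integral_pos f = I"
  proof (rule bochner_integral_pos_eqI[OF fI])
    show "has_improper_integral (\<lambda>\<mu>. k * (\<mu> powr (t - 1) / (\<mu> + 1))) (k * (1 powr (t - 1) * c))"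
      unfolding c_def
      by (rule has_improper_integral_linear[OF has_improper_integral_powr[OF t] bounded_linear_mult_right]) simp
    fix \<mu> :: real assume \<mu>: "\<mu> > 0"
    have "norm (f \<mu>) \<le> norm (vec_op (f \<mu>))" using norm_ev_le[of "vec_op (f \<mu>)"] by (simp add: ev_vec_op)
    also have "\<dots> \<le> norm (\<mu> powr (t - 1) *\<^sub>R (b' * \<rho> \<mu>)) * norm (vec_op x)"
      unfolding vf[OF \<mu>] by (rule norm_mult_ineq)
    also have "\<dots> = \<mu> powr (t - 1) * (norm (b' * \<rho> \<mu>) * norm (vec_op x))" by simp
    also have "\<dots> \<le> \<mu> powr (t - 1) * ((1 + M + norm b' * M) / (\<mu> + 1) * norm (vec_op x))"
      by (intro mult_left_mono mult_right_mono norm_b_R_le_divide \<mu>) auto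
    finally show "norm (f \<mu>) \<le> k * (\<mu> powr (t - 1) / (\<mu> + 1))" unfolding k_def by (simp add: mult_ac)
  qed
  moreover have "x \<in> Domain B" unfolding B_graph by auto
  then have "(x, y) \<in> J_below_one B t \<longleftrightarrow> y = (1 / c) *\<^sub>R bochner_integral_pos f"
    unfolding J_below_one_def c(2) f_def[abs_def] by blast
  ultimately have "(x, y) \<in> J_below_one B t \<longleftrightarrow> y = (1 / c) *\<^sub>R I" by simp
  also have "\<dots> \<longleftrightarrow> vec_op y = (1 / c) *\<^sub>R vec_op I"
    unfolding vec_op_eq_iff[symmetric, of y] vec_op_scaleR ..
  also have "(1 / c) *\<^sub>R vec_op I = Pw t * vec_op x" unfolding vI using c by simp
  finally show ?thesis .
qed

text \<open>The factor sin pi = 0 annihilates the integral term whatever its value is, and sin (pi /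
  2) = 1 leaves \<open>b x\<close>.\<close>

lemma J_one_eq: "(x, y) \<in> J_one B 1 \<longleftrightarrow> vec_op y = Pw 1 * vec_op x"
proof -
  have "Domain (B ^^ 2) = UNIV" unfolding B_graph relpow_graph by auto
  then have "(x, y) \<in> J_one B 1 \<longleftrightarrow> y = b x"
    unfolding J_one_def by (auto simp: app_B)
  then show ?thesis unfolding Pw_one b_vec_op vec_op_eq_iff .
qed

lemma J_eq:
  assumes s: "0 < s"
  shows "(u, v) \<in> J B s \<longleftrightarrow> vec_op v = Pw s * vec_op u"
proof -
  define n where "n = nat (\<lceil>s\<rceil> - 1)"
  define t where "t = s - real n"
  have "0 < \<lceil>s\<rceil>" using s by simp
  then have "real n = of_int \<lceil>s\<rceil> - 1" unfolding n_def by simp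
  then have t: "0 < t" "t \<le> 1" unfolding t_def using ceiling_correct[of s] by linarith+
  have bn: "vec_op ((b ^^ n) u) = b' ^ n * vec_op u" for u n
  proof (induction n)
    case (Suc n)
    then show ?case by (simp add: mult.assoc flip: b_vec_op)
  qed simp
  have "Pw s = Pw t * b' ^ n"
  \<comment> \<open>\<open>Pw_add\<close> covers positive exponents only, so n = 0 is treated
    separately.\<close>
  proof (cases "n = 0")
    case False
    then have "Pw s = Pw t * Pw (real n)" using Pw_add[OF t(1), of "real n"] unfolding t_def by simp
    then show ?thesis using Pw_of_nat False by simp
  qed (simp add: t_def)
  then have e: "Pw s * vec_op u = Pw t * vec_op ((b ^^ n) u)" by (simp add: bn mult.assoc)
  have "(u, v) \<in> J B s \<longleftrightarrow> ((b ^^ n) u, v) \<in> (if t < 1 then J_below_one B t else J_one B t)"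
    unfolding J_def Let_def n_def[symmetric] t_def[symmetric] B_graph relpow_graph by auto
  also have "\<dots> \<longleftrightarrow> vec_op v = Pw t * vec_op ((b ^^ n) u)"
    using J_below_one_eq[OF t(1)] J_one_eq t(2) by (cases "t < 1") auto
  finally show ?thesis unfolding e .
qed

lemma J_injective:
  assumes inj: "\<And>x. b' * x = 0 \<Longrightarrow> x = 0" and s: "0 < s" and J: "(w, u) \<in> J B s" "(w', u) \<in> J B s"
  shows "w = w'"
proof -
  have "Pw s * (vec_op w - vec_op w') = 0" using J unfolding J_eq[OF s] by (simp add: right_diff_distrib)
  then have "vec_op w - vec_op w' = 0" by (rule Pw_injective[rotated 2]) (rule inj, assumption, rule s)
  then show ?thesis by (simp add: vec_op_eq_iff)
qed

end

section \<open>Eigenvectors of fractional powers of nonnegative operators\<close>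

lemma (in bounded_op) single_valued_J:
  assumes s: "0 < s" shows "single_valued (J B s)"
proof (rule single_valuedI)
  fix x y z assume "(x, y) \<in> J B s" "(x, z) \<in> J B s"
  then have "vec_op y = vec_op z" unfolding J_eq[OF s] by (simp only:)
  then show "y = z" by (simp only: vec_op_eq_iff)
qed

context nonneg_op
begin

text \<open>The relation T u = lam S u says u = (1 + lam) (A + 1)^-1 u, which in particular places
  \<open>u\<close> in the domain of A.\<close>

lemma eigenvector_if_PT_eq:
  assumes s: "0 < s" "s < 2" and lam: "0 < lam" and rf: "resolvent_family RA M"
    and eq: "bounded_nonneg.Pw (resolvent_family.RT RA) s * vec_op u =
      lam powr s *\<^sub>R (bounded_nonneg.Pw (resolvent_family.RS RA 1) s * vec_op u)"
  shows "(u, lam *\<^sub>R u) \<in> A"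
proof -
  interpret RF: resolvent_family RA M by (rule rf)
  interpret R1: bounded_linear "resolvent A 1" by (rule bounded_linear_resolvent) simp
  have "(1 - RA 1) * vec_op u = lam *\<^sub>R (RA 1 * vec_op u)"
    by (rule RF.eigenvector_if_power_eigenvector[OF _ s lam eq]) (rule RA_injective[OF zero_less_one])
  then have "vec_op (u - resolvent A 1 u) = vec_op (lam *\<^sub>R resolvent A 1 u)"
    by (simp add: left_diff_distrib RA_vec_op vec_op_diff vec_op_scaleR)
  then have "u - resolvent A 1 u = lam *\<^sub>R resolvent A 1 u" by (simp only: vec_op_eq_iff)
  then have e: "(1 + lam) *\<^sub>R resolvent A 1 u = u" by (simp add: algebra_simps)
  have "((1 + lam) *\<^sub>R resolvent A 1 u, (1 + lam) *\<^sub>R (u - 1 *\<^sub>R resolvent A 1 u)) \<in> A"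
    by (rule scale[OF resolvent_in]) simp
  moreover have "(1 + lam) *\<^sub>R (u - 1 *\<^sub>R resolvent A 1 u) = lam *\<^sub>R u"
    using e by (simp add: scaleR_diff_right) (simp add: algebra_simps)
  ultimately show ?thesis unfolding e by simp
qed

lemma bounded_case:
  assumes bd: "bounded_operator A"
  shows "\<exists>M. bounded_op (diag (app A) 1) RA M (app A) (resolvent A) A"
proof -
  have D: "Domain A = UNIV" by (rule Domain_eq_UNIV_if_bounded[OF bd])
  have inA: "(u, app A u) \<in> A" for u using app_in[OF single_valued] D by blast
  obtain K where K: "\<And>u. norm (app A u) \<le> K * norm u"
    using bd unfolding bounded_operator_def D by blast
  have bl: "bounded_linear (app A)"
    by (rule bounded_linear_intro[where K=K])
      (auto intro!: app_eqI[OF single_valued] add scale inA simp: K mult.commute[of _ K])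
  obtain M where M: "1 \<le> M" "\<And>\<mu> f. 0 < \<mu> \<Longrightarrow> norm (resolvent A \<mu> f) \<le> M / \<mu> * norm f"
    using ex_resolvent_bound by blast
  have "bounded_op (diag (app A) 1) RA M (app A) (resolvent A) A"
  proof
    fix a :: real assume a: "0 < a"
    note blr = bounded_linear_resolvent[OF a]
    have sum: "a *\<^sub>R 1 + diag (app A) 1 = diag (\<lambda>x. a *\<^sub>R x + app A x) (a + 1)"
      unfolding diag_one[symmetric] diag_scaleR[OF bounded_linear_ident]
        diag_add[OF bounded_linear_const_scaleR[OF bounded_linear_ident] bl] by simp
    have bls: "bounded_linear (\<lambda>x. a *\<^sub>R x + app A x)"
      by (intro bounded_linear_add bounded_linear_const_scaleR bounded_linear_ident bl)
    have "a *\<^sub>R resolvent A a x + app A (resolvent A a x) = x" for x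
      using app_eqI[OF single_valued resolvent_in[OF a, of x]] by simp
    then show "(a *\<^sub>R 1 + diag (app A) 1) * RA a = 1"
      unfolding sum RA_def diag_mult[OF bls blr] using a by (simp add: diag_one)
    have "resolvent A a (a *\<^sub>R x + app A x) = x" for x by (rule resolvent_eq[OF a inA])
    then show "RA a * (a *\<^sub>R 1 + diag (app A) 1) = 1"
      unfolding sum RA_def diag_mult[OF blr bls] using a by (simp add: diag_one)
    show "norm (RA a) \<le> M / a" by (rule norm_RA_le[OF M(1) M(2)[OF a] a])
    show "RA a * vec_op u = vec_op (resolvent A a u)" for u by (rule RA_vec_op[OF a])
  next
    show "diag (app A) 1 * vec_op u = vec_op (app A u)" for u by (rule diag_vec_op[OF bl])
    show "A = range (\<lambda>u. (u, app A u))"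
      using inA app_eqI[OF single_valued] by force
  qed
  then show ?thesis by blast
qed

text \<open>Applying (A + 1)^-s to A^s u = lam^s u gives T^s u = lam^s S^s u by
  \<open>PS_Pw\<close>.\<close>

lemma eigenvector_if_J:
  assumes bd: "bounded_operator A" and s: "0 < s" "s < 2" and lam: "0 < lam"
    and J: "(u, lam powr s *\<^sub>R u) \<in> J A s"
  shows "(u, lam *\<^sub>R u) \<in> A"
proof -
  obtain M where "bounded_op (diag (app A) 1) RA M (app A) (resolvent A) A" using bounded_case[OF bd] by blast
  then interpret bounded_op "diag (app A) 1" RA M "app A" "resolvent A" A .
  have "PT s * vec_op u = PS 1 s * (Pw s * vec_op u)" using PS_Pw[OF s(1)] by (simp flip: mult.assoc)
  also have "Pw s * vec_op u = lam powr s *\<^sub>R vec_op u" using J unfolding J_eq[OF s(1)] vec_op_scaleR by simp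
  finally have "PT s * vec_op u = lam powr s *\<^sub>R (PS 1 s * vec_op u)" by simp
  then show ?thesis by (rule eigenvector_if_PT_eq[OF s lam resolvent_family_axioms])
qed

lemma J_if_eigenvector:
  assumes bd: "bounded_operator A" and s: "0 < s" and lam: "0 < lam" and e: "(u, lam *\<^sub>R u) \<in> A"
  shows "(u, lam powr s *\<^sub>R u) \<in> J A s" and "single_valued (J A s)"
proof -
  obtain M where "bounded_op (diag (app A) 1) RA M (app A) (resolvent A) A" using bounded_case[OF bd] by blast
  then interpret bounded_op "diag (app A) 1" RA M "app A" "resolvent A" A .
  have "diag (app A) 1 * vec_op u = lam *\<^sub>R vec_op u"
    unfolding b_vec_op app_eqI[OF single_valued e] vec_op_scaleR ..
  then show "(u, lam powr s *\<^sub>R u) \<in> J A s" unfolding J_eq[OF s] vec_op_scaleR using Pw_eigen[OF _ lam s] by metis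
  show "single_valued (J A s)" by (rule single_valued_J[OF s])
qed

section \<open>Unbounded operators: the powers of A + \<epsilon>I and their limit\<close>

lemma shift_case:
  assumes rf: "resolvent_family RA M" and e: "0 < \<epsilon>"
  shows "bounded_op (RA \<epsilon>) (resolvent_family.RS RA \<epsilon>) (1 + M) (resolvent A \<epsilon>)
    (\<lambda>\<delta> x. (1 / \<delta>) *\<^sub>R (x - (1 / \<delta>) *\<^sub>R resolvent A (\<epsilon> + 1 / \<delta>) x)) ((shift \<epsilon> A)\<inverse>)"
proof -
  interpret RF: resolvent_family RA M by (rule rf)
  show ?thesis
  proof (intro bounded_op.intro bounded_op_axioms.intro RF.bounded_nonneg_R[OF e] RA_vec_op[OF e])
    fix \<delta> :: real and u assume d: "0 < \<delta>"
    have "0 < \<epsilon> + 1 / \<delta>" using e d by (simp add: add_pos_pos)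
    then show "RF.RS \<epsilon> \<delta> * vec_op u = vec_op ((1 / \<delta>) *\<^sub>R (u - (1 / \<delta>) *\<^sub>R resolvent A (\<epsilon> + 1 / \<delta>) u))"
      unfolding RF.RS_def by (simp add: left_diff_distrib RA_vec_op vec_op_diff vec_op_scaleR)
  next
    have "(f, resolvent A \<epsilon> f) \<in> (shift \<epsilon> A)\<inverse>" for f
      using resolvent_in[OF e, of f] by (simp add: in_shift_iff)
    moreover have "resolvent A \<epsilon> f = u" if "(f, u) \<in> (shift \<epsilon> A)\<inverse>" for f u
      using resolvent_eq[OF e, of u "f - \<epsilon> *\<^sub>R u"] that by (simp add: in_shift_iff)
    ultimately show "(shift \<epsilon> A)\<inverse> = range (\<lambda>u. (u, resolvent A \<epsilon> u))" by force
  qed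
qed

text \<open>Makes \<open>pow_regular\<close> of the shifted operator the inverse of a power of the
  resolvent.\<close>

lemma unbounded_shift:
  assumes "\<not> bounded_operator A" shows "\<not> bounded_operator (shift \<mu> A)"
proof
  assume "bounded_operator (shift \<mu> A)"
  then obtain K where K: "\<And>u. u \<in> Domain (shift \<mu> A) \<Longrightarrow> norm (app (shift \<mu> A) u) \<le> K * norm u"
    unfolding bounded_operator_def by blast
  have "norm (app A u) \<le> (K + \<bar>\<mu>\<bar>) * norm u" if "u \<in> Domain A" for u
  proof -
    have "(u, \<mu> *\<^sub>R u + app A u) \<in> shift \<mu> A" using app_in[OF single_valued that] by (simp add: in_shift_iff)
    then have "norm (\<mu> *\<^sub>R u + app A u) \<le> K * norm u"
      using K[of u] app_eqI[OF single_valued_shift] by (metis Domain.DomainI)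
    moreover have "norm (app A u) \<le> norm (\<mu> *\<^sub>R u + app A u) + norm (\<mu> *\<^sub>R u)"
      using norm_triangle_ineq4[of "\<mu> *\<^sub>R u + app A u" "\<mu> *\<^sub>R u"] by simp
    ultimately show ?thesis by (simp add: algebra_simps)
  qed
  then show False using assms unfolding bounded_operator_def by blast
qed

lemma pow_regular_shift_iff:
  assumes ub: "\<not> bounded_operator A" and rf: "resolvent_family RA M" and e: "0 < \<epsilon>" and s: "0 < s"
  shows "(u, w) \<in> pow_regular (shift \<epsilon> A) s \<longleftrightarrow> vec_op u = bounded_nonneg.Pw (resolvent_family.RS RA \<epsilon>) s * vec_op w"
    and "single_valued (pow_regular (shift \<epsilon> A) s)"
proof -
  interpret RF: resolvent_family RA M by (rule rf)
  interpret bounded_op "RA \<epsilon>" "RF.RS \<epsilon>" "1 + M" "resolvent A \<epsilon>"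
    "\<lambda>\<delta> x. (1 / \<delta>) *\<^sub>R (x - (1 / \<delta>) *\<^sub>R resolvent A (\<epsilon> + 1 / \<delta>) x)" "(shift \<epsilon> A)\<inverse>"
    by (rule shift_case[OF rf e])
  have r: "pow_regular (shift \<epsilon> A) s = (J ((shift \<epsilon> A)\<inverse>) s)\<inverse>"
    unfolding pow_regular_def using unbounded_shift[OF ub] by simp
  show "(u, w) \<in> pow_regular (shift \<epsilon> A) s \<longleftrightarrow> vec_op u = bounded_nonneg.Pw (resolvent_family.RS RA \<epsilon>) s * vec_op w"
    unfolding r converse_iff by (rule J_eq[OF s])
  show "single_valued (pow_regular (shift \<epsilon> A) s)"
    unfolding r
  proof (rule single_valuedI, unfold converse_iff)
    fix x y z assume "(y, x) \<in> J ((shift \<epsilon> A)\<inverse>) s" "(z, x) \<in> J ((shift \<epsilon> A)\<inverse>) s"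
    then show "y = z" by (rule J_injective[rotated 2]) (rule RA_injective[OF e], assumption, rule s)
  qed
qed

lemma pow_limit_eigen:
  assumes ub: "\<not> bounded_operator A" and s: "0 < s" "s < 2" and lam: "0 < lam"
    and P: "(u, lam powr s *\<^sub>R u) \<in> pow_limit A s"
  shows "(u, lam *\<^sub>R u) \<in> A"
proof -
  obtain M where rf: "resolvent_family RA M" using ex_resolvent_family by blast
  interpret RF: resolvent_family RA M by (rule rf)
  define v where "v \<epsilon> = app (pow_regular (shift \<epsilon> A) s) u" for \<epsilon>
  have dom: "\<forall>\<^sub>F \<epsilon> in at_right 0. u \<in> Domain (pow_regular (shift \<epsilon> A) s)"
    and lim: "(v \<longlongrightarrow> lam powr s *\<^sub>R u) (at_right 0)"
    using P unfolding pow_limit_def v_def by auto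
  have "((\<lambda>\<epsilon>. RF.PS 1 s * vec_op (v \<epsilon>)) \<longlongrightarrow> RF.PS 1 s * vec_op (lam powr s *\<^sub>R u)) (at_right 0)"
    by (intro tendsto_intros bounded_linear.tendsto[OF bounded_linear_vec_op] lim)
  \<comment> \<open>Applying S^s replaces the unbounded (A + \<epsilon>I)^s by the bounded
    \<open>RF.E 1 \<epsilon> s\<close>, which converges to T^s.\<close>
  moreover have "\<forall>\<^sub>F \<epsilon> in at_right 0. RF.PS 1 s * vec_op (v \<epsilon>) = RF.E 1 \<epsilon> s * vec_op u"
    using dom eventually_at_right_less[of 0]
  proof eventually_elim
    case (elim \<epsilon>)
    have "(u, v \<epsilon>) \<in> pow_regular (shift \<epsilon> A) s"
      unfolding v_def by (rule app_in[OF pow_regular_shift_iff(2)[OF ub rf elim(2) s(1)] elim(1)])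
    then have u: "vec_op u = RF.PS \<epsilon> s * vec_op (v \<epsilon>)" unfolding pow_regular_shift_iff(1)[OF ub rf elim(2) s(1)] .
    have "RF.E 1 \<epsilon> s * vec_op u = (RF.E 1 \<epsilon> s * RF.PS \<epsilon> s) * vec_op (v \<epsilon>)" unfolding u by (simp only: mult.assoc)
    then show ?case unfolding RF.E_PS[OF elim(2) s(1)] by simp
  qed
  ultimately have "((\<lambda>\<epsilon>. RF.E 1 \<epsilon> s * vec_op u) \<longlongrightarrow> RF.PS 1 s * vec_op (lam powr s *\<^sub>R u)) (at_right 0)"
    by (rule Lim_transform_eventually)
  moreover have "((\<lambda>\<epsilon>. RF.E 1 \<epsilon> s * vec_op u) \<longlongrightarrow> RF.PT s * vec_op u) (at_right 0)"
    by (intro tendsto_intros RF.E_tendsto_PT s)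
  ultimately have "RF.PT s * vec_op u = RF.PS 1 s * vec_op (lam powr s *\<^sub>R u)"
    by (intro tendsto_unique[of "at_right (0::real)"]) simp_all
  then have "RF.PT s * vec_op u = lam powr s *\<^sub>R (RF.PS 1 s * vec_op u)" by (simp add: vec_op_scaleR)
  then show ?thesis by (rule eigenvector_if_PT_eq[OF s lam rf])
qed

lemma pow_limit_if_eigenvector:
  assumes ub: "\<not> bounded_operator A" and s: "0 < s" and lam: "0 < lam" and e: "(u, lam *\<^sub>R u) \<in> A"
  shows "(u, lam powr s *\<^sub>R u) \<in> pow_limit A s"
proof -
  obtain M where rf: "resolvent_family RA M" using ex_resolvent_family by blast
  have reg: "(u, (lam + \<epsilon>) powr s *\<^sub>R u) \<in> pow_regular (shift \<epsilon> A) s" if ep: "0 < \<epsilon>" for \<epsilon>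
  proof -
    interpret RF: resolvent_family RA M by (rule rf)
    interpret bounded_op "RA \<epsilon>" "RF.RS \<epsilon>" "1 + M" "resolvent A \<epsilon>"
      "\<lambda>\<delta> x. (1 / \<delta>) *\<^sub>R (x - (1 / \<delta>) *\<^sub>R resolvent A (\<epsilon> + 1 / \<delta>) x)" "(shift \<epsilon> A)\<inverse>"
      by (rule shift_case[OF rf ep])
    have "RA \<epsilon> * vec_op u = (1 / (lam + \<epsilon>)) *\<^sub>R vec_op u"
      unfolding RA_vec_op[OF ep] eigen_resolvent[OF e ep lam] vec_op_scaleR ..
    then have "Pw s * vec_op u = (1 / (lam + \<epsilon>)) powr s *\<^sub>R vec_op u"
      by (rule Pw_eigen) (use lam ep s in auto)
    then have "(lam + \<epsilon>) powr s *\<^sub>R (Pw s * vec_op u) = ((lam + \<epsilon>) * (1 / (lam + \<epsilon>))) powr s *\<^sub>R vec_op u"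
      using lam ep by (simp only: scaleR_scaleR powr_mult)
    then have "Pw s * vec_op ((lam + \<epsilon>) powr s *\<^sub>R u) = vec_op u"
      using lam ep by (simp add: vec_op_scaleR)
    then show ?thesis unfolding pow_regular_shift_iff(1)[OF ub rf ep s] by simp
  qed
  have ap: "app (pow_regular (shift \<epsilon> A) s) u = (lam + \<epsilon>) powr s *\<^sub>R u" if "0 < \<epsilon>" for \<epsilon>
    by (rule app_eqI[OF pow_regular_shift_iff(2)[OF ub rf that s] reg[OF that]])
  have "((\<lambda>\<epsilon>. (lam + \<epsilon>) powr s *\<^sub>R u) \<longlongrightarrow> (lam + 0) powr s *\<^sub>R u) (at_right 0)"
    using lam by (intro tendsto_intros) auto
  then have "((\<lambda>\<epsilon>. (lam + \<epsilon>) powr s *\<^sub>R u) \<longlongrightarrow> lam powr s *\<^sub>R u) (at_right 0)" by simp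
  then have "((\<lambda>\<epsilon>. app (pow_regular (shift \<epsilon> A) s) u) \<longlongrightarrow> lam powr s *\<^sub>R u) (at_right 0)"
    by (rule Lim_transform_eventually) (simp add: eventually_at_filter ap)
  moreover have "\<forall>\<^sub>F \<epsilon> in at_right 0. u \<in> Domain (pow_regular (shift \<epsilon> A) s)"
    using eventually_at_right_less[of 0] by eventually_elim (use reg in blast)
  ultimately show ?thesis unfolding pow_limit_def by simp
qed

section \<open>All cases together, and the logarithm\<close>

lemma zero_in_resolvent_set_imp:
  assumes z: "zero_in_resolvent_set A"
  shows "inj_on (app A) (Domain A)" and "bounded_operator (A\<inverse>)"
proof -
  show "inj_on (app A) (Domain A)" using z unfolding zero_in_resolvent_set_def bij_betw_def by simp
  have "bounded_linear (app (A\<inverse>))" using z unfolding zero_in_resolvent_set_def by simp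
  then obtain K where "\<And>x. norm (app (A\<inverse>) x) \<le> norm x * K" using bounded_linear.bounded by blast
  then show "bounded_operator (A\<inverse>)" unfolding bounded_operator_def by (metis mult.commute)
qed

lemma eigen_converse_iff:
  assumes "0 < lam" shows "(u, (1 / lam) *\<^sub>R u) \<in> A\<inverse> \<longleftrightarrow> (u, lam *\<^sub>R u) \<in> A"
proof
  assume "(u, (1 / lam) *\<^sub>R u) \<in> A\<inverse>"
  then show "(u, lam *\<^sub>R u) \<in> A" using scale[of "(1 / lam) *\<^sub>R u" u lam] assms by simp
next
  assume "(u, lam *\<^sub>R u) \<in> A"
  then show "(u, (1 / lam) *\<^sub>R u) \<in> A\<inverse>" using scale[of u "lam *\<^sub>R u" "1 / lam"] assms by simp
qed

theorem eigenvector_if_pos_power: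
  assumes s: "0 < s" "s < 2" and lam: "0 < lam" and P: "(u, lam powr s *\<^sub>R u) \<in> pos_power A s"
  shows "(u, lam *\<^sub>R u) \<in> A"
proof (cases "bounded_operator A")
  case True
  then show ?thesis using P eigenvector_if_J[OF True s lam] unfolding pos_power_def pow_regular_def by simp
next
  case ub: False
  show ?thesis
  proof (cases "zero_in_resolvent_set A")
    case True
    note z = zero_in_resolvent_set_imp[OF True]
    interpret inv: nonneg_op "A\<inverse>" by unfold_locales (rule nonnegative_operator_converse[OF nonneg z(1)])
    \<comment> \<open>As A^s is the inverse of (A^-1)^s in case (b), the power of A^-1 is evaluated
      at lam^s u, where it has the eigenvalue (1/lam)^s.\<close>
    let ?w = "lam powr s *\<^sub>R u"
    have "(?w, u) \<in> J (A\<inverse>) s" using P ub True unfolding pos_power_def pow_regular_def by simp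
    moreover have "u = (1 / lam) powr s *\<^sub>R ?w" using lam by (simp add: powr_divide)
    ultimately have "(?w, (1 / lam) powr s *\<^sub>R ?w) \<in> J (A\<inverse>) s" by simp
    then have "(?w, (1 / lam) *\<^sub>R ?w) \<in> A\<inverse>" by (rule inv.eigenvector_if_J[OF z(2) s, rotated]) (use lam in simp)
    then have "(?w, lam *\<^sub>R ?w) \<in> A" by (simp only: eigen_converse_iff[OF lam])
    from scale[OF this, of "1 / lam powr s"] show ?thesis using lam by simp
  next
    case False
    then show ?thesis using P ub pow_limit_eigen[OF ub s lam] unfolding pos_power_def by simp
  qed
qed

text \<open>The logarithm is built on \<open>app\<close>, a definite description, so
  single-valuedness is needed too. In case (b) it rests on the injectivity of (A^-1)^s, in case (c)
  on uniqueness of limits.\<close>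

theorem pos_power_if_eigenvector:
  assumes s: "0 < s" and lam: "0 < lam" and e: "(u, lam *\<^sub>R u) \<in> A"
  shows "(u, lam powr s *\<^sub>R u) \<in> pos_power A s" and "single_valued (pos_power A s)"
proof -
  have "(u, lam powr s *\<^sub>R u) \<in> pos_power A s \<and> single_valued (pos_power A s)"
  proof (cases "bounded_operator A")
    case True
    then show ?thesis using J_if_eigenvector[OF True s lam e] unfolding pos_power_def pow_regular_def by simp
  next
    case ub: False
    show ?thesis
    proof (cases "zero_in_resolvent_set A")
      case True
      note z = zero_in_resolvent_set_imp[OF True]
      interpret inv: nonneg_op "A\<inverse>" by unfold_locales (rule nonnegative_operator_converse[OF nonneg z(1)])
      have PA: "pos_power A s = (J (A\<inverse>) s)\<inverse>" using ub True unfolding pos_power_def pow_regular_def by simp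
      let ?w = "lam powr s *\<^sub>R u"
      have "(?w, lam *\<^sub>R ?w) \<in> A" using scale[OF e, of "lam powr s"] by (simp add: mult.commute)
      then have "(?w, (1 / lam) *\<^sub>R ?w) \<in> A\<inverse>" unfolding eigen_converse_iff[OF lam] .
      then have "(?w, (1 / lam) powr s *\<^sub>R ?w) \<in> J (A\<inverse>) s"
        by (rule inv.J_if_eigenvector(1)[OF z(2) s, rotated]) (use lam in simp)
      moreover have "(1 / lam) powr s *\<^sub>R ?w = u" using lam by (simp add: powr_divide)
      ultimately have 1: "(u, ?w) \<in> pos_power A s" unfolding PA by simp
      obtain M where "bounded_op (diag (app (A\<inverse>)) 1) inv.RA M (app (A\<inverse>)) (resolvent (A\<inverse>)) (A\<inverse>)"
        using inv.bounded_case[OF z(2)] by blast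
      then interpret B: bounded_op "diag (app (A\<inverse>)) 1" inv.RA M "app (A\<inverse>)" "resolvent (A\<inverse>)" "A\<inverse>" .
      have bl: "bounded_linear (app (A\<inverse>))" using True unfolding zero_in_resolvent_set_def by simp
      have i0: "f = 0" if "app (A\<inverse>) f = 0" for f
        using zero_in_resolvent_setD(1)[OF single_valued True, of f] zero that by simp
      have inj: "x = 0" if "diag (app (A\<inverse>)) 1 * x = 0" for x
        by (rule diag_injective[OF bl i0 _ that]) simp_all
      have "single_valued (pos_power A s)"
        unfolding PA
      proof (rule single_valuedI, unfold converse_iff)
        fix x y z assume "(y, x) \<in> J (A\<inverse>) s" "(z, x) \<in> J (A\<inverse>) s"
        then show "y = z" by (rule B.J_injective[rotated 2]) (rule inj, assumption, rule s)
      qed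
      then show ?thesis using 1 by blast
    next
      case False
      have PA: "pos_power A s = pow_limit A s" using ub False unfolding pos_power_def by simp
      have "single_valued (pow_limit A s)"
      proof (rule single_valuedI)
        fix x y z assume "(x, y) \<in> pow_limit A s" "(x, z) \<in> pow_limit A s"
        then have l: "((\<lambda>\<epsilon>. app (pow_regular (shift \<epsilon> A) s) x) \<longlongrightarrow> y) (at_right 0)"
          "((\<lambda>\<epsilon>. app (pow_regular (shift \<epsilon> A) s) x) \<longlongrightarrow> z) (at_right 0)"
          unfolding pow_limit_def by auto
        show "y = z" by (rule tendsto_unique[OF _ l]) simp
      qed
      then show ?thesis unfolding PA using pow_limit_if_eigenvector[OF ub s lam e] by blast
    qed
  qed
  then show "(u, lam powr s *\<^sub>R u) \<in> pos_power A s" "single_valued (pos_power A s)" by auto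
qed

lemma log_operator_if_eigenvector:
  assumes lam: "0 < lam" and e: "(u, lam *\<^sub>R u) \<in> A"
  shows "(u, ln lam *\<^sub>R u) \<in> log_operator A"
proof -
  have fp: "(u, lam powr s *\<^sub>R u) \<in> frac_power A s" "app (frac_power A s) u = lam powr s *\<^sub>R u" if "0 < s" for s
    using pos_power_if_eigenvector[OF that lam e] app_eqI that unfolding frac_power_def by auto
  have "((\<lambda>h. lam powr h) has_real_derivative ln lam) (at 0)"
    using lam by (auto intro!: derivative_eq_intros)
  then have "((\<lambda>h. (lam powr h - 1) / h) \<longlongrightarrow> ln lam) (at 0)"
    using lam by (simp add: has_field_derivative_iff)
  then have "((\<lambda>h. (lam powr h - 1) / h) \<longlongrightarrow> ln lam) (at_right 0)"
    using tendsto_within_subset by blast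
  then have "((\<lambda>h. ((lam powr h - 1) / h) *\<^sub>R u) \<longlongrightarrow> ln lam *\<^sub>R u) (at_right 0)"
    by (intro tendsto_intros)
  then have "((\<lambda>s. (1 / s) *\<^sub>R (app (frac_power A s) u - u)) \<longlongrightarrow> ln lam *\<^sub>R u) (at_right 0)"
  proof (rule Lim_transform_eventually)
    show "\<forall>\<^sub>F s in at_right 0. ((lam powr s - 1) / s) *\<^sub>R u = (1 / s) *\<^sub>R (app (frac_power A s) u - u)"
      using eventually_at_right_less[of 0]
      by eventually_elim (simp add: fp algebra_simps diff_divide_distrib)
  qed
  moreover have "\<forall>\<^sub>F s in at_right 0. u \<in> Domain (frac_power A s)"
    using eventually_at_right_less[of 0] by eventually_elim (use fp in blast)
  ultimately show ?thesis unfolding log_operator_def by simp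
qed

text \<open>Intended for A^-1 in the role of A, which accounts for the minus sign and the eigenvalue
  1/lam. The semigroup gives the equation for the exponent 1/2, and \<open>eigenvector_if_J\<close>
  does the rest.\<close>

lemma eigenvector_if_generator:
  assumes bd: "bounded_operator A" and lam: "0 < lam"
    and g: "((\<lambda>s. (1 / s) *\<^sub>R (app (pos_power A s) u - u)) \<longlongrightarrow> - (ln lam *\<^sub>R u)) (at_right 0)"
  shows "(u, (1 / lam) *\<^sub>R u) \<in> A"
proof -
  obtain M where "bounded_op (diag (app A) 1) RA M (app A) (resolvent A) A" using bounded_case[OF bd] by blast
  then interpret bounded_op "diag (app A) 1" RA M "app A" "resolvent A" A .
  have PA: "pos_power A s = J A s" for s using bd unfolding pos_power_def pow_regular_def by simp
  have vP: "vec_op (app (pos_power A s) u) = Pw s * vec_op u" if s: "0 < s" "s < 1" for s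
  proof -
    have "u \<in> Domain A" using Domain_eq_UNIV_if_bounded[OF bd] by blast
    then obtain y where "(u, y) \<in> J_below_one A s" unfolding J_below_one_def by blast
    then have "(u, y) \<in> J A s" by (simp only: J_below_one_eq[OF s] J_eq[OF s(1)])
    moreover have "single_valued (J A s)" by (rule single_valued_J[OF s(1)])
    ultimately have "app (pos_power A s) u = y" unfolding PA by (intro app_eqI)
    then show ?thesis using \<open>(u, y) \<in> J A s\<close> unfolding J_eq[OF s(1)] by simp
  qed
  have vl: "vec_op (- (ln lam *\<^sub>R u)) = - (ln lam *\<^sub>R vec_op u)"
    using vec_op_scaleR[of "- ln lam" u] by simp
  have "((\<lambda>s. vec_op ((1 / s) *\<^sub>R (app (pos_power A s) u - u))) \<longlongrightarrow> - (ln lam *\<^sub>R vec_op u)) (at_right 0)"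
    using bounded_linear.tendsto[OF bounded_linear_vec_op g] unfolding vl .
  moreover have "\<forall>\<^sub>F s in at_right 0. vec_op ((1 / s) *\<^sub>R (app (pos_power A s) u - u)) = (1 / s) *\<^sub>R (Pw s * vec_op u - vec_op u)"
  proof -
    have "\<forall>\<^sub>F s in at_right (0::real). s \<in> {0<..<1}" by (rule eventually_at_right_real) simp
    then show ?thesis by eventually_elim (simp add: vec_op_scaleR vec_op_diff vP)
  qed
  ultimately have "((\<lambda>s. (1 / s) *\<^sub>R (Pw s * vec_op u - vec_op u)) \<longlongrightarrow> - (ln lam *\<^sub>R vec_op u)) (at_right 0)"
    by (rule Lim_transform_eventually)
  from Pw_half_if_generator[OF this lam] have h: "lam powr (1/2) *\<^sub>R (Pw (1/2) * vec_op u) = vec_op u" .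
  have "Pw (1/2) * vec_op u = (1 / lam) powr (1/2) *\<^sub>R (lam powr (1/2) *\<^sub>R (Pw (1/2) * vec_op u))"
    using lam by (simp add: powr_divide)
  also have "\<dots> = vec_op ((1 / lam) powr (1/2) *\<^sub>R u)" unfolding h vec_op_scaleR ..
  finally have "(u, (1 / lam) powr (1/2) *\<^sub>R u) \<in> J A (1/2)" by (simp add: J_eq)
  then show ?thesis by (rule eigenvector_if_J[OF bd, rotated 3]) (use lam in auto)
qed

end

theorem theorem3p1:
  fixes A :: "('a::banach \<times> 'a) set" and u :: 'a and lam :: real
  assumes "nonnegative_operator A" and "lam > 0"
  shows
    "((\<exists>s. 0 < s \<and> s < 2 \<and> (u, (lam powr s) *\<^sub>R u) \<in> frac_power A s) \<longrightarrow>
        (u, ln lam *\<^sub>R u) \<in> log_operator A)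
   \<and> (inj_on (app A) (Domain A) \<longrightarrow>
        ((\<exists>s. 0 < s \<and> s < 2 \<and> (u, (lam powr s) *\<^sub>R u) \<in> frac_power A s) \<longleftrightarrow>
           (\<forall>s>0. (u, (lam powr s) *\<^sub>R u) \<in> frac_power A s))
      \<and> ((\<exists>s. 0 < s \<and> s < 2 \<and> (u, (lam powr (- s)) *\<^sub>R u) \<in> frac_power A (- s)) \<longleftrightarrow>
           (\<forall>s>0. (u, (lam powr (- s)) *\<^sub>R u) \<in> frac_power A (- s)))
      \<and> ((\<exists>s. 0 < s \<and> s < 2 \<and> (u, (lam powr s) *\<^sub>R u) \<in> frac_power A s) \<longrightarrow>
           (u, ln lam *\<^sub>R u) \<in> log_operator A)
      \<and> ((\<exists>s. 0 < s \<and> s < 2 \<and> (u, (lam powr (- s)) *\<^sub>R u) \<in> frac_power A (- s)) \<longrightarrow>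
           (u, ln lam *\<^sub>R u) \<in> log_operator A))
   \<and> (zero_in_resolvent_set A \<longrightarrow>
        (u, - (ln lam *\<^sub>R u)) \<in> generator (\<lambda>s. frac_power A (- s)) \<longrightarrow>
          (\<forall>s>0. (u, (lam powr s) *\<^sub>R u) \<in> frac_power A s)
        \<and> (\<forall>s>0. (u, (lam powr (- s)) *\<^sub>R u) \<in> frac_power A (- s)))"
proof -
  interpret nonneg_op A by unfold_locales (rule assms(1))
  note lam = assms(2)
  let ?eigen = "(u, lam *\<^sub>R u) \<in> A"
  have fpos: "frac_power A s = pos_power A s" if "0 < s" for s
    using that unfolding frac_power_def by simp
  have fneg: "frac_power A (- s) = pos_power (A\<inverse>) s" if "0 < s" for s
    using that unfolding frac_power_def by simp
  \<comment> \<open>Turns statements on negative powers of A and lam into statements on positive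
    powers of A^-1 and 1/lam.\<close>
  have lam_neg: "lam powr (- s) = (1 / lam) powr s" for s
    using lam by (simp add: powr_minus_divide powr_divide)
  have lam_inv: "0 < 1 / lam" using lam by simp
  have pos_imp: ?eigen if "\<exists>s. 0 < s \<and> s < 2 \<and> (u, (lam powr s) *\<^sub>R u) \<in> frac_power A s"
    using that eigenvector_if_pos_power[OF _ _ lam] fpos by fastforce
  have pos_all: "(u, (lam powr s) *\<^sub>R u) \<in> frac_power A s" if ?eigen "0 < s" for s
    using pos_power_if_eigenvector(1)[OF that(2) lam that(1)] fpos[OF that(2)] by simp
  have one: "0 < (1::real) \<and> 1 < (2::real)" by simp
  have neg: "((\<exists>s. 0 < s \<and> s < 2 \<and> (u, (lam powr (- s)) *\<^sub>R u) \<in> frac_power A (- s)) \<longrightarrow> ?eigen)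
      \<and> (?eigen \<longrightarrow> (\<forall>s>0. (u, (lam powr (- s)) *\<^sub>R u) \<in> frac_power A (- s)))"
    if inj: "inj_on (app A) (Domain A)"
  proof -
    interpret inv: nonneg_op "A\<inverse>" by unfold_locales (rule nonnegative_operator_converse[OF assms(1) inj])
    have "?eigen" if s: "0 < s" "s < 2" and P: "(u, (lam powr (- s)) *\<^sub>R u) \<in> frac_power A (- s)" for s
      using inv.eigenvector_if_pos_power[OF s lam_inv, of u] P
      unfolding fneg[OF s(1)] lam_neg eigen_converse_iff[OF lam] by blast
    moreover have "(u, (lam powr (- s)) *\<^sub>R u) \<in> frac_power A (- s)" if e: ?eigen and s: "0 < s" for s
      using inv.pos_power_if_eigenvector(1)[OF s lam_inv, of u] e
      unfolding fneg[OF s] lam_neg eigen_converse_iff[OF lam] by blast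
    ultimately show ?thesis by blast
  qed
  have gen: ?eigen if z: "zero_in_resolvent_set A"
    and g: "(u, - (ln lam *\<^sub>R u)) \<in> generator (\<lambda>s. frac_power A (- s))"
  proof -
    note z' = zero_in_resolvent_set_imp[OF z]
    interpret inv: nonneg_op "A\<inverse>" by unfold_locales (rule nonnegative_operator_converse[OF assms(1) z'(1)])
    have "((\<lambda>s. (1 / s) *\<^sub>R (app (frac_power A (- s)) u - u)) \<longlongrightarrow> - (ln lam *\<^sub>R u)) (at_right 0)"
      using g unfolding generator_def by simp
    then have "((\<lambda>s. (1 / s) *\<^sub>R (app (pos_power (A\<inverse>) s) u - u)) \<longlongrightarrow> - (ln lam *\<^sub>R u)) (at_right 0)"
      by (rule Lim_transform_eventually) (simp add: eventually_at_filter fneg)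
    then have "(u, (1 / lam) *\<^sub>R u) \<in> A\<inverse>" by (rule inv.eigenvector_if_generator[OF z'(2) lam])
    then show ?thesis unfolding eigen_converse_iff[OF lam] .
  qed
  note log = log_operator_if_eigenvector[OF lam]
  show ?thesis
  proof (intro conjI impI)
    assume inj: "inj_on (app A) (Domain A)"
    show "(\<exists>s. 0 < s \<and> s < 2 \<and> (u, (lam powr s) *\<^sub>R u) \<in> frac_power A s) \<longleftrightarrow>
        (\<forall>s>0. (u, (lam powr s) *\<^sub>R u) \<in> frac_power A s)"
      using pos_imp pos_all one by blast
    show "(\<exists>s. 0 < s \<and> s < 2 \<and> (u, (lam powr (- s)) *\<^sub>R u) \<in> frac_power A (- s)) \<longleftrightarrow>
        (\<forall>s>0. (u, (lam powr (- s)) *\<^sub>R u) \<in> frac_power A (- s))"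
      using neg[OF inj] one by blast
    show "(u, ln lam *\<^sub>R u) \<in> log_operator A"
      if "\<exists>s. 0 < s \<and> s < 2 \<and> (u, (lam powr (- s)) *\<^sub>R u) \<in> frac_power A (- s)"
      using neg[OF inj] log that by blast
  next
    assume "zero_in_resolvent_set A" "(u, - (ln lam *\<^sub>R u)) \<in> generator (\<lambda>s. frac_power A (- s))"
    note e = gen[OF this] and z = zero_in_resolvent_set_imp(1)[OF this(1)]
    show "\<forall>s>0. (u, (lam powr s) *\<^sub>R u) \<in> frac_power A s" using pos_all[OF e] by blast
    show "\<forall>s>0. (u, (lam powr (- s)) *\<^sub>R u) \<in> frac_power A (- s)" using neg[OF z] e by blast
  qed (use pos_imp log in blast)+
qed

end
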